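(* Let $\Sigma$ be a PA surface with $(\mathcal V,\theta)$ in a $3$-dimensional Riemannian manifold $M^3$, where $\mathcal V$ is an anti-torqued vector field along $\Sigma$ with potential function $f$ and $\theta$ is nowhere zero. Let $\{e_1,e_2\}$ be a local orthonormal frame on $\Sigma$ of principal directions with corresponding principal curvatures $\kappa_1,\kappa_2$, and suppose the tangential component of $\mathcal V$ satisfies $\mathcal T=\sin\theta\,e_1$. Put $$B:=\frac{f+\kappa_2\cos\theta}{\sin\theta}.$$ Then: (i) $e_1(\theta)=\kappa_1+f\cos\theta$ and $e_2(\theta)=0$. (ii) $\nabla^\Sigma_{e_1}e_1=\nabla^\Sigma_{e_1}e_2=0$, $\nabla^\Sigma_{e_2}e_1=Be_2$, $\nabla^\Sigma_{e_2}e_2=-Be_1$, and $[e_1,e_2]=-Be_2$. (iii) There is a local coordinate system $(u,v)$ on $\Sigma$ such that the induced metric is $$g^\Sigma=du^2+\big(p\,e^{\int B\,du}\big)^2dv^2,\qquad e_1=\partial_u,\qquad e_2=\big(p\,e^{\int B\,du}\big)^{-1}\partial_v,$$ where $p=p(v)$ is some positive function. (iv) The intrinsic and extrinsic curvatures of $\Sigma$ with respect to $(u,v)$ are $$K_{\mathrm{int}}=-\left(\frac{\partial B}{\partial u}+B^2\right),\qquad K_{\mathrm{ext}}=\left(\frac{d\theta}{du}-f\cos\theta\right)\kappa_2.$$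
   Context: Let $\nabla$ be the Levi-Civita connection of $M^3$, $\nabla^\Sigma$ the induced Levi-Civita connection of $\Sigma$, and $\mathfrak X(\Sigma)$ the smooth vector fields tangent to $\Sigma$. A vector field along $\Sigma$ is a smooth section of $TM|_\Sigma$. An orientable surface $\Sigma\subset M^3$ with unit normal field $\mathcal N$ is a prescribed angle (PA) surface with $(\mathcal V,\theta)$ if $\mathcal V$ is a unit vector field along $\Sigma$, $\theta:\Sigma\to[0,\frac{\pi}{2}]$ is a smooth function, and $\langle\mathcal V,\mathcal N\rangle=\cos\theta$. The unit field $\mathcal V$ is anti-torqued along $\Sigma$ with potential function $f\in C^\infty(\Sigma)$ if $\nabla_X\mathcal V=f\big(X-\langle X,\mathcal V\rangle\mathcal V\big)$ for all $X\in\mathfrak X(\Sigma)$. The tangential component $\mathcal T$ of $\mathcal V$ is defined by $\mathcal V=\mathcal T+\cos\theta\,\mathcal N$ with $\mathcal T\in\mathfrak X(\Sigma)$. The shape operator is $A(X)=-\nabla_X\mathcal N$, and $A(e_i)=\kappa_ie_i$. $K_{\mathrm{int}}$ is the Gaussian (sectional) curvature of the induced metric on $\Sigma$, and $K_{\mathrm{ext}}=\det A$. The symbol $\int B\,du$ denotes an antiderivative of $B$ with respect to $u$. *)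

theory Defs
  imports "HOL-Analysis.Analysis" "HOL-Library.Function_Algebras"
begin

section \<open>Smooth maps between open subsets of normed spaces\<close>

text \<open>Used for open sets only: derivatives are taken in the ambient space.\<close>

primrec times_differentiable_on ::
    "nat \<Rightarrow> 'a::real_normed_vector set \<Rightarrow> ('a \<Rightarrow> 'b::real_normed_vector) \<Rightarrow> bool" where
  "times_differentiable_on 0 S f \<longleftrightarrow> continuous_on S f"
| "times_differentiable_on (Suc k) S f \<longleftrightarrow>
     (\<forall>x\<in>S. f differentiable (at x)) \<and>
     (\<forall>v. times_differentiable_on k S (\<lambda>x. frechet_derivative f (at x) v))"

definition smooth_on :: "'a::real_normed_vector set \<Rightarrow> ('a \<Rightarrow> 'b::real_normed_vector) \<Rightarrow> bool" where
  "smooth_on S f \<longleftrightarrow> (\<forall>k. times_differentiable_on k S f)"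


section \<open>Smooth manifolds\<close>

text \<open>A chart is a pair of its domain and its coordinate map; the values of the coordinate map
  outside the domain are irrelevant.\<close>

type_synonym ('a, 'n) chart = "'a set \<times> ('a \<Rightarrow> real^'n)"

record ('a, 'n::finite) manifold =
  mtop :: "'a topology"
  charts :: "('a, 'n) chart set"

abbreviation points :: "('a, 'n::finite) manifold \<Rightarrow> 'a set" where
  "points M \<equiv> topspace (mtop M)"

abbreviation opens :: "('a, 'n::finite) manifold \<Rightarrow> 'a set \<Rightarrow> bool" where
  "opens M W \<equiv> openin (mtop M) W"

definition chart_inv :: "('a, 'n::finite) chart \<Rightarrow> real^'n \<Rightarrow> 'a" where
  "chart_inv c = inv_into (fst c) (snd c)"

definition is_chart :: "'a topology \<Rightarrow> ('a, 'n::finite) chart \<Rightarrow> bool" where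
  "is_chart X c \<longleftrightarrow> openin X (fst c) \<and> open (snd c ` fst c) \<and>
     homeomorphic_map (subtopology X (fst c)) (top_of_set (snd c ` fst c)) (snd c)"

definition smooth_transition :: "('a, 'n::finite) chart \<Rightarrow> ('a, 'n) chart \<Rightarrow> bool" where
  "smooth_transition c d \<longleftrightarrow> smooth_on (snd c ` (fst c \<inter> fst d)) (snd d \<circ> chart_inv c)"

definition smooth_manifold :: "('a, 'n::finite) manifold \<Rightarrow> bool" where
  "smooth_manifold M \<longleftrightarrow>
     Hausdorff_space (mtop M) \<and> second_countable (mtop M) \<and>
     (\<forall>c\<in>charts M. is_chart (mtop M) c) \<and>
     (\<Union>c\<in>charts M. fst c) = points M \<and>
     (\<forall>c\<in>charts M. \<forall>d\<in>charts M. smooth_transition c d) \<and>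
     (\<forall>c. is_chart (mtop M) c \<and> (\<forall>d\<in>charts M. smooth_transition c d \<and> smooth_transition d c)
        \<longrightarrow> c \<in> charts M)"

definition orientable :: "('a, 'n::finite) manifold \<Rightarrow> bool" where
  "orientable M \<longleftrightarrow>
     (\<exists>B \<subseteq> charts M. (\<Union>c\<in>B. fst c) = points M \<and>
        (\<forall>c\<in>B. \<forall>d\<in>B. \<forall>p\<in>fst c \<inter> fst d.
           det (matrix (frechet_derivative (snd d \<circ> chart_inv c) (at (snd c p)))) > 0))"

definition smooth_fun ::
    "('a, 'n::finite) manifold \<Rightarrow> 'a set \<Rightarrow> ('a \<Rightarrow> 'b::real_normed_vector) \<Rightarrow> bool" where
  "smooth_fun M W h \<longleftrightarrow> (\<forall>c\<in>charts M. smooth_on (snd c ` (fst c \<inter> W)) (h \<circ> chart_inv c))"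

definition partial_deriv :: "('a, 'n::finite) chart \<Rightarrow> 'n \<Rightarrow> ('a \<Rightarrow> real) \<Rightarrow> 'a \<Rightarrow> real" where
  "partial_deriv c k h p = frechet_derivative (h \<circ> chart_inv c) (at (snd c p)) (axis k 1)"


section \<open>Tangent vectors\<close>

text \<open>A tangent vector at a point \<open>p\<close> is the family of its component vectors in all charts around
  \<open>p\<close>, transforming by the derivatives of the coordinate changes. At all other arguments the family
  is zero, so that equality of tangent vectors is equality of functions.\<close>

type_synonym ('a, 'n) tangent = "('a, 'n) chart \<Rightarrow> real^'n"

type_synonym ('a, 'n) vfield = "'a \<Rightarrow> ('a, 'n) tangent"

instantiation "fun" :: (type, real_vector) real_vector
begin

definition scaleR_fun :: "real \<Rightarrow> ('a \<Rightarrow> 'b) \<Rightarrow> 'a \<Rightarrow> 'b" where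
  "scaleR_fun r v = (\<lambda>x. r *\<^sub>R v x)"

instance
  by standard (auto simp: scaleR_fun_def fun_eq_iff scaleR_add_right scaleR_add_left)

end

definition tangent_space :: "('a, 'n::finite) manifold \<Rightarrow> 'a \<Rightarrow> ('a, 'n) tangent set" where
  "tangent_space M p = {v.
     (\<forall>c\<in>charts M. \<forall>d\<in>charts M. p \<in> fst c \<inter> fst d \<longrightarrow>
        v d = frechet_derivative (snd d \<circ> chart_inv c) (at (snd c p)) (v c)) \<and>
     (\<forall>c. \<not> (c \<in> charts M \<and> p \<in> fst c) \<longrightarrow> v c = 0)}"

definition vec_in_chart ::
    "('a, 'n::finite) manifold \<Rightarrow> ('a, 'n) chart \<Rightarrow> 'a \<Rightarrow> real^'n \<Rightarrow> ('a, 'n) tangent" where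
  "vec_in_chart M c p w = (\<lambda>d. if d \<in> charts M \<and> p \<in> fst d
     then frechet_derivative (snd d \<circ> chart_inv c) (at (snd c p)) w else 0)"

definition coord_field ::
    "('a, 'n::finite) manifold \<Rightarrow> ('a, 'n) chart \<Rightarrow> 'n \<Rightarrow> ('a, 'n) vfield" where
  "coord_field M c k p = vec_in_chart M c p (axis k 1)"

definition chart_at :: "('a, 'n::finite) manifold \<Rightarrow> 'a \<Rightarrow> ('a, 'n) chart" where
  "chart_at M p = (SOME c. c \<in> charts M \<and> p \<in> fst c)"

text \<open>The derivative \<open>x(h)\<close> of a function \<open>h\<close> in the direction of \<open>x\<close>, a tangent vector at \<open>p\<close>.
  By the chain rule it is the same in every chart around \<open>p\<close>.\<close>

definition tderiv ::
    "('a, 'n::finite) manifold \<Rightarrow> 'a \<Rightarrow> ('a, 'n) tangent \<Rightarrow> ('a \<Rightarrow> 'b::real_normed_vector) \<Rightarrow> 'b" where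
  "tderiv M p x h = (let c = chart_at M p in
     frechet_derivative (h \<circ> chart_inv c) (at (snd c p)) (x c))"

definition smooth_vfield :: "('a, 'n::finite) manifold \<Rightarrow> 'a set \<Rightarrow> ('a, 'n) vfield \<Rightarrow> bool" where
  "smooth_vfield M W X \<longleftrightarrow> (\<forall>p\<in>W. X p \<in> tangent_space M p) \<and>
     (\<forall>c\<in>charts M. smooth_fun M (fst c \<inter> W) (\<lambda>p. X p c))"

definition lie_bracket ::
    "('a, 'n::finite) manifold \<Rightarrow> ('a, 'n) vfield \<Rightarrow> ('a, 'n) vfield \<Rightarrow> ('a, 'n) vfield" where
  "lie_bracket M X Y p = (\<lambda>c. if c \<in> charts M \<and> p \<in> fst c
     then tderiv M p (X p) (\<lambda>q. Y q c) - tderiv M p (Y p) (\<lambda>q. X q c) else 0)"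

text \<open>The determinant of an endomorphism of the tangent space at \<open>p\<close>, computed in a coordinate
  basis.\<close>

definition endo_det ::
    "('a, 'n::finite) manifold \<Rightarrow> 'a \<Rightarrow> (('a, 'n) tangent \<Rightarrow> ('a, 'n) tangent) \<Rightarrow> real" where
  "endo_det M p L = (let c = chart_at M p in det (matrix (\<lambda>w. L (vec_in_chart M c p w) c)))"


section \<open>Riemannian metrics, connections and curvature\<close>

type_synonym ('a, 'n) metric = "'a \<Rightarrow> ('a, 'n) tangent \<Rightarrow> ('a, 'n) tangent \<Rightarrow> real"

definition riemannian_metric :: "('a, 'n::finite) manifold \<Rightarrow> ('a, 'n) metric \<Rightarrow> bool" where
  "riemannian_metric M g \<longleftrightarrow>
     (\<forall>p\<in>points M. \<forall>x\<in>tangent_space M p. \<forall>y\<in>tangent_space M p.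
        g p x y = g p y x \<and> (x \<noteq> 0 \<longrightarrow> g p x x > 0) \<and>
        (\<forall>z\<in>tangent_space M p. \<forall>a b. g p (a *\<^sub>R x + b *\<^sub>R y) z = a * g p x z + b * g p y z)) \<and>
     (\<forall>c\<in>charts M. \<forall>i j. smooth_fun M (fst c) (\<lambda>p. g p (coord_field M c i p) (coord_field M c j p)))"

text \<open>A connection acts on vector fields defined on any open set, and its value at \<open>p\<close> depends on
  the field only near \<open>p\<close>; \<open>nabla Y p x\<close> is the covariant derivative of \<open>Y\<close> at \<open>p\<close> in the direction of
  the tangent vector \<open>x\<close>, so that the field usually written \<open>\<nabla>\<^sub>X Y\<close> is \<open>\<lambda>p. nabla Y p (X p)\<close>.\<close>

type_synonym ('a, 'n) connection =
  "('a, 'n) vfield \<Rightarrow> 'a \<Rightarrow> ('a, 'n) tangent \<Rightarrow> ('a, 'n) tangent"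

definition is_connection :: "('a, 'n::finite) manifold \<Rightarrow> ('a, 'n) connection \<Rightarrow> bool" where
  "is_connection M nabla \<longleftrightarrow> (\<forall>W Y. opens M W \<and> smooth_vfield M W Y \<longrightarrow>
     (\<forall>X. smooth_vfield M W X \<longrightarrow> smooth_vfield M W (\<lambda>p. nabla Y p (X p))) \<and>
     (\<forall>p\<in>W. \<forall>x\<in>tangent_space M p.
        nabla Y p x \<in> tangent_space M p \<and>
        (\<forall>y\<in>tangent_space M p. \<forall>a b.
           nabla Y p (a *\<^sub>R x + b *\<^sub>R y) = a *\<^sub>R nabla Y p x + b *\<^sub>R nabla Y p y) \<and>
        (\<forall>Z. smooth_vfield M W Z \<longrightarrow> nabla (\<lambda>q. Y q + Z q) p x = nabla Y p x + nabla Z p x) \<and>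
        (\<forall>h. smooth_fun M W h \<longrightarrow>
           nabla (\<lambda>q. h q *\<^sub>R Y q) p x = tderiv M p x h *\<^sub>R Y p + h p *\<^sub>R nabla Y p x) \<and>
        (\<forall>Z. smooth_vfield M W Z \<and> (\<forall>q\<in>W. Z q = Y q) \<longrightarrow> nabla Z p x = nabla Y p x)))"

definition levi_civita ::
    "('a, 'n::finite) manifold \<Rightarrow> ('a, 'n) metric \<Rightarrow> ('a, 'n) connection \<Rightarrow> bool" where
  "levi_civita M g nabla \<longleftrightarrow> is_connection M nabla \<and>
     (\<forall>W Y Z. opens M W \<and> smooth_vfield M W Y \<and> smooth_vfield M W Z \<longrightarrow>
        (\<forall>p\<in>W. nabla Z p (Y p) - nabla Y p (Z p) = lie_bracket M Y Z p \<and>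
           (\<forall>x\<in>tangent_space M p.
              tderiv M p x (\<lambda>q. g q (Y q) (Z q)) = g p (nabla Y p x) (Z p) + g p (Y p) (nabla Z p x))))"

definition riemann_curvature ::
    "('a, 'n::finite) manifold \<Rightarrow> ('a, 'n) connection \<Rightarrow>
     ('a, 'n) vfield \<Rightarrow> ('a, 'n) vfield \<Rightarrow> ('a, 'n) vfield \<Rightarrow> ('a, 'n) vfield" where
  "riemann_curvature M nabla X Y Z p =
     nabla (\<lambda>q. nabla Z q (Y q)) p (X p) - nabla (\<lambda>q. nabla Z q (X q)) p (Y p)
       - nabla Z p (lie_bracket M X Y p)"

text \<open>The sectional curvature of the tangent plane of a surface at \<open>p\<close>: the common value of the
  quotients below for all smooth fields \<open>X\<close>, \<open>Y\<close> defined near \<open>p\<close> and spanning the tangent plane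
  at \<open>p\<close>.\<close>

definition gauss_curvature ::
    "('a, 2) manifold \<Rightarrow> ('a, 2) metric \<Rightarrow> ('a, 2) connection \<Rightarrow> 'a \<Rightarrow> real" where
  "gauss_curvature M g nabla p = (THE K. \<forall>W X Y.
     opens M W \<and> p \<in> W \<and> smooth_vfield M W X \<and> smooth_vfield M W Y \<and>
     (\<forall>a b. a *\<^sub>R X p + b *\<^sub>R Y p = 0 \<longrightarrow> a = 0 \<and> b = 0) \<longrightarrow>
     K = g p (riemann_curvature M nabla X Y Y p) (X p) /
           (g p (X p) (X p) * g p (Y p) (Y p) - (g p (X p) (Y p))\<^sup>2))"


section \<open>Submanifolds\<close>

text \<open>The differential at \<open>p\<close> of the inclusion of \<open>S\<close> into \<open>M\<close>.\<close>

definition incl_diff ::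
    "('a, 'm::finite) manifold \<Rightarrow> ('a, 'n::finite) manifold \<Rightarrow> 'a \<Rightarrow> ('a, 'n) tangent \<Rightarrow> ('a, 'm) tangent" where
  "incl_diff M S p x = (\<lambda>c. if c \<in> charts M \<and> p \<in> fst c then tderiv S p x (snd c) else 0)"

text \<open>\<open>S\<close> carries its own topology and smooth structure, and the inclusion is a smooth immersion;
  embedded submanifolds are the special case in which the topology of \<open>S\<close> is the subspace
  topology.\<close>

definition submanifold :: "('a, 'm::finite) manifold \<Rightarrow> ('a, 'n::finite) manifold \<Rightarrow> bool" where
  "submanifold M S \<longleftrightarrow> smooth_manifold M \<and> smooth_manifold S \<and>
     continuous_map (mtop S) (mtop M) (\<lambda>p. p) \<and>
     (\<forall>c\<in>charts M. smooth_fun S (fst c \<inter> points S) (snd c)) \<and>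
     (\<forall>p\<in>points S. inj_on (incl_diff M S p) (tangent_space S p))"

definition induced_metric ::
    "('a, 'm::finite) manifold \<Rightarrow> ('a, 'n::finite) manifold \<Rightarrow> ('a, 'm) metric \<Rightarrow> ('a, 'n) metric" where
  "induced_metric M S g p x y = g p (incl_diff M S p x) (incl_diff M S p y)"

text \<open>Smooth sections of the restriction to \<open>S\<close> of the tangent bundle of \<open>M\<close>.\<close>

definition vfield_along ::
    "('a, 'm::finite) manifold \<Rightarrow> ('a, 'n::finite) manifold \<Rightarrow> ('a, 'm) vfield \<Rightarrow> bool" where
  "vfield_along M S V \<longleftrightarrow> (\<forall>p\<in>points S. V p \<in> tangent_space M p) \<and>
     (\<forall>c\<in>charts M. smooth_fun S (fst c \<inter> points S) (\<lambda>p. V p c))"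

text \<open>The covariant derivative in the direction of \<open>x\<close>, tangent to \<open>S\<close>, of a field along \<open>S\<close>, i.e. the
  pullback of the connection of \<open>M\<close> by the inclusion. Writing \<open>V = \<Sum>k. V\<^sup>k \<partial>\<^sub>k\<close> in a chart of \<open>M\<close>, it is
  \<open>\<Sum>k. x(V\<^sup>k) \<partial>\<^sub>k + V\<^sup>k \<nabla>\<^sub>x \<partial>\<^sub>k\<close>; its components in each chart are given by this formula in that
  chart.\<close>

definition covderiv_along ::
    "('a, 'm::finite) manifold \<Rightarrow> ('a, 'n::finite) manifold \<Rightarrow> ('a, 'm) connection \<Rightarrow>
     ('a, 'm) vfield \<Rightarrow> 'a \<Rightarrow> ('a, 'n) tangent \<Rightarrow> ('a, 'm) tangent" where
  "covderiv_along M S nabla V p x = (\<lambda>c. if c \<in> charts M \<and> p \<in> fst c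
     then tderiv S p x (\<lambda>q. V q c)
       + (\<Sum>k\<in>UNIV. (V p c $ k) *\<^sub>R nabla (coord_field M c k) p (incl_diff M S p x) c)
     else 0)"

definition unit_vfield_along ::
    "('a, 'm::finite) manifold \<Rightarrow> ('a, 'n::finite) manifold \<Rightarrow> ('a, 'm) metric \<Rightarrow> ('a, 'm) vfield \<Rightarrow> bool" where
  "unit_vfield_along M S g V \<longleftrightarrow> vfield_along M S V \<and> (\<forall>p\<in>points S. g p (V p) (V p) = 1)"

definition unit_normal ::
    "('a, 'm::finite) manifold \<Rightarrow> ('a, 'n::finite) manifold \<Rightarrow> ('a, 'm) metric \<Rightarrow> ('a, 'm) vfield \<Rightarrow> bool" where
  "unit_normal M S g N \<longleftrightarrow> unit_vfield_along M S g N \<and>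
     (\<forall>p\<in>points S. \<forall>x\<in>tangent_space S p. g p (N p) (incl_diff M S p x) = 0)"

definition shape_operator ::
    "('a, 'm::finite) manifold \<Rightarrow> ('a, 'n::finite) manifold \<Rightarrow> ('a, 'm) connection \<Rightarrow> ('a, 'm) vfield \<Rightarrow>
     ('a \<Rightarrow> ('a, 'n) tangent \<Rightarrow> ('a, 'n) tangent) \<Rightarrow> bool" where
  "shape_operator M S nabla N A \<longleftrightarrow> (\<forall>p\<in>points S. \<forall>x\<in>tangent_space S p.
     A p x \<in> tangent_space S p \<and> incl_diff M S p (A p x) = - covderiv_along M S nabla N p x)"


section \<open>Prescribed angle surfaces and anti-torqued fields\<close>

definition PA_surface ::
    "('a, 3) manifold \<Rightarrow> ('a, 3) metric \<Rightarrow> ('a, 2) manifold \<Rightarrow> ('a, 3) vfield \<Rightarrow>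
     ('a, 3) vfield \<Rightarrow> ('a \<Rightarrow> real) \<Rightarrow> bool" where
  "PA_surface M g S N V \<theta> \<longleftrightarrow>
     submanifold M S \<and> orientable S \<and> unit_normal M S g N \<and> unit_vfield_along M S g V \<and>
     smooth_fun S (points S) \<theta> \<and>
     (\<forall>p\<in>points S. \<theta> p \<in> {0..pi/2} \<and> g p (V p) (N p) = cos (\<theta> p))"

definition anti_torqued_along ::
    "('a, 'm::finite) manifold \<Rightarrow> ('a, 'm) metric \<Rightarrow> ('a, 'm) connection \<Rightarrow> ('a, 'n::finite) manifold \<Rightarrow>
     ('a, 'm) vfield \<Rightarrow> ('a \<Rightarrow> real) \<Rightarrow> bool" where
  "anti_torqued_along M g nabla S V f \<longleftrightarrow>
     unit_vfield_along M S g V \<and> smooth_fun S (points S) f \<and>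
     (\<forall>p\<in>points S. \<forall>x\<in>tangent_space S p.
        covderiv_along M S nabla V p x =
          f p *\<^sub>R (incl_diff M S p x - g p (incl_diff M S p x) (V p) *\<^sub>R V p))"

definition tangential_component ::
    "('a, 3) manifold \<Rightarrow> ('a, 2) manifold \<Rightarrow> ('a, 3) vfield \<Rightarrow> ('a, 3) vfield \<Rightarrow> ('a \<Rightarrow> real) \<Rightarrow>
     ('a, 2) vfield \<Rightarrow> bool" where
  "tangential_component M S N V \<theta> T \<longleftrightarrow> smooth_vfield S (points S) T \<and>
     (\<forall>p\<in>points S. V p = incl_diff M S p (T p) + cos (\<theta> p) *\<^sub>R N p)"

text \<open>In a chart \<open>c = (u, v)\<close>, an antiderivative of \<open>B\<close> with respect to \<open>u\<close>.\<close>

definition antiderivative_u ::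
    "('a, 2) manifold \<Rightarrow> ('a, 2) chart \<Rightarrow> ('a \<Rightarrow> real) \<Rightarrow> ('a \<Rightarrow> real) \<Rightarrow> bool" where
  "antiderivative_u S c B G \<longleftrightarrow> smooth_fun S (fst c) G \<and> (\<forall>q\<in>fst c. partial_deriv c 1 G q = B q)"

end

theory Submission
  imports Defs
begin

text \<open>Let \<open>E\<^sub>i\<close> be the image of \<open>e\<^sub>i\<close> in the tangent bundle of \<open>M\<close>. Differentiating \<open>\<langle>V, N\<rangle> = cos \<theta>\<close> and
  \<open>\<langle>V, E\<^sub>2\<rangle> = 0\<close> along \<open>e\<^sub>1\<close> and \<open>e\<^sub>2\<close>, where \<open>V = sin \<theta> E\<^sub>1 + cos \<theta> N\<close> is anti-torqued, gives the derivatives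
  of \<open>\<theta>\<close> and the products \<open>\<langle>\<nabla>\<^bsub>e\<^sub>i\<^esub> E\<^sub>2, E\<^sub>1\<rangle>\<close>, hence \<open>[e\<^sub>1, e\<^sub>2] = - B e\<^sub>2\<close>, and this bracket determines the
  Levi-Civita connection of the surface.

  Because of the bracket, the form dual to \<open>e\<^sub>1\<close> is closed, so locally it is \<open>du\<close>. A first integral \<open>v\<close>
  of \<open>e\<^sub>1\<close>, obtained from the flow of a scalar differential equation with smooth dependence on the
  initial value, completes \<open>u\<close> to a chart with \<open>e\<^sub>1 = \<partial>\<^sub>u\<close> and \<open>e\<^sub>2 = k \<partial>\<^sub>v\<close>. There the bracket reads
  \<open>k\<^sub>u = - B k\<close>, so \<open>1 / k\<close> is \<open>exp (\<integral> B du)\<close> up to a factor depending on \<open>v\<close> only, and the Gaussian curvature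
  is \<open>- k (1 / k)\<^sub>u\<^sub>u\<close>.\<close>

section \<open>Calculus of smooth maps\<close>

text \<open>The obstacle behind the ambient computation is that \<open>covderiv_along\<close> is a
  separate coordinate formula in each chart. For \<open>V\<close> and \<open>N\<close> the
  anti-torqued identity and the shape operator equation equate it with genuine tangent vectors,
  which settles all charts at once; for the frame fields only its version in one chart around the
  point is used. The decomposition of V is never differentiated: <V, E2> = 0 and <N, E2> = 0 are
  differentiated together, the second eliminates <N, D E2> from the first, and sin \<theta> > 0
  allows the division that produces \<open>B\<close>. \<open>\<kappa>2\<close>, and with it
  \<open>B\<close>, is given only pointwise, so regularity is recovered in the chart:
  \<open>k\<close> is a component of \<open>e2\<close>, and \<open>B\<close> is
  \<open>- k_u / k\<close>. Flows and inverse maps become smooth by bootstrapping, since their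
  derivatives are expressions in the maps themselves. \<open>gauss_curvature\<close> is a definite
  description over all pairs of fields, so the curvature is computed for arbitrary coefficients. The
  coordinate image is a box, so that each line of constant v is an interval and meets one fixed line
  u = u0.\<close>

abbreviation fderiv :: "('a::real_normed_vector \<Rightarrow> 'b::real_normed_vector) \<Rightarrow> 'a \<Rightarrow> 'a \<Rightarrow> 'b" where
  "fderiv f x \<equiv> frechet_derivative f (at x)"

lemma fderiv_at: "(f has_derivative f') (at x) \<Longrightarrow> fderiv f x = f'"
  using frechet_derivative_at by metis

lemma fderiv_works: "f differentiable at x \<Longrightarrow> (f has_derivative fderiv f x) (at x)"
  using frechet_derivative_works by blast

text \<open>\<open>frechet_derivative\<close> is a choice among all derivatives. Both choices are
  taken from the same predicate, so the values agree even at points where no derivative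
  exists.\<close>

lemma fderiv_cong_open:
  assumes "open S" "x \<in> S" "\<And>y. y \<in> S \<Longrightarrow> f y = g y"
  shows "fderiv f x = fderiv g x"
proof -
  have "(f has_derivative f') (at x) \<longleftrightarrow> (g has_derivative f') (at x)" for f'
    using has_derivative_transform_within_open[OF _ assms(1,2)] assms(3) by metis
  then show ?thesis
    unfolding frechet_derivative_def by simp
qed

lemma differentiable_cong_open:
  assumes "open S" "x \<in> S" "\<And>y. y \<in> S \<Longrightarrow> f y = g y"
  shows "f differentiable at x \<longleftrightarrow> g differentiable at x"
  using has_derivative_transform_within_open[OF _ assms(1,2)] assms(3)
  unfolding differentiable_def by metis

lemma times_differentiable_cong:
  assumes "open S" "\<And>y. y \<in> S \<Longrightarrow> f y = g y"
  shows "times_differentiable_on k S f \<longleftrightarrow> times_differentiable_on k S g"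
  using assms(2)
proof (induction k arbitrary: f g)
  case 0
  then show ?case by (simp cong: continuous_on_cong_simp)
next
  case (Suc k)
  have "times_differentiable_on k S (\<lambda>x. fderiv f x v) \<longleftrightarrow>
        times_differentiable_on k S (\<lambda>x. fderiv g x v)" for v
    by (rule Suc.IH) (use fderiv_cong_open[OF assms(1)] Suc.prems in metis)
  moreover have "f differentiable at x \<longleftrightarrow> g differentiable at x" if "x \<in> S" for x
    using differentiable_cong_open[OF assms(1) that] Suc.prems by blast
  ultimately show ?case by simp
qed

text \<open>Most closure properties below are inductions through this rule: it lets an explicit
  derivative formula take the place of \<open>frechet_derivative\<close>.\<close>

lemma times_differentiable_SucI:
  assumes "open S" "\<And>x. x \<in> S \<Longrightarrow> (f has_derivative f' x) (at x)"
    and "\<And>v. times_differentiable_on k S (\<lambda>x. f' x v)"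
  shows "times_differentiable_on (Suc k) S f"
proof -
  have "fderiv f x = f' x" if "x \<in> S" for x
    using fderiv_at assms(2) that by blast
  then have "times_differentiable_on k S (\<lambda>x. fderiv f x v)" for v
    using times_differentiable_cong[OF assms(1), where f = "\<lambda>x. fderiv f x v" and g = "\<lambda>x. f' x v"] assms(3)
    by simp
  then show ?thesis
    using assms(2) by (auto simp: differentiable_def)
qed

lemma times_differentiable_SucD:
  assumes "times_differentiable_on (Suc k) S f" "x \<in> S"
  shows "(f has_derivative fderiv f x) (at x)"
  using assms fderiv_works by auto

lemma times_differentiable_Suc_imp:
  "times_differentiable_on (Suc k) S f \<Longrightarrow> times_differentiable_on k S f"
proof (induction k arbitrary: f)
  case 0
  then show ?case
    by (auto intro!: continuous_at_imp_continuous_on differentiable_imp_continuous_within)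
next
  case (Suc k)
  then have "times_differentiable_on k S (\<lambda>x. fderiv f x v)" for v
    using Suc.IH[of "\<lambda>x. fderiv f x v"] by (simp only: times_differentiable_on.simps(2)[of "Suc k"])
  with Suc.prems show ?case
    by (simp only: times_differentiable_on.simps(2)) blast
qed

lemma times_differentiable_le:
  assumes "times_differentiable_on k S f" "j \<le> k"
  shows "times_differentiable_on j S f"
  using assms(2,1)
proof (induction k rule: dec_induct)
  case (step n)
  show ?case by (rule step.IH[OF times_differentiable_Suc_imp[OF step.prems]])
qed

lemma times_differentiable_subset:
  "times_differentiable_on k S f \<Longrightarrow> T \<subseteq> S \<Longrightarrow> times_differentiable_on k T f"
  by (induction k arbitrary: f) (auto intro: continuous_on_subset)

lemma times_differentiable_const: "times_differentiable_on k S (\<lambda>x. c)"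
  by (induction k arbitrary: c) auto

lemma times_differentiable_linear:
  assumes "bounded_linear L" "open S" "times_differentiable_on k S f"
  shows "times_differentiable_on k S (\<lambda>x. L (f x))"
  using assms(3)
proof (induction k arbitrary: f)
  case 0
  then show ?case
    using assms(1) by (auto intro: bounded_linear.continuous_on)
next
  case (Suc k)
  show ?case
  proof (rule times_differentiable_SucI[OF assms(2), where f' = "\<lambda>x v. L (fderiv f x v)"])
    fix x assume "x \<in> S"
    then show "((\<lambda>x. L (f x)) has_derivative (\<lambda>v. L (fderiv f x v))) (at x)"
      using times_differentiable_SucD[OF Suc.prems] bounded_linear.has_derivative[OF assms(1)] by blast
  next
    fix v
    show "times_differentiable_on k S (\<lambda>x. L (fderiv f x v))"
      using Suc by simp
  qed
qed

lemma times_differentiable_add: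
  assumes "open S" "times_differentiable_on k S f" "times_differentiable_on k S g"
  shows "times_differentiable_on k S (\<lambda>x. f x + g x)"
  using assms(2,3)
proof (induction k arbitrary: f g)
  case 0
  then show ?case by (simp add: continuous_on_add)
next
  case (Suc k)
  show ?case
  proof (rule times_differentiable_SucI[OF assms(1), where f' = "\<lambda>x v. fderiv f x v + fderiv g x v"])
    fix x assume "x \<in> S"
    then show "((\<lambda>x. f x + g x) has_derivative (\<lambda>v. fderiv f x v + fderiv g x v)) (at x)"
      using Suc.prems by (intro has_derivative_add times_differentiable_SucD)
  next
    fix v
    show "times_differentiable_on k S (\<lambda>x. fderiv f x v + fderiv g x v)"
      using Suc by simp
  qed
qed

lemma times_differentiable_bilinear:
  assumes "bounded_bilinear p" "open S" "times_differentiable_on k S f" "times_differentiable_on k S g"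
  shows "times_differentiable_on k S (\<lambda>x. p (f x) (g x))"
  using assms(3,4)
proof (induction k arbitrary: f g)
  case 0
  then show ?case
    using bounded_bilinear.continuous_on[OF assms(1)] by auto
next
  case (Suc k)
  show ?case
  proof (rule times_differentiable_SucI[OF assms(2),
        where f' = "\<lambda>x v. p (f x) (fderiv g x v) + p (fderiv f x v) (g x)"])
    fix x assume "x \<in> S"
    then show "((\<lambda>x. p (f x) (g x)) has_derivative
        (\<lambda>v. p (f x) (fderiv g x v) + p (fderiv f x v) (g x))) (at x)"
      using Suc.prems by (intro bounded_bilinear.FDERIV[OF assms(1)] times_differentiable_SucD)
  next
    fix v
    \<comment> \<open>The product rule also contains the undifferentiated factors, which must be
      weakened from level \<open>Suc k\<close> to level \<open>k\<close>.\<close>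
    have "times_differentiable_on k S f" "times_differentiable_on k S g"
      using Suc.prems times_differentiable_Suc_imp by blast+
    then show "times_differentiable_on k S (\<lambda>x. p (f x) (fderiv g x v) + p (fderiv f x v) (g x))"
      using Suc.prems by (intro times_differentiable_add[OF assms(2)] Suc.IH) auto
  qed
qed

lemma times_differentiable_Pair:
  fixes f :: "'a::real_normed_vector \<Rightarrow> 'b::real_normed_vector" and g :: "'a \<Rightarrow> 'c::real_normed_vector"
  assumes "open S" "times_differentiable_on k S f" "times_differentiable_on k S g"
  shows "times_differentiable_on k S (\<lambda>x. (f x, g x))"
proof -
  have "bounded_linear (\<lambda>y. (y, 0::'c))" "bounded_linear (\<lambda>y. (0::'b, y))"
    by (intro bounded_linear_Pair bounded_linear_ident bounded_linear_zero)+
  from times_differentiable_add[OF assms(1) times_differentiable_linear[OF this(1) assms(1,2)]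
      times_differentiable_linear[OF this(2) assms(1,3)]]
  show ?thesis by simp
qed

lemma times_differentiable_sum:
  assumes "open S" "\<And>i. i \<in> I \<Longrightarrow> times_differentiable_on k S (f i)"
  shows "times_differentiable_on k S (\<lambda>x. \<Sum>i\<in>I. f i x)"
proof (cases "finite I")
  case True
  then show ?thesis
    using assms(2) by (induction I rule: finite_induct)
      (auto intro: times_differentiable_const times_differentiable_add[OF assms(1)])
qed (simp add: times_differentiable_const)

text \<open>The definition of higher differentiability only takes derivatives in fixed directions.
  Whenever the direction varies with the point, this expansion rewrites the derivative as a finite
  sum of scalars times derivatives in basis directions.\<close>

lemma linear_Basis_expansion:
  fixes L :: "'a::euclidean_space \<Rightarrow> 'b::real_vector"
  assumes "linear L"
  shows "L w = (\<Sum>b\<in>Basis. (w \<bullet> b) *\<^sub>R L b)"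
proof -
  have "L w = L (\<Sum>b\<in>Basis. (w \<bullet> b) *\<^sub>R b)"
    by (simp add: euclidean_representation)
  then show ?thesis
    by (simp add: linear_sum[OF assms] linear_cmul[OF assms])
qed

text \<open>In the chain rule the outer derivative is taken in the direction
  \<open>fderiv f x v\<close>, which moves with x. Expanding it over \<open>Basis\<close> of the
  middle space leaves derivatives of g in fixed directions, to which the induction hypothesis
  applies; hence the Euclidean middle space.\<close>

lemma times_differentiable_compose:
  fixes f :: "'a::real_normed_vector \<Rightarrow> 'b::euclidean_space" and g :: "'b \<Rightarrow> 'c::real_normed_vector"
  assumes "open S" "open T" "f ` S \<subseteq> T" "times_differentiable_on k S f" "times_differentiable_on k T g"
  shows "times_differentiable_on k S (\<lambda>x. g (f x))"
  using assms(4,5)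
proof (induction k arbitrary: g)
  case 0
  then show ?case
    using continuous_on_compose2[OF _ _ assms(3)] by simp
next
  case (Suc k)
  have f: "times_differentiable_on k S f"
    using Suc.prems times_differentiable_Suc_imp by blast
  show ?case
  proof (rule times_differentiable_SucI[OF assms(1),
        where f' = "\<lambda>x v. \<Sum>b\<in>Basis. (fderiv f x v \<bullet> b) *\<^sub>R fderiv g (f x) b"])
    fix x assume x: "x \<in> S"
    then have g: "(g has_derivative fderiv g (f x)) (at (f x))"
      using times_differentiable_SucD[OF Suc.prems(2)] assms(3) by auto
    then have "linear (fderiv g (f x))"
      by (rule has_derivative_linear)
    then have "fderiv g (f x) \<circ> fderiv f x = (\<lambda>v. \<Sum>b\<in>Basis. (fderiv f x v \<bullet> b) *\<^sub>R fderiv g (f x) b)"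
      by (intro ext, unfold o_apply) (rule linear_Basis_expansion)
    then show "((\<lambda>x. g (f x)) has_derivative
        (\<lambda>v. \<Sum>b\<in>Basis. (fderiv f x v \<bullet> b) *\<^sub>R fderiv g (f x) b)) (at x)"
      using diff_chain_at[OF times_differentiable_SucD[OF Suc.prems(1) x] g] by (simp add: o_def)
  next
    fix v
    have "times_differentiable_on k S (\<lambda>x. fderiv g (f x) b)" for b
      using Suc.IH[OF f, of "\<lambda>y. fderiv g y b"] Suc.prems(2) by simp
    moreover have "times_differentiable_on k S (\<lambda>x. fderiv f x v \<bullet> b)" for b
      by (rule times_differentiable_linear[OF bounded_linear_inner_left assms(1)]) (use Suc.prems(1) in simp)
    ultimately show "times_differentiable_on k S (\<lambda>x. \<Sum>b\<in>Basis. (fderiv f x v \<bullet> b) *\<^sub>R fderiv g (f x) b)"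
      by (intro times_differentiable_sum[OF assms(1)]
          times_differentiable_bilinear[OF bounded_bilinear_scaleR assms(1)])
  qed
qed

text \<open>The derivative is a product of copies of \<open>inverse\<close> itself, so level
  \<open>k\<close> feeds level \<open>Suc k\<close>.\<close>

lemma times_differentiable_inverse: "times_differentiable_on k (- {0}) (inverse :: real \<Rightarrow> real)"
proof (induction k)
  case 0
  show ?case by (simp add: continuous_on_inverse)
next
  case (Suc k)
  show ?case
  proof (rule times_differentiable_SucI[where f' = "\<lambda>x v. - v * (inverse x * inverse x)"])
    show "open (- {0::real})" by (simp add: open_Compl)
    fix x :: real assume "x \<in> - {0}"
    then show "(inverse has_derivative (\<lambda>v. - v * (inverse x * inverse x))) (at x)"
      by (auto intro!: derivative_eq_intros)
  next
    fix v :: real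
    show "times_differentiable_on k (- {0}) (\<lambda>x. - v * (inverse x * inverse x))"
      by (intro times_differentiable_bilinear[OF bounded_bilinear_mult] times_differentiable_const Suc)
        auto
  qed
qed

lemma times_differentiable_ln: "times_differentiable_on k {0<..} (ln :: real \<Rightarrow> real)"
proof (cases k)
  case 0
  then show ?thesis by (simp add: continuous_on_ln)
next
  case (Suc j)
  have "times_differentiable_on (Suc j) {0<..} (ln :: real \<Rightarrow> real)"
  proof (rule times_differentiable_SucI[where f' = "\<lambda>x v. v * inverse x"])
    show "open ({0<..} :: real set)" by simp
    fix x :: real assume "x \<in> {0<..}"
    then show "(ln has_derivative (\<lambda>v. v * inverse x)) (at x)"
      by (auto intro!: derivative_eq_intros simp: divide_inverse)
  next
    fix v :: real
    have "times_differentiable_on j {0<..} (inverse :: real \<Rightarrow> real)"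
      using times_differentiable_inverse by (rule times_differentiable_subset) auto
    then show "times_differentiable_on j {0<..} (\<lambda>x. v * inverse x)"
      by (intro times_differentiable_bilinear[OF bounded_bilinear_mult] times_differentiable_const) auto
  qed
  then show ?thesis unfolding Suc .
qed

lemma times_differentiable_exp: "times_differentiable_on k S (exp :: real \<Rightarrow> real)"
proof -
  have "times_differentiable_on k UNIV (exp :: real \<Rightarrow> real)"
  proof (induction k)
    case 0
    show ?case unfolding times_differentiable_on.simps by (rule continuous_on_exp[OF continuous_on_id])
  next
    case (Suc k)
    show ?case
    proof (rule times_differentiable_SucI[where f' = "\<lambda>x v. v * exp x"])
      fix x :: real
      show "(exp has_derivative (\<lambda>v. v * exp x)) (at x)"
        by (auto intro!: derivative_eq_intros)
    next
      fix v :: real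
      show "times_differentiable_on k UNIV (\<lambda>x. v * exp x)"
        by (intro times_differentiable_bilinear[OF bounded_bilinear_mult] times_differentiable_const Suc)
          auto
    qed auto
  qed
  then show ?thesis
    by (rule times_differentiable_subset) simp
qed

lemma times_differentiable_id: "times_differentiable_on k UNIV (\<lambda>x::'a::real_normed_vector. x)"
proof (cases k)
  case (Suc j)
  have "times_differentiable_on (Suc j) UNIV (\<lambda>x::'a. x)"
    by (rule times_differentiable_SucI[where f' = "\<lambda>x v. v"]) (auto intro: times_differentiable_const)
  then show ?thesis unfolding Suc .
qed simp

section \<open>Closure properties of smooth maps\<close>

lemma smooth_on_times_differentiable: "smooth_on S f \<Longrightarrow> times_differentiable_on k S f"
  by (simp only: smooth_on_def)

lemma smooth_on_cong:
  "open S \<Longrightarrow> (\<And>y. y \<in> S \<Longrightarrow> f y = g y) \<Longrightarrow> smooth_on S f \<longleftrightarrow> smooth_on S g"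
  unfolding smooth_on_def by (intro iff_allI times_differentiable_cong)

lemma smooth_on_transform:
  assumes "smooth_on S f" "open S" "\<And>y. y \<in> S \<Longrightarrow> f y = g y"
  shows "smooth_on S g"
  using smooth_on_cong[OF assms(2,3)] assms(1) by simp

lemma smooth_on_subset: "smooth_on S f \<Longrightarrow> T \<subseteq> S \<Longrightarrow> smooth_on T f"
  by (simp only: smooth_on_def) (rule allI, rule times_differentiable_subset, erule spec)

lemma smooth_on_const: "smooth_on S (\<lambda>x. c)"
  by (simp add: smooth_on_def times_differentiable_const)

lemma smooth_on_linear:
  "bounded_linear L \<Longrightarrow> open S \<Longrightarrow> smooth_on S f \<Longrightarrow> smooth_on S (\<lambda>x. L (f x))"
  by (simp only: smooth_on_def) (rule allI, rule times_differentiable_linear, assumption+, erule spec)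

lemma smooth_on_id: "smooth_on S (\<lambda>x. x)"
  unfolding smooth_on_def by (intro allI times_differentiable_subset[OF times_differentiable_id] subset_UNIV)

lemma smooth_on_bounded_linear:
  assumes "bounded_linear L"
  shows "smooth_on S L"
  by (rule smooth_on_subset[OF smooth_on_linear[OF assms open_UNIV smooth_on_id]]) simp

lemma smooth_on_add:
  "open S \<Longrightarrow> smooth_on S f \<Longrightarrow> smooth_on S g \<Longrightarrow> smooth_on S (\<lambda>x. f x + g x)"
  unfolding smooth_on_def by (intro allI times_differentiable_add) (assumption | erule spec)+

lemma smooth_on_minus:
  "open S \<Longrightarrow> smooth_on S f \<Longrightarrow> smooth_on S (\<lambda>x. - f x)"
  by (rule smooth_on_linear[OF bounded_linear_minus[OF bounded_linear_ident]])

lemma smooth_on_diff: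
  "open S \<Longrightarrow> smooth_on S f \<Longrightarrow> smooth_on S g \<Longrightarrow> smooth_on S (\<lambda>x. f x - g x)"
  unfolding diff_conv_add_uminus by (intro smooth_on_add smooth_on_minus)

lemma smooth_on_scaleR:
  "open S \<Longrightarrow> smooth_on S f \<Longrightarrow> smooth_on S g \<Longrightarrow> smooth_on S (\<lambda>x. f x *\<^sub>R g x)"
  unfolding smooth_on_def by (intro allI times_differentiable_bilinear[OF bounded_bilinear_scaleR]) (assumption | erule spec)+

lemma smooth_on_mult:
  fixes f :: "'a::real_normed_vector \<Rightarrow> real"
  shows "open S \<Longrightarrow> smooth_on S f \<Longrightarrow> smooth_on S g \<Longrightarrow> smooth_on S (\<lambda>x. f x * g x)"
  unfolding smooth_on_def by (intro allI times_differentiable_bilinear[OF bounded_bilinear_mult]) (assumption | erule spec)+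

lemma smooth_on_sum:
  assumes "open S" "\<And>i. i \<in> I \<Longrightarrow> smooth_on S (f i)"
  shows "smooth_on S (\<lambda>x. \<Sum>i\<in>I. f i x)"
  unfolding smooth_on_def
  by (intro allI times_differentiable_sum assms(1) smooth_on_times_differentiable assms(2))

lemma smooth_on_compose:
  fixes f :: "'a::real_normed_vector \<Rightarrow> 'b::euclidean_space"
  assumes "open S" "open T" "f ` S \<subseteq> T" "smooth_on S f" "smooth_on T g"
  shows "smooth_on S (\<lambda>x. g (f x))"
  unfolding smooth_on_def
  by (rule allI, rule times_differentiable_compose[OF assms(1-3)])
    (intro smooth_on_times_differentiable assms(4,5))+

lemma smooth_on_inverse:
  fixes f :: "'a::real_normed_vector \<Rightarrow> real"
  assumes "open S" "smooth_on S f" "\<And>x. x \<in> S \<Longrightarrow> f x \<noteq> 0"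
  shows "smooth_on S (\<lambda>x. inverse (f x))"
proof (rule smooth_on_compose[OF assms(1) _ _ assms(2)])
  show "smooth_on (- {0}) (inverse :: real \<Rightarrow> real)"
    unfolding smooth_on_def by (intro allI times_differentiable_inverse)
qed (use assms in \<open>auto simp: open_Compl\<close>)

lemma smooth_on_divide:
  fixes f :: "'a::real_normed_vector \<Rightarrow> real"
  assumes "open S" "smooth_on S f" "smooth_on S g" "\<And>x. x \<in> S \<Longrightarrow> g x \<noteq> 0"
  shows "smooth_on S (\<lambda>x. f x / g x)"
  unfolding divide_inverse using assms by (intro smooth_on_mult smooth_on_inverse) auto

lemma smooth_on_ln:
  fixes f :: "'a::real_normed_vector \<Rightarrow> real"
  assumes "open S" "smooth_on S f" "\<And>x. x \<in> S \<Longrightarrow> f x > 0"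
  shows "smooth_on S (\<lambda>x. ln (f x))"
proof (rule smooth_on_compose[OF assms(1) _ _ assms(2)])
  show "smooth_on ({0<..}) (ln :: real \<Rightarrow> real)"
    unfolding smooth_on_def by (intro allI times_differentiable_ln)
qed (use assms in \<open>auto simp: open_Compl\<close>)

lemma smooth_on_exp:
  fixes f :: "'a::real_normed_vector \<Rightarrow> real"
  assumes "open S" "smooth_on S f"
  shows "smooth_on S (\<lambda>x. exp (f x))"
  by (rule smooth_on_compose[OF assms(1), where T = UNIV])
    (use assms times_differentiable_exp in \<open>auto simp: smooth_on_def\<close>)

lemma smooth_on_Pair:
  assumes "open S" "smooth_on S f" "smooth_on S g"
  shows "smooth_on S (\<lambda>x. (f x, g x))"
  using assms unfolding smooth_on_def by (intro allI times_differentiable_Pair) blast+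

lemma smooth_on_has_derivative:
  assumes "smooth_on S f" "x \<in> S"
  shows "(f has_derivative fderiv f x) (at x)"
  by (rule times_differentiable_SucD[OF smooth_on_times_differentiable[OF assms(1)] assms(2)])

lemma smooth_on_differentiable: "smooth_on S f \<Longrightarrow> x \<in> S \<Longrightarrow> f differentiable at x"
  by (rule differentiableI[OF smooth_on_has_derivative])

lemma smooth_on_continuous_on: "smooth_on S f \<Longrightarrow> continuous_on S f"
  using smooth_on_times_differentiable[of S f 0] by (simp only: times_differentiable_on.simps)

lemma smooth_on_linear_fderiv: "smooth_on S f \<Longrightarrow> x \<in> S \<Longrightarrow> linear (fderiv f x)"
  by (rule has_derivative_linear[OF smooth_on_has_derivative])

lemma smooth_on_fderiv: "smooth_on S f \<Longrightarrow> smooth_on S (\<lambda>x. fderiv f x v)"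
  unfolding smooth_on_def
proof
  fix k assume "\<forall>k. times_differentiable_on k S f"
  then have "times_differentiable_on (Suc k) S f" by (rule spec)
  then show "times_differentiable_on k S (\<lambda>x. fderiv f x v)" by simp
qed

lemma smooth_on_fderiv_field:
  fixes f :: "'a::euclidean_space \<Rightarrow> 'b::real_normed_vector"
  assumes "open S" "smooth_on S f" "smooth_on S X"
  shows "smooth_on S (\<lambda>x. fderiv f x (X x))"
proof -
  have "smooth_on S (\<lambda>x. \<Sum>b\<in>Basis. (X x \<bullet> b) *\<^sub>R fderiv f x b)"
    using assms by (intro smooth_on_sum smooth_on_scaleR smooth_on_fderiv
        smooth_on_linear[OF bounded_linear_inner_left]) auto
  moreover have "fderiv f x (X x) = (\<Sum>b\<in>Basis. (X x \<bullet> b) *\<^sub>R fderiv f x b)" if "x \<in> S" for x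
    using linear_Basis_expansion smooth_on_linear_fderiv assms(2) that by blast
  ultimately show ?thesis
    using smooth_on_cong[OF assms(1), of "\<lambda>x. fderiv f x (X x)"] by simp
qed

lemma smooth_on_nth:
  fixes f :: "'a::real_normed_vector \<Rightarrow> real^'n"
  shows "open S \<Longrightarrow> smooth_on S f \<Longrightarrow> smooth_on S (\<lambda>x. f x $ i)"
  by (rule smooth_on_linear[OF bounded_linear_vec_nth])

text \<open>The inverse function theorem asks for a derivative that is continuous in the operator
  norm; in finite dimension continuity in each basis direction is enough.\<close>

lemma smooth_on_fderiv_blinfun:
  fixes f :: "'a::euclidean_space \<Rightarrow> 'b::real_normed_vector"
  assumes "smooth_on S f"
  obtains f' where "\<And>x. x \<in> S \<Longrightarrow> blinfun_apply (f' x) = fderiv f x" "continuous_on S f'"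
proof -
  define f' where "f' x = Blinfun (fderiv f x)" for x
  have eq: "blinfun_apply (f' x) = fderiv f x" if "x \<in> S" for x
    using smooth_on_has_derivative[OF assms that] has_derivative_bounded_linear
    unfolding f'_def by (blast intro: bounded_linear_Blinfun_apply)
  moreover have "continuous_on S f'"
  proof (rule continuous_on_blinfun_componentwise)
    fix i :: 'a assume "i \<in> Basis"
    show "continuous_on S (\<lambda>x. blinfun_apply (f' x) i)"
      using smooth_on_continuous_on[OF smooth_on_fderiv[OF assms, of i]] eq
      by (simp cong: continuous_on_cong_simp)
  qed
  ultimately show ?thesis using that by blast
qed

lemma has_derivative_along_line:
  assumes "(f has_derivative f') (at (p + t *\<^sub>R v))"
  shows "((\<lambda>t. f (p + t *\<^sub>R v)) has_vector_derivative f' v) (at t within A)"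
proof -
  have "((\<lambda>t. p + t *\<^sub>R v) has_derivative (\<lambda>h. h *\<^sub>R v)) (at t within A)"
    by (auto intro!: derivative_eq_intros)
  from has_derivative_compose[OF this assms]
  have "((\<lambda>t. f (p + t *\<^sub>R v)) has_derivative (\<lambda>h. f' (h *\<^sub>R v))) (at t within A)" .
  then show ?thesis
    by (simp add: has_vector_derivative_def linear_cmul[OF has_derivative_linear[OF assms]])
qed

text \<open>The increment of f along v is an integral over t; differentiating it in s along w, once
  directly and once under the integral, shows that \<open>L\<close> is a primitive of
  \<open>H\<close>. Its derivative at 0, computed in these two ways, gives the two mixed
  derivatives.\<close>

lemma symmetric_second_fderiv:
  fixes f :: "'a::real_normed_vector \<Rightarrow> 'b::banach"
  assumes S: "open S" "p \<in> S" and f: "smooth_on S f"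
  shows "fderiv (\<lambda>x. fderiv f x v) p w = fderiv (\<lambda>x. fderiv f x w) p v"
proof -
  obtain e where e: "e > 0" "ball p e \<subseteq> S"
    using S open_contains_ball by blast
  \<comment> \<open>The summand 1 avoids division by zero for v = w = 0 and gives r (|v| + |w|) = e
    - r < e, so the closed parallelogram with parameters in [-r, r] stays inside the ball.\<close>
  define n where "n = norm v + norm w + 1"
  define r where "r = e / n"
  have "n > 0"
    by (simp add: n_def add_nonneg_pos)
  then have r: "r > 0" "r * n = e"
    using e(1) unfolding r_def by auto
  have "r * (norm v + norm w) = e - r"
    using r(2) by (simp add: n_def algebra_simps)
  with r(1) have r: "r > 0" "r * (norm v + norm w) < e"
    by simp_all
  have mem: "p + t *\<^sub>R v + s *\<^sub>R w \<in> S" if "\<bar>t\<bar> \<le> r" "\<bar>s\<bar> \<le> r" for s t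
  proof -
    have "norm (t *\<^sub>R v + s *\<^sub>R w) \<le> \<bar>t\<bar> * norm v + \<bar>s\<bar> * norm w"
      by (metis norm_scaleR norm_triangle_ineq)
    also have "\<dots> \<le> r * norm v + r * norm w"
      by (intro add_mono mult_right_mono that) auto
    also have "\<dots> < e" using r(2) by (simp add: algebra_simps)
    finally have "p + (t *\<^sub>R v + s *\<^sub>R w) \<in> ball p e"
      by (metis add_diff_cancel_left' dist_commute dist_norm mem_ball)
    then show ?thesis using e by (auto simp: add.assoc)
  qed
  have mem0: "p + t *\<^sub>R v \<in> S" if "\<bar>t\<bar> \<le> r" for t
    using mem[OF that, of 0] r(1) by simp
  define H where "H t = fderiv (\<lambda>x. fderiv f x v) (p + t *\<^sub>R v) w" for t
  define L where "L t = fderiv f (p + t *\<^sub>R v) w" for t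
  have D1: "(f has_derivative fderiv f x) (at x)" if "x \<in> S" for x
    by (rule smooth_on_has_derivative[OF f that])
  have D2: "((\<lambda>x. fderiv f x u) has_derivative fderiv (\<lambda>x. fderiv f x u) x) (at x)" if "x \<in> S" for x u
    by (rule smooth_on_has_derivative[OF smooth_on_fderiv[OF f] that])
  have contH: "continuous_on {0..r} H"
    unfolding H_def
    by (rule continuous_on_compose2[OF smooth_on_continuous_on[OF smooth_on_fderiv[OF smooth_on_fderiv[OF f]]]])
      (auto intro!: continuous_intros mem0)
  \<comment> \<open>Both sides are the derivative at s = 0 of \<open>f (p + \<tau> *\<^sub>R v + s
    *\<^sub>R w) - f (p + s *\<^sub>R w)\<close>.\<close>
  have key: "L \<tau> - L 0 = integral {0..\<tau>} H" if \<tau>: "\<tau> \<in> {0..r}" for \<tau>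
  proof -
    define K where "K s t = fderiv f (p + t *\<^sub>R v + s *\<^sub>R w) v" for s t
    define K' where "K' s t = fderiv (\<lambda>x. fderiv f x v) (p + t *\<^sub>R v + s *\<^sub>R w) w" for s t
    have int: "(K s has_integral (f (p + \<tau> *\<^sub>R v + s *\<^sub>R w) - f (p + s *\<^sub>R w))) {0..\<tau>}"
      if s: "\<bar>s\<bar> \<le> r" for s
    proof -
      have "((\<lambda>t. f (p + t *\<^sub>R v + s *\<^sub>R w)) has_vector_derivative K s t) (at t within {0..\<tau>})"
        if "t \<in> {0..\<tau>}" for t
      proof -
        have "p + s *\<^sub>R w + t *\<^sub>R v \<in> S"
          using mem[of t s] that \<tau> s by (auto simp: algebra_simps)
        moreover have "p + t *\<^sub>R v + s *\<^sub>R w = p + s *\<^sub>R w + t *\<^sub>R v" for t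
          by simp
        ultimately show ?thesis
          unfolding K_def by (simp only: has_derivative_along_line[OF D1])
      qed
      from fundamental_theorem_of_calculus[OF _ this] show ?thesis
        using \<tau> by simp
    qed
    have "((\<lambda>s. integral (cbox 0 \<tau>) (K s)) has_vector_derivative integral (cbox 0 \<tau>) (K' 0))
        (at 0 within {-r..r})"
    proof (rule leibniz_rule_vector_derivative)
      fix s t assume "s \<in> {-r..r}" "t \<in> cbox 0 \<tau>"
      then have "p + t *\<^sub>R v + s *\<^sub>R w \<in> S"
        using \<tau> by (intro mem) auto
      from has_derivative_along_line[OF D2[OF this]]
      show "((\<lambda>s. K s t) has_vector_derivative K' s t) (at s within {- r..r})"
        unfolding K_def K'_def .
    next
      fix s assume "s \<in> {-r..r}"
      then have "\<bar>s\<bar> \<le> r" by auto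
      then show "K s integrable_on cbox 0 \<tau>"
        using has_integral_integrable[OF int] by simp
    next
      have "continuous_on ({-r..r} \<times> cbox 0 \<tau>) (\<lambda>z. K' (fst z) (snd z))"
        unfolding K'_def
        by (rule continuous_on_compose2[OF smooth_on_continuous_on[OF smooth_on_fderiv[OF smooth_on_fderiv[OF f]]]])
          (use \<tau> in \<open>auto intro!: continuous_intros mem\<close>)
      then show "continuous_on ({-r..r} \<times> cbox 0 \<tau>) (\<lambda>(s, t). K' s t)"
        by (simp add: case_prod_beta)
    qed (use r in auto)
    then have "((\<lambda>s. integral {0..\<tau>} (K s)) has_vector_derivative integral {0..\<tau>} (K' 0))
        (at 0 within {-r..r})"
      by simp
    then have "((\<lambda>s. f (p + \<tau> *\<^sub>R v + s *\<^sub>R w) - f (p + s *\<^sub>R w)) has_vector_derivative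
        integral {0..\<tau>} (K' 0)) (at 0 within {-r..r})"
      by (rule has_vector_derivative_transform[rotated 2]) (use r in \<open>auto simp: integral_unique[OF int]\<close>)
    moreover have "((\<lambda>s. f (p + \<tau> *\<^sub>R v + s *\<^sub>R w) - f (p + s *\<^sub>R w)) has_vector_derivative L \<tau> - L 0)
        (at 0 within {-r..r})"
    proof -
      have "p + \<tau> *\<^sub>R v + 0 *\<^sub>R w \<in> S" "p + 0 *\<^sub>R w \<in> S"
        using mem0[of \<tau>] \<tau> S by auto
      from this[THEN D1, THEN has_derivative_along_line] show ?thesis
        unfolding L_def by (intro has_vector_derivative_diff) auto
    qed
    ultimately have "L \<tau> - L 0 = integral {0..\<tau>} (K' 0)"
      using vector_derivative_unique_within_closed_interval[of "-r" r 0] r by simp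
    then show ?thesis
      unfolding H_def K'_def by simp
  qed
  have "((\<lambda>\<tau>. integral {0..\<tau>} H) has_vector_derivative H 0) (at 0 within {0..r})"
    using integral_has_vector_derivative[OF contH] r by simp
  then have "((\<lambda>\<tau>. L \<tau> - L 0) has_vector_derivative H 0) (at 0 within {0..r})"
    by (rule has_vector_derivative_transform[rotated 2]) (use r key in auto)
  moreover have "((\<lambda>\<tau>. L \<tau> - L 0) has_vector_derivative fderiv (\<lambda>x. fderiv f x w) p v) (at 0 within {0..r})"
  proof -
    have "p + 0 *\<^sub>R v \<in> S" using S by simp
    from has_derivative_along_line[OF D2[OF this]]
    have "(L has_vector_derivative fderiv (\<lambda>x. fderiv f x w) p v) (at 0 within {0..r})"
      unfolding L_def by simp
    from has_vector_derivative_diff[OF this has_vector_derivative_const] show ?thesis by simp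
  qed
  ultimately have "H 0 = fderiv (\<lambda>x. fderiv f x w) p v"
    using vector_derivative_unique_within_closed_interval[of 0 r 0] r by simp
  then show ?thesis unfolding H_def by simp
qed

section \<open>Integrals depending on a parameter, primitives of closed one-forms, local
  inverses\<close>

lemma continuous_on_param_integral:
  fixes K :: "real \<times> 'a::topological_space \<Rightarrow> 'b::banach"
  assumes T: "{0..1} \<times> S \<subseteq> T" and K: "continuous_on T K"
  shows "continuous_on S (\<lambda>z. integral {0..1} (\<lambda>t. K (t, z)))"
proof -
  have "continuous_on (S \<times> cbox 0 1) (\<lambda>z. K (snd z, fst z))"
    by (rule continuous_on_compose2[OF K]) (use T in \<open>auto intro!: continuous_intros\<close>)
  then have "continuous_on (S \<times> cbox 0 1) (\<lambda>(z, t). K (t, z))"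
    by (simp only: case_prod_unfold)
  from integral_continuous_on_param[OF this] show ?thesis by simp
qed

text \<open>The parameter is the second argument of \<open>K\<close>, so differentiation under the
  integral uses the directions (0, w). The Leibniz rule wants a continuous family of bounded
  operators over a convex set, hence the passage through \<open>Blinfun\<close> and a ball around
  z.\<close>

lemma has_derivative_param_integral:
  fixes K :: "real \<times> 'a::euclidean_space \<Rightarrow> 'b::banach"
  assumes S: "open S" "z \<in> S" and T: "{0..1} \<times> S \<subseteq> T" and K: "times_differentiable_on (Suc 0) T K"
  shows "((\<lambda>z. integral {0..1} (\<lambda>t. K (t, z))) has_derivative
    (\<lambda>w. integral {0..1} (\<lambda>t. fderiv K (t, z) (0, w)))) (at z)"
proof -
  define D where "D z t = Blinfun (\<lambda>w. fderiv K (t, z) (0, w))" for z t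
  have hd: "((\<lambda>z. K (t, z)) has_derivative (\<lambda>w. fderiv K (t, z) (0, w))) (at z)"
    if "t \<in> {0..1}" "z \<in> S" for t z
  proof -
    have "(t, z) \<in> T" using T that by blast
    then have "(K has_derivative fderiv K (t, z)) (at (t, z))"
      by (rule times_differentiable_SucD[OF K])
    moreover have "(Pair t has_derivative (\<lambda>w. (0, w))) (at z)"
      by (auto intro!: derivative_eq_intros)
    ultimately show ?thesis
      using has_derivative_compose[of "Pair t" "\<lambda>w. (0, w)" z UNIV K "fderiv K (t, z)"] by simp
  qed
  have D: "blinfun_apply (D z t) = (\<lambda>w. fderiv K (t, z) (0, w))" if "t \<in> {0..1}" "z \<in> S" for t z
    unfolding D_def by (rule bounded_linear_Blinfun_apply[OF has_derivative_bounded_linear[OF hd[OF that]]])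
  have cont: "continuous_on (S \<times> cbox 0 1) (\<lambda>(z, t). D z t)"
  proof (rule continuous_on_blinfun_componentwise)
    fix i :: 'a assume "i \<in> Basis"
    have "continuous_on T (\<lambda>x. fderiv K x (0, i))"
      using K by simp
    then have "continuous_on (S \<times> cbox 0 1) (\<lambda>x. fderiv K (snd x, fst x) (0, i))"
      by (rule continuous_on_compose2) (use T in \<open>auto intro!: continuous_intros\<close>)
    then show "continuous_on (S \<times> cbox 0 1) (\<lambda>x. blinfun_apply (case x of (z, t) \<Rightarrow> D z t) i)"
      by (rule continuous_on_eq) (auto simp: D)
  qed
  have contD: "continuous_on {0..1} (D z)"
  proof -
    have "continuous_on {0..1} (\<lambda>t::real. (z, t))"
      by (intro continuous_intros)
    from continuous_on_compose2[OF cont this] show ?thesis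
      using S by auto
  qed
  obtain e where e: "e > 0" "ball z e \<subseteq> S"
    using S open_contains_ball by blast
  have contK: "continuous_on T K"
    using times_differentiable_le[OF K, of 0] by simp
  have "((\<lambda>z. integral (cbox 0 1) (\<lambda>t. K (t, z))) has_derivative integral (cbox 0 1) (D z))
      (at z within ball z e)"
  proof (rule leibniz_rule)
    fix x t assume "x \<in> ball z e" "t \<in> cbox (0::real) 1"
    then have "t \<in> {0..1}" "x \<in> S"
      using e by auto
    then show "((\<lambda>x. K (t, x)) has_derivative blinfun_apply (D x t)) (at x within ball z e)"
      by (simp only: D has_derivative_at_withinI[OF hd])
  next
    fix x assume "x \<in> ball z e"
    then have "x \<in> S" using e by auto
    have "continuous_on {0..1} (\<lambda>t. K (t, x))"
      by (rule continuous_on_compose2[OF contK]) (use T \<open>x \<in> S\<close> in \<open>auto intro!: continuous_intros\<close>)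
    then show "(\<lambda>t. K (t, x)) integrable_on cbox 0 1"
      using integrable_continuous_real by simp
  next
    show "continuous_on (ball z e \<times> cbox 0 1) (\<lambda>(x, t). D x t)"
      by (rule continuous_on_subset[OF cont]) (use e in auto)
  qed (use e in auto)
  then have "((\<lambda>z. integral {0..1} (\<lambda>t. K (t, z))) has_derivative integral {0..1} (D z)) (at z)"
    using e at_within_open[of z "ball z e"] by simp
  moreover have "blinfun_apply (integral {0..1} (D z)) = (\<lambda>w. integral {0..1} (\<lambda>t. fderiv K (t, z) (0, w)))"
  proof
    fix w
    have "blinfun_apply (integral {0..1} (D z)) w = integral {0..1} (\<lambda>t. D z t w)"
      by (rule blinfun_apply_integral[OF integrable_continuous_real[OF contD]])
    also have "\<dots> = integral {0..1} (\<lambda>t. fderiv K (t, z) (0, w))"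
      by (rule integral_cong) (simp add: D S)
    finally show "blinfun_apply (integral {0..1} (D z)) w = integral {0..1} (\<lambda>t. fderiv K (t, z) (0, w))" .
  qed
  ultimately show ?thesis by simp
qed

text \<open>The derivative is again an integral over {0..1}, of a fixed-direction derivative of
  \<open>K\<close>, so an induction over all \<open>K\<close> at once closes. This is why integrals
  with moving limits are always rescaled to {0..1}.\<close>

lemma times_differentiable_param_integral:
  fixes K :: "real \<times> 'a::euclidean_space \<Rightarrow> 'b::banach"
  assumes S: "open S" and T: "{0..1} \<times> S \<subseteq> T" and K: "times_differentiable_on k T K"
  shows "times_differentiable_on k S (\<lambda>z. integral {0..1} (\<lambda>t. K (t, z)))"
  using K
proof (induction k arbitrary: K)
  case 0
  then show ?case using continuous_on_param_integral[OF T] by simp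
next
  case (Suc k)
  show ?case
  proof (rule times_differentiable_SucI[OF S has_derivative_param_integral[OF S _ T]])
    show "times_differentiable_on (Suc 0) T K"
      by (rule times_differentiable_le[OF Suc.prems]) simp
    fix w
    show "times_differentiable_on k S (\<lambda>z. integral {0..1} (\<lambda>t. fderiv K (t, z) (0, w)))"
      by (rule Suc.IH[of "\<lambda>x. fderiv K x (0, w)"]) (use Suc.prems in simp)
  qed
qed

lemma smooth_on_param_integral:
  fixes K :: "real \<times> 'a::euclidean_space \<Rightarrow> 'b::banach"
  assumes "open S" "{0..1} \<times> S \<subseteq> T" "smooth_on T K"
  shows "smooth_on S (\<lambda>z. integral {0..1} (\<lambda>t. K (t, z)))"
  unfolding smooth_on_def
  by (rule allI, rule times_differentiable_param_integral[OF assms(1,2)])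
    (rule smooth_on_times_differentiable[OF assms(3)])

text \<open>The primitive is \<open>u z = \<integral> \<omega>\<^bsub>p + t (z - p)\<^esub> (z - p) dt\<close>; closedness turns the integrand of its
  derivative in the direction \<open>w\<close> into \<open>d/dt (t \<omega>\<^bsub>p + t (z - p)\<^esub> w)\<close>.\<close>

lemma closed_one_form_primitive:
  fixes \<omega> :: "'a::euclidean_space \<Rightarrow> 'a \<Rightarrow> real"
  assumes S: "open S" "convex S" "p \<in> S"
    and smooth: "\<And>w. smooth_on S (\<lambda>z. \<omega> z w)" and lin: "\<And>z. z \<in> S \<Longrightarrow> linear (\<omega> z)"
    and closed: "\<And>z v w. z \<in> S \<Longrightarrow> fderiv (\<lambda>x. \<omega> x v) z w = fderiv (\<lambda>x. \<omega> x w) z v"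
  obtains u where "smooth_on S u" "\<And>z. z \<in> S \<Longrightarrow> (u has_derivative \<omega> z) (at z)"
proof -
  define \<gamma> where "\<gamma> x = p + fst x *\<^sub>R (snd x - p)" for x :: "real \<times> 'a"
  \<comment> \<open>Ambient derivatives call for an open domain, so {0..1} \<times> S is enlarged to
    the open set of all (t, z) for which z and the path point lie in S.\<close>
  define T where "T = \<gamma> -` S \<inter> (UNIV \<times> S)"
  define K where "K x = (\<Sum>b\<in>Basis. ((snd x - p) \<bullet> b) * \<omega> (\<gamma> x) b)" for x
  define u where "u z = integral {0..1} (\<lambda>t. K (t, z))" for z
  have snd_smooth: "smooth_on A (\<lambda>x. snd x - p)" if "open A" for A :: "(real \<times> 'a) set"
    by (intro smooth_on_diff smooth_on_const smooth_on_bounded_linear[OF bounded_linear_snd] that)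
  have \<gamma>_smooth: "smooth_on A \<gamma>" if "open A" for A
    unfolding \<gamma>_def
    by (intro smooth_on_add smooth_on_const smooth_on_scaleR snd_smooth
        smooth_on_bounded_linear[OF bounded_linear_fst] that)
  have T: "open T"
    unfolding T_def using S smooth_on_continuous_on[OF \<gamma>_smooth[OF open_UNIV]]
    by (intro open_Int open_vimage open_Times) auto
  have \<gamma>T: "\<gamma> ` T \<subseteq> S"
    by (auto simp: T_def)
  have sub: "{0..1} \<times> S \<subseteq> T"
  proof
    fix x :: "real \<times> 'a" assume x: "x \<in> {0..1} \<times> S"
    then have "(1 - fst x) *\<^sub>R p + fst x *\<^sub>R snd x \<in> S"
      by (intro convexD[OF S(2)] S(3)) auto
    moreover have "(1 - fst x) *\<^sub>R p + fst x *\<^sub>R snd x = \<gamma> x"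
      by (simp add: \<gamma>_def algebra_simps)
    ultimately show "x \<in> T"
      using x by (auto simp: T_def)
  qed
  have K: "smooth_on T K"
    unfolding K_def
    by (intro smooth_on_sum smooth_on_mult T smooth_on_linear[OF bounded_linear_inner_left] snd_smooth
        smooth_on_compose[OF T S(1) \<gamma>T \<gamma>_smooth[OF T] smooth])
  have u: "smooth_on S u"
    unfolding u_def by (rule smooth_on_param_integral[OF S(1) sub K])
  show thesis
  proof
    show "smooth_on S u" by fact
    fix z assume z: "z \<in> S"
    have "integral {0..1} (\<lambda>t. fderiv K (t, z) (0, w)) = \<omega> z w" for w
    proof -
      define \<omega>' where "\<omega>' b = fderiv (\<lambda>y. \<omega> y b)" for b
      have \<omega>': "((\<lambda>y. \<omega> y b) has_derivative \<omega>' b y) (at y)" if "y \<in> S" for b y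
        unfolding \<omega>'_def by (rule smooth_on_has_derivative[OF smooth that])
      have "((\<lambda>t. t * \<omega> (p + t *\<^sub>R (z - p)) w) has_vector_derivative fderiv K (t, z) (0, w))
          (at t within {0..1})" if t: "t \<in> {0..1}" for t
      proof -
        have tz: "(t, z) \<in> T" using sub t z by blast
        have y: "\<gamma> (t, z) \<in> S" using tz \<gamma>T by blast
        have "(\<gamma> has_derivative (\<lambda>h. fst h *\<^sub>R (z - p) + t *\<^sub>R snd h)) (at (t, z))"
          unfolding \<gamma>_def by (auto intro!: derivative_eq_intros)
        note has_derivative_compose[OF this \<omega>'[OF y]]
        then have "(K has_derivative (\<lambda>h. \<Sum>b\<in>Basis. ((z - p) \<bullet> b) * \<omega>' b (\<gamma> (t, z)) (fst h *\<^sub>R (z - p) + t *\<^sub>R snd h)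
            + (snd h \<bullet> b) * \<omega> (\<gamma> (t, z)) b)) (at (t, z))"
          unfolding K_def by (auto intro!: derivative_eq_intros)
        then have "fderiv K (t, z) (0, w) =
            (\<Sum>b\<in>Basis. ((z - p) \<bullet> b) * \<omega>' b (\<gamma> (t, z)) (t *\<^sub>R w) + (w \<bullet> b) * \<omega> (\<gamma> (t, z)) b)"
          by (simp add: fderiv_at)
        also have "\<dots> = (\<Sum>b\<in>Basis. ((z - p) \<bullet> b) * (t * \<omega>' w (\<gamma> (t, z)) b)) + \<omega> (\<gamma> (t, z)) w"
          using linear_Basis_expansion[OF lin[OF y], of w] closed[OF y] linear_cmul[OF has_derivative_linear[OF \<omega>'[OF y]]]
          by (simp add: sum.distrib \<omega>'_def)
        also have "(\<Sum>b\<in>Basis. ((z - p) \<bullet> b) * (t * \<omega>' w (\<gamma> (t, z)) b)) = t * \<omega>' w (\<gamma> (t, z)) (z - p)"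
          using linear_Basis_expansion[OF has_derivative_linear[OF \<omega>'[OF y, of w]], of "z - p"]
          by (simp add: sum_distrib_left mult.left_commute)
        finally have *: "fderiv K (t, z) (0, w) = t * \<omega>' w (\<gamma> (t, z)) (z - p) + \<omega> (\<gamma> (t, z)) w" .
        have "((\<lambda>t. \<omega> (p + t *\<^sub>R (z - p)) w) has_vector_derivative \<omega>' w (\<gamma> (t, z)) (z - p)) (at t within {0..1})"
          using has_derivative_along_line[OF \<omega>', of p t "z - p" w] y by (simp add: \<gamma>_def)
        from has_vector_derivative_mult[OF has_vector_derivative_id this] show ?thesis
          by (simp add: * \<gamma>_def)
      qed
      from fundamental_theorem_of_calculus[OF _ this] show ?thesis
        by (simp add: integral_unique)
    qed
    then show "(u has_derivative \<omega> z) (at z)"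
      using has_derivative_param_integral[OF S(1) z sub smooth_on_times_differentiable[OF K]]
      unfolding u_def by simp
  qed
qed

text \<open>Bootstrapping: the local inverse satisfies G' = R(G), with R smooth in the base point.
  If G is k times differentiable, so is R(G) in each direction, and hence G is k + 1 times
  differentiable.\<close>

lemma smooth_local_inverse:
  fixes F :: "'a::euclidean_space \<Rightarrow> 'a"
  assumes S: "open S" "p \<in> S" and F: "smooth_on S F" and R: "\<And>w. smooth_on S (\<lambda>x. R x w)"
    and inv: "\<And>x w. x \<in> S \<Longrightarrow> R x (fderiv F x w) = w" "\<And>x w. x \<in> S \<Longrightarrow> fderiv F x (R x w) = w"
  obtains S' G where "open S'" "p \<in> S'" "S' \<subseteq> S" "open (F ` S')" "smooth_on (F ` S') G"
    "\<And>x. x \<in> S' \<Longrightarrow> G (F x) = x" "\<And>x. x \<in> S' \<Longrightarrow> (G has_derivative R x) (at (F x))"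
proof -
  obtain F' where F': "\<And>x. x \<in> S \<Longrightarrow> blinfun_apply (F' x) = fderiv F x" "continuous_on S F'"
    using smooth_on_fderiv_blinfun[OF F] by blast
  have linR: "linear (R x)" if "x \<in> S" for x
  proof -
    have "fderiv F x \<circ> R x = id"
      using inv that by auto
    moreover have "linear (fderiv F x)"
      by (rule smooth_on_linear_fderiv[OF F that])
    ultimately show ?thesis
      using right_inverse_linear by blast
  qed
  have Rp: "blinfun_apply (Blinfun (R p)) = R p"
    using linR[OF S(2)] by (intro bounded_linear_Blinfun_apply) (simp add: linear_conv_bounded_linear)
  have "Blinfun (R p) o\<^sub>L F' p = id_blinfun"
    by (rule blinfun_eqI) (simp add: Rp F' S inv)
  then obtain S' V G G' where *: "open S'" "S' \<subseteq> S" "p \<in> S'" "open V" "F p \<in> V"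
    and hom: "homeomorphism S' V F G"
    and G': "\<And>y. y \<in> V \<Longrightarrow> (G has_derivative G' y) (at y)"
      "\<And>y. y \<in> V \<Longrightarrow> G' y = Hilbert_Choice.inv (blinfun_apply (F' (G y)))"
    using inverse_function_theorem[OF S(1) _ F'(2) S(2), of F "Blinfun (R p)"]
      F'(1) smooth_on_has_derivative[OF F] by (metis (no_types, lifting))
  have V: "V = F ` S'" and GF: "\<And>x. x \<in> S' \<Longrightarrow> G (F x) = x"
    using hom by (auto simp: homeomorphism_def)
  have GV: "G ` V \<subseteq> S"
    using V GF * by auto
  have GR: "(G has_derivative R (G y)) (at y)" if "y \<in> V" for y
  proof -
    have "G y \<in> S" using GV that by auto
    then have "R (G y) = Hilbert_Choice.inv (fderiv F (G y))"
      using inv by (intro ext) (metis inv_f_f injI)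
    then show ?thesis
      using G'[OF that] F'(1)[OF \<open>G y \<in> S\<close>] by simp
  qed
  have "times_differentiable_on k V G" for k
  proof (induction k)
    case 0
    show ?case
      using hom by (simp add: homeomorphism_def)
  next
    case (Suc k)
    show ?case
    proof (rule times_differentiable_SucI[OF \<open>open V\<close> GR])
      fix v
      show "times_differentiable_on k V (\<lambda>x. R (G x) v)"
        by (rule times_differentiable_compose[OF \<open>open V\<close> S(1) GV Suc
              smooth_on_times_differentiable[OF R]])
    qed
  qed
  then have "smooth_on (F ` S') G"
    by (simp add: smooth_on_def V)
  moreover have "(G has_derivative R x) (at (F x))" if "x \<in> S'" for x
    using GR[of "F x"] GF that V by auto
  ultimately show thesis
    using that[of S' G] * GF V by blast
qed

section \<open>Flows of scalar differential equations\<close>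

text \<open>After substitution the expression is the integral of h from c to x. The rescaled form
  treats x < c and x > c alike and keeps the limits constant, as the parameter integrals above
  require.\<close>

lemma normalized_integral_has_derivative:
  fixes h :: "real \<Rightarrow> real"
  assumes h: "continuous_on {c - e<..<c + e} h" and x: "x \<in> {c - e<..<c + e}"
  shows "((\<lambda>x. (x - c) * integral {0..1} (\<lambda>t. h (c + t * (x - c)))) has_real_derivative h x) (at x)"
proof -
  obtain d where d: "\<bar>x - c\<bar> < d" "d < e"
    using x dense[of "\<bar>x - c\<bar>" e] by (auto simp: abs_less_iff)
  have "continuous_on {c - d..c + d} h"
    by (rule continuous_on_subset[OF h]) (use d in auto)
  then obtain g where g: "\<And>y. y \<in> {c - d..c + d} \<Longrightarrow> (g has_vector_derivative h y) (at y within {c - d..c + d})"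
    using antiderivative_continuous by blast
  have eq: "g y - g c = (y - c) * integral {0..1} (\<lambda>t. h (c + t * (y - c)))" if y: "y \<in> {c - d<..<c + d}" for y
  proof -
    have mem: "c + t * (y - c) \<in> {c - d..c + d}" if "t \<in> {0..1}" for t
    proof -
      have "\<bar>t * (y - c)\<bar> \<le> 1 * \<bar>y - c\<bar>"
        unfolding abs_mult using that by (intro mult_right_mono) auto
      then show ?thesis using y by (auto simp: abs_le_iff)
    qed
    have "((\<lambda>t. g (c + t * (y - c))) has_vector_derivative (y - c) * h (c + t * (y - c))) (at t within {0..1})"
      if t: "t \<in> {0..1}" for t
    proof -
      have "((\<lambda>t. c + t * (y - c)) has_vector_derivative (y - c)) (at t within {0..1})"
        by (auto intro!: derivative_eq_intros simp flip: has_real_derivative_iff_has_vector_derivative)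
      moreover have "(g has_vector_derivative h (c + t * (y - c)))
          (at (c + t * (y - c)) within (\<lambda>t. c + t * (y - c)) ` {0..1})"
        by (rule has_vector_derivative_within_subset[OF g[OF mem[OF t]]]) (use mem in auto)
      ultimately show ?thesis
        using vector_diff_chain_within[of "\<lambda>t. c + t * (y - c)" "y - c" t "{0..1}" g] by (simp add: o_def)
    qed
    from fundamental_theorem_of_calculus[OF _ this] have
      "((\<lambda>t. (y - c) * h (c + t * (y - c))) has_integral g y - g c) {0..1}"
      by simp
    from integral_unique[OF this] show ?thesis by simp
  qed
  have "(g has_real_derivative h x) (at x within {c - d<..<c + d})"
    unfolding has_real_derivative_iff_has_vector_derivative
    by (rule has_vector_derivative_within_subset[OF g]) (use d in auto)
  then have "(g has_real_derivative h x) (at x)"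
    using d at_within_open[of x "{c - d<..<c + d}"] by (simp add: abs_less_iff)
  then have "((\<lambda>y. g y - g c) has_real_derivative h x) (at x)"
    by (auto intro!: derivative_eq_intros)
  then show ?thesis
    by (rule has_field_derivative_transform_within_open[where S = "{c - d<..<c + d}"])
      (use d eq in \<open>auto simp: abs_less_iff\<close>)
qed

text \<open>Integrating factor: \<open>\<Delta>\<close> times the exponential of minus the primitive
  \<open>E\<close> of b has derivative zero, and \<open>E\<close> vanishes at c.\<close>

lemma linear_scalar_ode_unique:
  fixes \<Delta> b :: "real \<Rightarrow> real"
  assumes b: "continuous_on {c - e<..<c + e} b" and e: "e > 0"
    and \<Delta>: "\<And>x. x \<in> {c - e<..<c + e} \<Longrightarrow> (\<Delta> has_real_derivative b x * \<Delta> x) (at x)"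
    and x: "x \<in> {c - e<..<c + e}"
  shows "\<Delta> x = \<Delta> c * exp ((x - c) * integral {0..1} (\<lambda>t. b (c + t * (x - c))))"
proof -
  define E where "E x = (x - c) * integral {0..1} (\<lambda>t. b (c + t * (x - c)))" for x
  have E: "(E has_real_derivative b x) (at x)" if "x \<in> {c - e<..<c + e}" for x
    unfolding E_def by (rule normalized_integral_has_derivative[OF b that])
  have "((\<lambda>x. \<Delta> x * exp (- E x)) has_real_derivative 0) (at x)" if "x \<in> {c - e<..<c + e}" for x
    using \<Delta>[OF that] E[OF that] by (auto intro!: derivative_eq_intros)
  then have "\<exists>k. \<forall>x\<in>{c - e<..<c + e}. \<Delta> x * exp (- E x) = k"
    by (intro has_field_derivative_zero_constant) (auto intro: has_field_derivative_at_within)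
  moreover have "c \<in> {c - e<..<c + e}" using e by simp
  ultimately have "\<Delta> x * exp (- E x) = \<Delta> c * exp (- E c)"
    using x by metis
  moreover have "E c = 0" by (simp add: E_def)
  ultimately have "\<Delta> x = \<Delta> c * exp (E x)"
    by (simp add: exp_minus field_simps)
  then show ?thesis by (simp add: E_def)
qed

text \<open>For r \<ge> 0 this is the nearest-point retraction onto the closed interval of radius r
  about c. It is 1-Lipschitz and therefore harmless in contraction estimates.\<close>

definition clamp_to :: "real \<Rightarrow> real \<Rightarrow> real \<Rightarrow> real" where
  "clamp_to c r x = max (c - r) (min (c + r) x)"

lemma clamp_to_abs: "r \<ge> 0 \<Longrightarrow> \<bar>clamp_to c r x - c\<bar> \<le> r"
  by (auto simp: clamp_to_def)

lemma clamp_to_eq: "\<bar>x - c\<bar> \<le> r \<Longrightarrow> clamp_to c r x = x"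
  by (auto simp: clamp_to_def)

lemma clamp_to_lipschitz: "\<bar>clamp_to c r x - clamp_to c r y\<bar> \<le> \<bar>x - y\<bar>"
  by (auto simp: clamp_to_def)

lemma continuous_on_clamp_to [continuous_intros]:
  "continuous_on S f \<Longrightarrow> continuous_on S (\<lambda>x. clamp_to c r (f x))"
  unfolding clamp_to_def by (intro continuous_intros)

text \<open>Picard iteration for all initial values at once. The arguments are clamped to make the iteration
  a contraction of the bounded continuous functions on the whole plane.\<close>

lemma scalar_flow_exists:
  fixes a :: "real \<times> real \<Rightarrow> real"
  assumes \<Omega>: "open \<Omega>" "(p, q) \<in> \<Omega>" and a: "smooth_on \<Omega> a"
  obtains e r \<Phi> where "e > 0" "e \<le> r" "{p - e..p + e} \<times> {q - r..q + r} \<subseteq> \<Omega>"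
    "continuous_on ({p - e<..<p + e} \<times> {q - e<..<q + e}) \<Phi>"
    "\<And>x w. x \<in> {p - e<..<p + e} \<Longrightarrow> w \<in> {q - e<..<q + e} \<Longrightarrow> \<Phi> (x, w) \<in> {q - r<..<q + r}"
    "\<And>x w. x \<in> {p - e<..<p + e} \<Longrightarrow> w \<in> {q - e<..<q + e} \<Longrightarrow>
       \<Phi> (x, w) = w + (x - p) * integral {0..1} (\<lambda>t. a (p + t * (x - p), \<Phi> (p + t * (x - p), w)))"
proof -
  obtain A1 A2 where A: "open A1" "open A2" "p \<in> A1" "q \<in> A2" "A1 \<times> A2 \<subseteq> \<Omega>"
    using \<Omega> by (auto simp: open_prod_def)
  obtain d1 where d1: "d1 > 0" "cball p d1 \<subseteq> A1" using A open_contains_cball by blast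
  obtain d2 where d2: "d2 > 0" "cball q d2 \<subseteq> A2" using A open_contains_cball by blast
  define r where "r = min d1 d2"
  define C where "C = {p - r..p + r} \<times> {q - r..q + r}"
  have r: "r > 0" using d1 d2 by (simp add: r_def)
  have C: "C \<subseteq> \<Omega>"
  proof -
    have "{p - r..p + r} \<subseteq> cball p d1" "{q - r..q + r} \<subseteq> cball q d2"
      by (auto simp: r_def dist_real_def)
    then show ?thesis using A(5) d1 d2 unfolding C_def by blast
  qed
  have compact: "compact C" unfolding C_def by (intro compact_Times compact_Icc)
  have contC: "continuous_on C a"
    by (rule continuous_on_subset[OF smooth_on_continuous_on[OF a] C])
  obtain M where M: "\<And>z. z \<in> C \<Longrightarrow> \<bar>a z\<bar> \<le> M" "M \<ge> 0"
  proof -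
    have "bounded (a ` C)"
      using compact_imp_bounded[OF compact_continuous_image[OF contC compact]] .
    then obtain M where "\<And>z. z \<in> C \<Longrightarrow> \<bar>a z\<bar> \<le> M" by (auto simp: bounded_iff)
    then show thesis using that[of "max M 0"] by (meson max.coboundedI1 max.cobounded2)
  qed
  obtain L where L: "\<And>z. z \<in> C \<Longrightarrow> \<bar>fderiv a z (0, 1)\<bar> \<le> L" "L \<ge> 0"
  proof -
    have "continuous_on C (\<lambda>z. fderiv a z (0, 1))"
      by (rule continuous_on_subset[OF smooth_on_continuous_on[OF smooth_on_fderiv[OF a]] C])
    then have "bounded ((\<lambda>z. fderiv a z (0, 1)) ` C)"
      using compact_imp_bounded[OF compact_continuous_image[OF _ compact]] by blast
    then obtain L where "\<And>z. z \<in> C \<Longrightarrow> \<bar>fderiv a z (0, 1)\<bar> \<le> L" by (auto simp: bounded_iff)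
    then show thesis using that[of "max L 0"] by (meson max.coboundedI1 max.cobounded2)
  qed
  \<comment> \<open>Mean value estimate in the second variable alone; \<open>C\<close> is a product
    of intervals, so the segment from (x, y') to (x, y) stays in it.\<close>
  have lip: "\<bar>a (x, y) - a (x, y')\<bar> \<le> L * \<bar>y - y'\<bar>"
    if x: "x \<in> {p - r..p + r}" and y: "y \<in> {q - r..q + r}" "y' \<in> {q - r..q + r}" for x y y'
  proof -
    have "norm (a (x, y) - a (x, y')) \<le> L * norm (y - y')"
    proof (rule field_differentiable_bound[where S = "{q - r..q + r}" and f' = "\<lambda>y. fderiv a (x, y) (0, 1)"])
      fix y assume y: "y \<in> {q - r..q + r}"
      then have *: "(x, y) \<in> C" using x by (simp add: C_def)
      have "(x, 0) + y *\<^sub>R (0, 1) = (x, y)" by simp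
      then have "(x, 0) + y *\<^sub>R (0, 1) \<in> \<Omega>" using * C by auto
      from has_derivative_along_line[OF smooth_on_has_derivative[OF a this]]
      show "((\<lambda>y. a (x, y)) has_field_derivative fderiv a (x, y) (0, 1)) (at y within {q - r..q + r})"
        unfolding has_real_derivative_iff_has_vector_derivative by simp
      show "norm (fderiv a (x, y) (0, 1)) \<le> L"
        using L(1)[OF *] by simp
    qed (use y in auto)
    then show ?thesis by simp
  qed
  \<comment> \<open>Three requirements: e M < r / 2 bounds the displacement along a solution, e
    \<le> r / 2 bounds the spread of initial values, and e L \<le> 1 / 2 gives the contraction. The
    summands 1 cover M = 0 and L = 0.\<close>
  define e where "e = min (r / 2 / (M + 1)) (min (1 / 2 / (L + 1)) (r / 2))"
  have e: "e > 0" "e \<le> r / 2" "e * M < r / 2" "e * L \<le> 1 / 2"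
  proof -
    show "e > 0" using r M(2) L(2) by (simp add: e_def)
    show "e \<le> r / 2" unfolding e_def by (intro min.coboundedI2 order_refl)
    have "e \<le> r / 2 / (M + 1)" by (simp add: e_def)
    then have "e * (M + 1) \<le> r / 2" using M(2) by (simp add: field_simps)
    then show "e * M < r / 2" using \<open>e > 0\<close> by (simp add: algebra_simps)
    have "e \<le> 1 / 2 / (L + 1)" by (simp add: e_def)
    then have "e * (L + 1) \<le> 1 / 2" using L(2) by (simp add: field_simps)
    then show "e * L \<le> 1 / 2" using \<open>e > 0\<close> by (simp add: algebra_simps)
  qed
  \<comment> \<open>\<open>s\<close> is the rescaled time between p and x, \<open>J\<close> the
    integrand and \<open>P\<close> the Picard operator. Time and initial value are clamped at radius
    e and the values of \<Phi> at radius r, so \<open>a\<close> is only ever evaluated in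
    \<open>C\<close>.\<close>
  define s where "s t x = p + t * (clamp_to p e x - p)" for t x
  define J where "J \<Phi> z t = a (s t (fst z), clamp_to q r (\<Phi> (s t (fst z), clamp_to q e (snd z))))"
    for \<Phi> :: "real \<times> real \<Rightarrow> real" and z t
  define P where "P \<Phi> z = clamp_to q e (snd z) + (clamp_to p e (fst z) - p) * integral {0..1} (J \<Phi> z)"
    for \<Phi> z
  have s: "\<bar>s t x - p\<bar> \<le> e" if "t \<in> {0..1}" for t x
  proof -
    have "\<bar>t * (clamp_to p e x - p)\<bar> \<le> 1 * e"
      unfolding abs_mult using that e clamp_to_abs[of e p x] by (intro mult_mono) auto
    then show ?thesis by (simp add: s_def)
  qed
  have sC: "(s t x, clamp_to q r y) \<in> C" if "t \<in> {0..1}" for t x y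
    using s[OF that, of x] clamp_to_abs[of r q y] r e by (auto simp: C_def abs_le_iff)
  have contJ: "continuous_on ({0..1} \<times> UNIV) (\<lambda>x. J \<Phi> (snd x) (fst x))" if "continuous_on UNIV \<Phi>" for \<Phi>
    unfolding J_def
  proof (rule continuous_on_compose2[OF contC])
    have "continuous_on ({0..1} \<times> UNIV) (\<lambda>x. \<Phi> (s (fst x) (fst (snd x)), clamp_to q e (snd (snd x))))"
      unfolding s_def by (rule continuous_on_compose2[OF that]) (auto intro!: continuous_intros)
    then show "continuous_on ({0..1} \<times> UNIV) (\<lambda>x. (s (fst x) (fst (snd x)),
        clamp_to q r (\<Phi> (s (fst x) (fst (snd x)), clamp_to q e (snd (snd x))))))"
      by (intro continuous_intros) (auto intro!: continuous_intros simp: s_def)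
  qed (use sC in auto)
  have contJ1: "continuous_on {0..1} (J \<Phi> z)" if "continuous_on UNIV \<Phi>" for \<Phi> z
  proof -
    have "continuous_on {0..1} (\<lambda>t::real. (t, z))" by (intro continuous_intros)
    from continuous_on_compose2[OF contJ[OF that] this] show ?thesis by auto
  qed
  have Jbound: "\<bar>integral {0..1} (J \<Phi> z)\<bar> \<le> M" if "continuous_on UNIV \<Phi>" for \<Phi> z
  proof -
    have "norm (integral {0..1} (J \<Phi> z)) \<le> M * (1 - 0)"
    proof (rule integral_bound)
      show "norm (J \<Phi> z t) \<le> M" if "t \<in> {0..1}" for t
        using M(1)[OF sC[OF that]] by (simp add: J_def)
    qed (use contJ1[OF that] in auto)
    then show ?thesis by simp
  qed
  have diff_bound: "\<bar>P \<Phi> z - clamp_to q e (snd z)\<bar> \<le> e * M" if "continuous_on UNIV \<Phi>" for \<Phi> z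
    unfolding P_def using Jbound[OF that, of z] clamp_to_abs[of e p "fst z"] e
    by (auto simp: abs_mult intro!: mult_mono)
  have P: "P \<Phi> \<in> bcontfun" if \<Phi>: "continuous_on UNIV \<Phi>" for \<Phi>
  proof (rule bcontfun_normI)
    have "continuous_on UNIV (\<lambda>z. integral {0..1} (\<lambda>t. J \<Phi> z t))"
      using continuous_on_param_integral[OF _ contJ[OF \<Phi>], of UNIV] by simp
    then show "continuous_on UNIV (P \<Phi>)"
      unfolding P_def by (intro continuous_intros) auto
    show "norm (P \<Phi> z) \<le> \<bar>q\<bar> + e + e * M" for z
      using diff_bound[OF \<Phi>, of z] clamp_to_abs[of e q "snd z"] e by simp
  qed
  have contr: "\<bar>P \<Phi> z - P \<Psi> z\<bar> \<le> 1 / 2 * D"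
    if c: "continuous_on UNIV \<Phi>" "continuous_on UNIV \<Psi>" and D: "\<And>z. \<bar>\<Phi> z - \<Psi> z\<bar> \<le> D" for \<Phi> \<Psi> z D
  proof -
    have "norm (integral {0..1} (\<lambda>t. J \<Phi> z t - J \<Psi> z t)) \<le> L * D * (1 - 0)"
    proof (rule integral_bound)
      show "continuous_on {0..1} (\<lambda>t. J \<Phi> z t - J \<Psi> z t)"
        by (intro continuous_intros contJ1 c)
      fix t :: real assume t: "t \<in> {0..1}"
      let ?y = "\<lambda>\<Phi>. \<Phi> (s t (fst z), clamp_to q e (snd z))"
      have "\<bar>J \<Phi> z t - J \<Psi> z t\<bar> \<le> L * \<bar>clamp_to q r (?y \<Phi>) - clamp_to q r (?y \<Psi>)\<bar>"
        unfolding J_def by (rule lip) (use sC[OF t] in \<open>auto simp: C_def\<close>)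
      also have "\<dots> \<le> L * D"
        by (intro mult_left_mono L(2) order_trans[OF clamp_to_lipschitz D])
      finally show "norm (J \<Phi> z t - J \<Psi> z t) \<le> L * D" by simp
    qed simp
    moreover have "integral {0..1} (\<lambda>t. J \<Phi> z t - J \<Psi> z t) = integral {0..1} (J \<Phi> z) - integral {0..1} (J \<Psi> z)"
      by (intro integral_diff integrable_continuous_real contJ1 c)
    ultimately have 1: "\<bar>integral {0..1} (J \<Phi> z) - integral {0..1} (J \<Psi> z)\<bar> \<le> L * D" by simp
    have "P \<Phi> z - P \<Psi> z = (clamp_to p e (fst z) - p) * (integral {0..1} (J \<Phi> z) - integral {0..1} (J \<Psi> z))"
      by (simp add: P_def algebra_simps)
    then have "\<bar>P \<Phi> z - P \<Psi> z\<bar> \<le> e * (L * D)"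
      using 1 clamp_to_abs[of e p "fst z"] e by (auto simp: abs_mult intro!: mult_mono)
    also have "\<dots> = (e * L) * D" by simp
    also have "\<dots> \<le> 1 / 2 * D"
      using e(4) D[of z] by (intro mult_right_mono) auto
    finally show ?thesis .
  qed
  \<comment> \<open>The operator is transported to the complete space of bounded continuous
    functions, where the contraction principle applies.\<close>
  define F where "F \<Phi> = Bcontfun (P (apply_bcontfun \<Phi>))" for \<Phi> :: "(real \<times> real) \<Rightarrow>\<^sub>C real"
  have F: "apply_bcontfun (F \<Phi>) = P (apply_bcontfun \<Phi>)" for \<Phi>
    unfolding F_def by (intro Bcontfun_inverse P) auto
  have "\<exists>!\<Phi>. F \<Phi> = \<Phi>"
  proof (rule banach_fix_type[of "1/2"])
    show "\<forall>\<Phi> \<Psi>. dist (F \<Phi>) (F \<Psi>) \<le> 1 / 2 * dist \<Phi> \<Psi>"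
    proof (intro allI)
      fix \<Phi> \<Psi>
      show "dist (F \<Phi>) (F \<Psi>) \<le> 1 / 2 * dist \<Phi> \<Psi>"
      proof (rule dist_bound)
        fix z
        have "\<bar>apply_bcontfun \<Phi> z - apply_bcontfun \<Psi> z\<bar> \<le> dist \<Phi> \<Psi>" for z
          using dist_bounded[of \<Phi> z \<Psi>] by (simp add: dist_real_def)
        then have "\<bar>P (apply_bcontfun \<Phi>) z - P (apply_bcontfun \<Psi>) z\<bar> \<le> 1 / 2 * dist \<Phi> \<Psi>"
          by (intro contr) auto
        then show "dist (apply_bcontfun (F \<Phi>) z) (apply_bcontfun (F \<Psi>) z) \<le> 1 / 2 * dist \<Phi> \<Psi>"
          by (simp add: F dist_real_def)
      qed
    qed
  qed auto
  then obtain \<Phi>0 where "F \<Phi>0 = \<Phi>0" by blast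
  define \<Phi> where "\<Phi> = apply_bcontfun \<Phi>0"
  have cont: "continuous_on UNIV \<Phi>" by (simp add: \<Phi>_def)
  have fp: "\<Phi> z = P \<Phi> z" for z
    using F[of \<Phi>0] \<open>F \<Phi>0 = \<Phi>0\<close> unfolding \<Phi>_def by simp
  \<comment> \<open>The displacement from q is at most e M + e < r, so at the fixed point the clamp
    on the values is inactive and the genuine integral equation results.\<close>
  have range: "\<bar>\<Phi> z - q\<bar> < r" for z
  proof -
    have "\<Phi> z - q = (P \<Phi> z - clamp_to q e (snd z)) + (clamp_to q e (snd z) - q)"
      by (subst fp) simp
    then show ?thesis
      using diff_bound[OF cont, of z] clamp_to_abs[of e q "snd z"] e by (simp add: abs_le_iff abs_less_iff)
  qed
  show thesis
  proof (rule that[of e r \<Phi>])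
    show "{p - e..p + e} \<times> {q - r..q + r} \<subseteq> \<Omega>"
      using C e r by (fastforce simp: C_def)
    show "continuous_on ({p - e<..<p + e} \<times> {q - e<..<q + e}) \<Phi>"
      by (rule continuous_on_subset[OF cont]) simp
    fix x w assume x: "x \<in> {p - e<..<p + e}" and w: "w \<in> {q - e<..<q + e}"
    show "\<Phi> (x, w) \<in> {q - r<..<q + r}"
      using range[of "(x, w)"] by (auto simp: abs_less_iff)
    have clamp: "clamp_to q r (\<Phi> z) = \<Phi> z" "clamp_to p e x = x" "clamp_to q e w = w" for z
      using range[of z] x w by (auto intro!: clamp_to_eq simp: abs_le_iff abs_less_iff)
    then have "J \<Phi> (x, w) = (\<lambda>t. a (p + t * (x - p), \<Phi> (p + t * (x - p), w)))"
      by (intro ext) (simp add: J_def s_def)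
    then show "\<Phi> (x, w) = w + (x - p) * integral {0..1} (\<lambda>t. a (p + t * (x - p), \<Phi> (p + t * (x - p), w)))"
      by (subst fp) (simp add: P_def clamp)
  qed (use e r in auto)
qed

text \<open>Continuity of fy controls the increment in the second variable uniformly, so the other
  partial derivative is only used at the point itself. For the flow it comes from the differential
  equation, and fy is an explicit exponential.\<close>

lemma has_derivative_continuous_partials:
  fixes f :: "real \<times> real \<Rightarrow> real"
  assumes S: "open S" "z \<in> S"
    and fx: "((\<lambda>x. f (x, snd z)) has_real_derivative fx) (at (fst z))"
    and fy: "\<And>x y. (x, y) \<in> S \<Longrightarrow> ((\<lambda>y. f (x, y)) has_real_derivative fy (x, y)) (at y)"
    and cont: "continuous_on S fy"
  shows "(f has_derivative (\<lambda>h. fst h * fx + snd h * fy z)) (at z)"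
proof -
  obtain A1 A2 where A: "open A1" "open A2" "fst z \<in> A1" "snd z \<in> A2" "A1 \<times> A2 \<subseteq> S"
    using S by (metis open_prod_elim mem_Times_iff)
  obtain d where d: "d > 0" "ball (snd z) d \<subseteq> A2" using A open_contains_ball by blast
  let ?X = "A1" and ?Y = "ball (snd z) d"
  have sub: "?X \<times> ?Y \<subseteq> S" using A(5) d by blast
  have open_XY: "open (?X \<times> ?Y)" using A by (intro open_Times) auto
  have z: "(fst z, snd z) \<in> ?X \<times> ?Y" using A d by (simp add: mem_Times_iff)
  have "((\<lambda>(x, y). f (x, y)) has_derivative
      (\<lambda>(tx, ty). (\<lambda>h. h * fx) tx + blinfun_apply (blinfun_scaleR_left (fy (fst z, snd z))) ty))
      (at (fst z, snd z) within ?X \<times> ?Y)"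
  proof (rule has_derivative_partialsI[where fy = "\<lambda>x y. blinfun_scaleR_left (fy (x, y))"])
    show "((\<lambda>x. f (x, snd z)) has_derivative (\<lambda>h. h * fx)) (at (fst z) within ?X)"
    proof -
      have "(\<lambda>h. h * fx) = (*) fx" by (auto simp: mult.commute)
      then show ?thesis
        using fx unfolding has_field_derivative_def by (simp add: has_derivative_at_withinI)
    qed
  next
    fix x y assume "x \<in> ?X" "y \<in> ?Y"
    then have "(x, y) \<in> S" using sub by blast
    then show "((\<lambda>y. f (x, y)) has_derivative blinfun_apply (blinfun_scaleR_left (fy (x, y)))) (at y within ?Y)"
    proof -
      have "blinfun_apply (blinfun_scaleR_left (fy (x, y))) = (*) (fy (x, y))" by (auto simp: mult.commute)
      moreover have "((\<lambda>y. f (x, y)) has_derivative (*) (fy (x, y))) (at y)"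
        using fy[OF \<open>(x, y) \<in> S\<close>] unfolding has_field_derivative_def .
      ultimately show ?thesis by (simp add: has_derivative_at_withinI)
    qed
  next
    have "continuous_on (?X \<times> ?Y) (\<lambda>z. blinfun_scaleR_left (fy z))"
      using continuous_on_subset[OF cont sub] by (intro continuous_intros)
    then have "continuous (at (fst z, snd z) within ?X \<times> ?Y) (\<lambda>z. blinfun_scaleR_left (fy z))"
      using z continuous_on_eq_continuous_within by blast
    then show "continuous (at (fst z, snd z) within ?X \<times> ?Y) (\<lambda>(x, y). blinfun_scaleR_left (fy (x, y)))"
      by (simp add: case_prod_unfold)
  qed (use d in auto)
  then show ?thesis
    using z at_within_open[OF z open_XY] by (simp add: case_prod_unfold)
qed

text \<open>Along the flow the difference of two solutions satisfies a linear equation with continuous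
  coefficient \<open>b\<close>, so its quotient by the difference of the initial values is an exponential.\<close>

lemma scalar_flow_differentiable:
  fixes a \<Phi> :: "real \<times> real \<Rightarrow> real" and p q e r :: real
  defines "B \<equiv> {p - e<..<p + e} \<times> {q - e<..<q + e}"
  assumes e: "e > 0" and \<Omega>: "open \<Omega>" "{p - e..p + e} \<times> {q - r..q + r} \<subseteq> \<Omega>" and a: "smooth_on \<Omega> a"
    and cont: "continuous_on B \<Phi>"
    and range: "\<And>x w. (x, w) \<in> B \<Longrightarrow> \<Phi> (x, w) \<in> {q - r<..<q + r}"
    and eq: "\<And>x w. (x, w) \<in> B \<Longrightarrow>
       \<Phi> (x, w) = w + (x - p) * integral {0..1} (\<lambda>t. a (p + t * (x - p), \<Phi> (p + t * (x - p), w)))"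
    and z: "z \<in> B"
  shows "(\<Phi> has_derivative (\<lambda>h. fst h * a (fst z, \<Phi> z) + snd h *
    exp ((fst z - p) * integral {0..1} (\<lambda>t. fderiv a (p + t * (fst z - p), \<Phi> (p + t * (fst z - p), snd z)) (0, 1)))))
    (at z)"
proof -
  define X where "X = {p - e<..<p + e}"
  define W where "W = {q - e<..<q + e}"
  have B: "B = X \<times> W" by (simp add: B_def X_def W_def)
  have openB: "open B" unfolding B_def by (intro open_Times) auto
  have XJ: "(x, y) \<in> \<Omega>" if "x \<in> X" "y \<in> {q - r<..<q + r}" for x y
    using that \<Omega>(2) by (auto simp: X_def)
  have inX: "p + t * (x - p) \<in> X" if "t \<in> {0..1}" "x \<in> X" for t x
  proof -
    have "\<bar>t * (x - p)\<bar> \<le> 1 * \<bar>x - p\<bar>"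
      unfolding abs_mult using that by (intro mult_right_mono) auto
    then show ?thesis using that(2) by (auto simp: X_def abs_le_iff)
  qed
  have pX: "p \<in> X" using e by (simp add: X_def)
  have conta: "continuous_on \<Omega> a" by (rule smooth_on_continuous_on[OF a])
  define ay where "ay z = fderiv a z (0, 1)" for z
  have contay: "continuous_on \<Omega> ay"
    unfolding ay_def by (rule smooth_on_continuous_on[OF smooth_on_fderiv[OF a]])
  have contx: "continuous_on X (\<lambda>x. \<Phi> (x, w))" if "w \<in> W" for w
    by (rule continuous_on_compose2[OF cont]) (use that in \<open>auto simp: B intro!: continuous_intros\<close>)
  have \<Phi>x: "((\<lambda>x. \<Phi> (x, w)) has_real_derivative a (x, \<Phi> (x, w))) (at x)" if "x \<in> X" "w \<in> W" for x w
  proof -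
    have "continuous_on X (\<lambda>x. a (x, \<Phi> (x, w)))"
      by (rule continuous_on_compose2[OF conta])
        (use that(2) XJ range in \<open>auto simp: B intro!: continuous_intros contx\<close>)
    then have "((\<lambda>x. w + (x - p) * integral {0..1} (\<lambda>t. a (p + t * (x - p), \<Phi> (p + t * (x - p), w))))
        has_real_derivative 0 + a (x, \<Phi> (x, w))) (at x)"
      using that(1) unfolding X_def by (intro DERIV_add DERIV_const normalized_integral_has_derivative)
    then have "((\<lambda>x. w + (x - p) * integral {0..1} (\<lambda>t. a (p + t * (x - p), \<Phi> (p + t * (x - p), w))))
        has_real_derivative a (x, \<Phi> (x, w))) (at x)" by simp
    then show ?thesis
      by (rule has_field_derivative_transform_within_open[where S = X])
        (use that eq in \<open>auto simp: B X_def\<close>)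
  qed
  have \<Phi>0: "\<Phi> (p, w) = w" if "w \<in> W" for w
    using eq[of p w] that pX by (simp add: B)
  \<comment> \<open>The segment between two solution values at the same time. It stays in the convex
    range of the flow, so the derivative of \<open>a\<close> can be averaged along it, as in
    Hadamard's lemma.\<close>
  define seg where "seg t x w w' = \<Phi> (x, w) + t * (\<Phi> (x, w') - \<Phi> (x, w))" for t x w w'
  have seg: "seg t x w w' \<in> {q - r<..<q + r}" if "t \<in> {0..1}" "x \<in> X" "w \<in> W" "w' \<in> W" for t x w w'
  proof -
    have "(1 - t) *\<^sub>R \<Phi> (x, w) + t *\<^sub>R \<Phi> (x, w') \<in> {q - r<..<q + r}"
      by (rule convexD) (use that range in \<open>auto simp: B\<close>)
    then show ?thesis by (simp add: seg_def algebra_simps)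
  qed
  \<comment> \<open>Unlike a difference quotient of \<open>a\<close>, this average is defined and
    continuous across w = w'.\<close>
  define b where "b x w w' = integral {0..1} (\<lambda>t. ay (x, seg t x w w'))" for x w w'
  have contb: "continuous_on (X \<times> W \<times> W) (\<lambda>x. b (fst x) (fst (snd x)) (snd (snd x)))"
  proof -
    have "continuous_on ({0..1} \<times> X \<times> W \<times> W) (\<lambda>y. ay (fst (snd y), seg (fst y) (fst (snd y)) (fst (snd (snd y))) (snd (snd (snd y)))))"
    proof (rule continuous_on_compose2[OF contay])
      have "continuous_on ({0..1} \<times> X \<times> W \<times> W) (\<lambda>y. \<Phi> (fst (snd y), fst (snd (snd y))))"
        "continuous_on ({0..1} \<times> X \<times> W \<times> W) (\<lambda>y. \<Phi> (fst (snd y), snd (snd (snd y))))"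
        by (rule continuous_on_compose2[OF cont]; auto simp: B intro!: continuous_intros)+
      then show "continuous_on ({0..1} \<times> X \<times> W \<times> W) (\<lambda>y. (fst (snd y), seg (fst y) (fst (snd y)) (fst (snd (snd y))) (snd (snd (snd y)))))"
        unfolding seg_def by (intro continuous_intros) auto
    qed (use seg XJ in auto)
    from continuous_on_param_integral[OF order_refl this] show ?thesis
      by (simp add: b_def)
  qed
  define E where "E x w w' = (x - p) * integral {0..1} (\<lambda>t. b (p + t * (x - p)) w w')" for x w w'
  have contE: "continuous_on (X \<times> W \<times> W) (\<lambda>x. E (fst x) (fst (snd x)) (snd (snd x)))"
  proof -
    have "continuous_on ({0..1} \<times> X \<times> W \<times> W)
        (\<lambda>y. b (p + fst y * (fst (snd y) - p)) (fst (snd (snd y))) (snd (snd (snd y))))"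
    proof -
      have "continuous_on ({0..1} \<times> X \<times> W \<times> W)
          (\<lambda>y. (p + fst y * (fst (snd y) - p), fst (snd (snd y)), snd (snd (snd y))))"
        by (intro continuous_intros)
      from continuous_on_compose2[OF contb this] show ?thesis
        using inX by (simp add: image_subset_iff mem_Times_iff)
    qed
    from continuous_on_param_integral[OF order_refl this]
    have "continuous_on (X \<times> W \<times> W) (\<lambda>x. integral {0..1} (\<lambda>t. b (p + t * (fst x - p)) (fst (snd x)) (snd (snd x))))"
      by simp
    then show ?thesis
      unfolding E_def by (intro continuous_intros)
  qed
  have diff: "\<Phi> (x, w') - \<Phi> (x, w) = (w' - w) * exp (E x w w')" if "x \<in> X" "w \<in> W" "w' \<in> W" for x w w'
  proof -
    define \<Delta> where "\<Delta> x = \<Phi> (x, w') - \<Phi> (x, w)" for x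
    have hadamard: "a (x, \<Phi> (x, w')) - a (x, \<Phi> (x, w)) = b x w w' * \<Delta> x" if "x \<in> X" for x
    proof -
      have "((\<lambda>t. a (x, seg t x w w')) has_vector_derivative \<Delta> x * ay (x, seg t x w w')) (at t within {0..1})"
        if t: "t \<in> {0..1}" for t
      proof -
        have mem: "(x, seg t x w w') \<in> \<Omega>"
          using seg[OF t \<open>x \<in> X\<close> \<open>w \<in> W\<close> \<open>w' \<in> W\<close>] XJ[OF \<open>x \<in> X\<close>] by blast
        have line: "(x, seg t x w w') = (x, \<Phi> (x, w)) + t *\<^sub>R (0, \<Delta> x)" for t
          by (simp add: seg_def \<Delta>_def)
        have "fderiv a (x, seg t x w w') (\<Delta> x *\<^sub>R (0, 1)) = \<Delta> x *\<^sub>R ay (x, seg t x w w')"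
          unfolding ay_def by (rule linear_cmul[OF smooth_on_linear_fderiv[OF a mem]])
        then have "fderiv a (x, seg t x w w') (0, \<Delta> x) = \<Delta> x * ay (x, seg t x w w')" by simp
        moreover have "((\<lambda>t. a ((x, \<Phi> (x, w)) + t *\<^sub>R (0, \<Delta> x))) has_vector_derivative
            fderiv a ((x, \<Phi> (x, w)) + t *\<^sub>R (0, \<Delta> x)) (0, \<Delta> x)) (at t within {0..1})"
          by (rule has_derivative_along_line[OF smooth_on_has_derivative[OF a]]) (use mem line in metis)
        ultimately show ?thesis by (simp only: line[symmetric])
      qed
      from integral_unique[OF fundamental_theorem_of_calculus[OF _ this]]
      show ?thesis by (simp add: b_def seg_def mult.commute)
    qed
    have "\<Delta> x = \<Delta> p * exp ((x - p) * integral {0..1} (\<lambda>t. b (p + t * (x - p)) w w'))"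
    proof (rule linear_scalar_ode_unique[OF _ e])
      have "continuous_on X (\<lambda>x. (x, w, w'))" by (intro continuous_intros)
      from continuous_on_compose2[OF contb this] show "continuous_on {p - e<..<p + e} (\<lambda>x. b x w w')"
        using that by (simp add: X_def image_subset_iff)
      show "(\<Delta> has_real_derivative b x w w' * \<Delta> x) (at x)" if "x \<in> {p - e<..<p + e}" for x
      proof -
        have x: "x \<in> X" using that by (simp add: X_def)
        have "(\<Delta> has_real_derivative a (x, \<Phi> (x, w')) - a (x, \<Phi> (x, w))) (at x)"
          unfolding \<Delta>_def by (rule DERIV_diff[OF \<Phi>x[OF x \<open>w' \<in> W\<close>] \<Phi>x[OF x \<open>w \<in> W\<close>]])
        then show ?thesis by (simp only: hadamard[OF x])
      qed
    qed (use that in \<open>simp add: X_def\<close>)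
    then show ?thesis
      using that \<Phi>0 by (simp add: \<Delta>_def E_def)
  qed
  \<comment> \<open>For w' \<noteq> w the difference quotient is exactly
    \<open>exp (E x w w')\<close>; continuity of \<open>E\<close> at w' = w gives the limit.\<close>
  have \<Phi>w: "((\<lambda>w. \<Phi> (x, w)) has_real_derivative exp (E x w w)) (at w)" if "x \<in> X" "w \<in> W" for x w
  proof -
    have openW: "open W" by (simp add: W_def)
    have "continuous_on W (\<lambda>w'. (x, w, w'))" by (intro continuous_intros)
    from continuous_on_compose2[OF contE this] have "continuous_on W (\<lambda>w'. exp (E x w w'))"
      using that by (auto intro!: continuous_intros)
    then have "((\<lambda>w'. exp (E x w w')) \<longlongrightarrow> exp (E x w w)) (at w)"
      using that(2) openW by (simp add: continuous_on_eq_continuous_at isCont_def)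
    then have "((\<lambda>w'. (\<Phi> (x, w') - \<Phi> (x, w)) / (w' - w)) \<longlongrightarrow> exp (E x w w)) (at w)"
      by (rule Lim_transform_within_open[OF _ openW that(2)]) (use diff that in auto)
    then show ?thesis by (simp add: has_field_derivative_iff)
  qed
  have "continuous_on B (\<lambda>z. exp (E (fst z) (snd z) (snd z)))"
  proof -
    have "continuous_on B (\<lambda>z. (fst z, snd z, snd z))" by (intro continuous_intros)
    moreover have "(\<lambda>z. (fst z, snd z, snd z)) ` B \<subseteq> X \<times> W \<times> W" by (auto simp: B)
    ultimately have "continuous_on B (\<lambda>z. E (fst z) (snd z) (snd z))"
      using continuous_on_compose2[OF contE] by fastforce
    then show ?thesis by (intro continuous_intros)
  qed
  from has_derivative_continuous_partials[OF openB z, of \<Phi> _ "\<lambda>z. exp (E (fst z) (snd z) (snd z))", OF \<Phi>x _ this]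
  have "(\<Phi> has_derivative (\<lambda>h. fst h * a (fst z, \<Phi> (fst z, snd z)) + snd h * exp (E (fst z) (snd z) (snd z)))) (at z)"
    using z \<Phi>w by (auto simp: B)
  \<comment> \<open>On the diagonal the segment is a single point, and \<open>E\<close> becomes the
    exponent of the variational equation.\<close>
  moreover have "b x w w = ay (x, \<Phi> (x, w))" for x w
    by (simp add: b_def seg_def)
  ultimately show ?thesis
    by (simp add: E_def ay_def)
qed

text \<open>Both partial derivatives of the flow are expressions in the flow: a(x, \<Phi>), and the
  exponential \<open>H\<close> of an integral over values of \<Phi>. So k-fold differentiability of
  \<Phi> passes to its derivative, and induction gives smoothness.\<close>

lemma smooth_scalar_flow:
  fixes a :: "real \<times> real \<Rightarrow> real"
  assumes \<Omega>: "open \<Omega>" "(p, q) \<in> \<Omega>" and a: "smooth_on \<Omega> a"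
  obtains e \<Phi> where "e > 0" "smooth_on ({p - e<..<p + e} \<times> {q - e<..<q + e}) \<Phi>"
    "\<Phi> (p, q) = q"
    "\<And>z. z \<in> {p - e<..<p + e} \<times> {q - e<..<q + e} \<Longrightarrow> (fst z, \<Phi> z) \<in> \<Omega>"
    "\<And>z. z \<in> {p - e<..<p + e} \<times> {q - e<..<q + e} \<Longrightarrow> fderiv \<Phi> z (1, 0) = a (fst z, \<Phi> z)"
    "\<And>z. z \<in> {p - e<..<p + e} \<times> {q - e<..<q + e} \<Longrightarrow> fderiv \<Phi> z (0, 1) > 0"
proof (rule scalar_flow_exists[OF \<Omega> a])
  fix e r \<Phi> assume e: "e > 0" "e \<le> r" and sub: "{p - e..p + e} \<times> {q - r..q + r} \<subseteq> \<Omega>"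
    and cont: "continuous_on ({p - e<..<p + e} \<times> {q - e<..<q + e}) \<Phi>"
    and range: "\<And>x w. x \<in> {p - e<..<p + e} \<Longrightarrow> w \<in> {q - e<..<q + e} \<Longrightarrow> \<Phi> (x, w) \<in> {q - r<..<q + r}"
    and eq: "\<And>x w. x \<in> {p - e<..<p + e} \<Longrightarrow> w \<in> {q - e<..<q + e} \<Longrightarrow>
       \<Phi> (x, w) = w + (x - p) * integral {0..1} (\<lambda>t. a (p + t * (x - p), \<Phi> (p + t * (x - p), w)))"
  define B where "B = {p - e<..<p + e} \<times> {q - e<..<q + e}"
  have openB: "open B" unfolding B_def by (intro open_Times) auto
  define ay where "ay z = fderiv a z (0, 1)" for z
  have smay: "smooth_on \<Omega> ay" unfolding ay_def by (rule smooth_on_fderiv[OF a])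
  define H where "H z = exp ((fst z - p) * integral {0..1} (\<lambda>t. ay (p + t * (fst z - p), \<Phi> (p + t * (fst z - p), snd z))))" for z
  have D: "(\<Phi> has_derivative (\<lambda>h. fst h * a (fst z, \<Phi> z) + snd h * H z)) (at z)" if "z \<in> B" for z
    unfolding H_def ay_def
    by (rule scalar_flow_differentiable[OF e(1) \<Omega>(1) sub a cont]) (use range eq that in \<open>auto simp: B_def\<close>)
  have mem: "(fst z, \<Phi> z) \<in> \<Omega>" if "z \<in> B" for z
    using range[of "fst z" "snd z"] that sub by (auto simp: B_def subset_iff)
  have "times_differentiable_on k B \<Phi>" for k
  proof (induction k)
    case 0
    then show ?case using cont by (simp add: B_def)
  next
    case (Suc k)
    \<comment> \<open>The domain type is left open because the rule is applied to pairs (x, w) and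
      to the triples (t, x, w) under the integral in \<open>H\<close>.\<close>
    have comp: "times_differentiable_on k A (\<lambda>z. c (\<phi> z, \<Phi> (\<phi> z, \<psi> z)))"
      if "smooth_on \<Omega> c" "open A" "smooth_on A \<phi>" "smooth_on A \<psi>" "\<And>z. z \<in> A \<Longrightarrow> (\<phi> z, \<psi> z) \<in> B"
      for A :: "'z::real_normed_vector set" and c \<phi> \<psi>
    proof -
      have "times_differentiable_on k A (\<lambda>z. (\<phi> z, \<psi> z))"
        using that by (intro times_differentiable_Pair smooth_on_times_differentiable)
      from times_differentiable_compose[OF that(2) openB _ this Suc]
      have "times_differentiable_on k A (\<lambda>z. \<Phi> (\<phi> z, \<psi> z))" using that(5) by blast
      then have "times_differentiable_on k A (\<lambda>z. (\<phi> z, \<Phi> (\<phi> z, \<psi> z)))"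
        by (rule times_differentiable_Pair[OF that(2) smooth_on_times_differentiable[OF that(3)]])
      from times_differentiable_compose[OF that(2) \<Omega>(1) _ this smooth_on_times_differentiable[OF that(1)]]
      show ?thesis using mem that(5) by force
    qed
    have sfst: "smooth_on A (fst :: real \<times> real \<Rightarrow> real)" and ssnd: "smooth_on A (snd :: real \<times> real \<Rightarrow> real)" for A
      by (intro smooth_on_bounded_linear bounded_linear_fst bounded_linear_snd)+
    have ta: "times_differentiable_on k B (\<lambda>z. a (fst z, \<Phi> z))"
      using comp[OF a openB sfst ssnd] by simp
    have tH: "times_differentiable_on k B H"
    proof -
      \<comment> \<open>An open set containing {0..1} \<times> B on which the integrand of
        \<open>H\<close> makes sense.\<close>
      define T where "T = (\<lambda>y::real \<times> real \<times> real. (p + fst y * (fst (snd y) - p), snd (snd y))) -` B"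
      have sm1: "smooth_on A (\<lambda>y::real \<times> real \<times> real. p + fst y * (fst (snd y) - p))"
        and sm2: "smooth_on A (\<lambda>y::real \<times> real \<times> real. snd (snd y))" if "open A" for A
        by (intro smooth_on_add smooth_on_mult smooth_on_diff smooth_on_const that smooth_on_bounded_linear
            bounded_linear_fst bounded_linear_snd
            bounded_linear_compose[OF bounded_linear_fst bounded_linear_snd]
            bounded_linear_compose[OF bounded_linear_snd bounded_linear_snd])+
      have T: "open T"
        unfolding T_def using openB by (rule open_vimage) (intro continuous_intros)
      have sub: "{0..1} \<times> B \<subseteq> T"
      proof
        fix y :: "real \<times> real \<times> real" assume y: "y \<in> {0..1} \<times> B"
        have "\<bar>fst y * (fst (snd y) - p)\<bar> \<le> 1 * \<bar>fst (snd y) - p\<bar>"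
          unfolding abs_mult using y by (intro mult_right_mono) auto
        then show "y \<in> T" using y by (auto simp: T_def B_def abs_le_iff)
      qed
      have "times_differentiable_on k T (\<lambda>y. ay (p + fst y * (fst (snd y) - p),
          \<Phi> (p + fst y * (fst (snd y) - p), snd (snd y))))"
        by (rule comp[OF smay T sm1[OF T] sm2[OF T]]) (simp add: T_def)
      from times_differentiable_param_integral[OF openB sub this]
      have "times_differentiable_on k B (\<lambda>z. integral {0..1} (\<lambda>t. ay (p + t * (fst z - p), \<Phi> (p + t * (fst z - p), snd z))))"
        by simp
      moreover have "times_differentiable_on k B (\<lambda>z. fst z - p)"
        by (intro smooth_on_times_differentiable smooth_on_diff smooth_on_const sfst openB)
      ultimately have "times_differentiable_on k B (\<lambda>z. (fst z - p) * integral {0..1} (\<lambda>t. ay (p + t * (fst z - p), \<Phi> (p + t * (fst z - p), snd z))))"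
        by (intro times_differentiable_bilinear[OF bounded_bilinear_mult openB])
      from times_differentiable_compose[OF openB open_UNIV _ this times_differentiable_exp]
      show ?thesis by (simp add: H_def[abs_def])
    qed
    show ?case
    proof (rule times_differentiable_SucI[OF openB D])
      fix v
      show "times_differentiable_on k B (\<lambda>x. fst v * a (fst x, \<Phi> x) + snd v * H x)"
        by (intro times_differentiable_add openB times_differentiable_const ta tH
            times_differentiable_bilinear[OF bounded_bilinear_mult openB])
    qed
  qed
  then have sm: "smooth_on B \<Phi>" by (simp add: smooth_on_def)
  show thesis
  proof (rule that[OF e(1)])
    show "\<Phi> (p, q) = q" using eq[of p q] e by simp
    fix z assume "z \<in> {p - e<..<p + e} \<times> {q - e<..<q + e}"
    then have z: "z \<in> B" by (simp only: B_def)
    show "(fst z, \<Phi> z) \<in> \<Omega>" by (rule mem[OF z])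
    show "fderiv \<Phi> z (1, 0) = a (fst z, \<Phi> z)" "fderiv \<Phi> z (0, 1) > 0"
      by (simp_all add: fderiv_at[OF D[OF z]] H_def)
  qed (use sm in \<open>simp add: B_def\<close>)
qed

text \<open>\<open>v\<close> assigns to (x, y) the value at the initial abscissa of the solution
  through (x, y), which is constant along solutions. It is obtained as the second component of the
  inverse of (x, w) \<mapsto> (x, \<Phi>(x, w)).\<close>

lemma first_integral_scalar:
  fixes a :: "real \<times> real \<Rightarrow> real"
  assumes \<Omega>: "open \<Omega>" "p \<in> \<Omega>" and a: "smooth_on \<Omega> a"
  obtains A and v :: "real \<times> real \<Rightarrow> real" where "open A" "p \<in> A" "A \<subseteq> \<Omega>" "smooth_on A v"
    "\<And>z. z \<in> A \<Longrightarrow> fderiv v z (1, a z) = 0" "\<And>z. z \<in> A \<Longrightarrow> fderiv v z (0, 1) > 0"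
proof -
  obtain e \<Phi> where e: "e > 0" and sm: "smooth_on ({fst p - e<..<fst p + e} \<times> {snd p - e<..<snd p + e}) \<Phi>"
    and p: "\<Phi> (fst p, snd p) = snd p"
    and mem: "\<And>z. z \<in> {fst p - e<..<fst p + e} \<times> {snd p - e<..<snd p + e} \<Longrightarrow> (fst z, \<Phi> z) \<in> \<Omega>"
    and \<Phi>x: "\<And>z. z \<in> {fst p - e<..<fst p + e} \<times> {snd p - e<..<snd p + e} \<Longrightarrow> fderiv \<Phi> z (1, 0) = a (fst z, \<Phi> z)"
    and \<Phi>w: "\<And>z. z \<in> {fst p - e<..<fst p + e} \<times> {snd p - e<..<snd p + e} \<Longrightarrow> fderiv \<Phi> z (0, 1) > 0"
    using smooth_scalar_flow[of \<Omega> "fst p" "snd p" a] \<Omega> a by auto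
  define B where "B = {fst p - e<..<fst p + e} \<times> {snd p - e<..<snd p + e}"
  note sm = sm[folded B_def] and mem = mem[folded B_def] and \<Phi>x = \<Phi>x[folded B_def] and \<Phi>w = \<Phi>w[folded B_def]
  have B: "open B" "p \<in> B"
    unfolding B_def by (intro open_Times) (use e in \<open>auto simp: mem_Times_iff\<close>)
  define F where "F z = (fst z, \<Phi> z)" for z
  \<comment> \<open>The inverse of the triangular differential of \<open>F\<close>; the division is
    by the positive derivative of \<Phi> in the initial value.\<close>
  define R where "R z h = (fst h, (snd h - fderiv \<Phi> z (1, 0) * fst h) / fderiv \<Phi> z (0, 1))" for z h :: "real \<times> real"
  have F: "smooth_on B F"
    unfolding F_def by (intro smooth_on_Pair B sm smooth_on_bounded_linear bounded_linear_fst)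
  have R: "smooth_on B (\<lambda>z. R z h)" for h
    unfolding R_def using \<Phi>w
    by (intro smooth_on_Pair B smooth_on_const smooth_on_divide smooth_on_diff smooth_on_mult smooth_on_fderiv sm)
      force
  have \<Phi>lin: "fderiv \<Phi> z h = fst h * fderiv \<Phi> z (1, 0) + snd h * fderiv \<Phi> z (0, 1)" if "z \<in> B" for z h
  proof -
    note lin = smooth_on_linear_fderiv[OF sm that]
    have "fderiv \<Phi> z h = fderiv \<Phi> z (fst h *\<^sub>R (1, 0) + snd h *\<^sub>R (0, 1))" by simp
    then show ?thesis by (simp only: linear_add[OF lin] linear_cmul[OF lin] real_scaleR_def)
  qed
  have DF: "fderiv F z h = (fst h, fderiv \<Phi> z h)" if "z \<in> B" for z h
  proof -
    have "(F has_derivative (\<lambda>h. (fst h, fderiv \<Phi> z h))) (at z)"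
      unfolding F_def by (intro has_derivative_Pair has_derivative_fst has_derivative_ident
          smooth_on_has_derivative[OF sm that])
    then show ?thesis by (simp add: fderiv_at)
  qed
  have inv1: "R z (fderiv F z h) = h" and inv2: "fderiv F z (R z h) = h" if "z \<in> B" for z h
    using \<Phi>w[OF that] unfolding DF[OF that] \<Phi>lin[OF that, of h] \<Phi>lin[OF that, of "R z h"]
    by (auto simp: R_def prod_eq_iff field_simps)
  show thesis
  proof (rule smooth_local_inverse[OF B F R inv1 inv2])
    fix S' G assume G: "open S'" "p \<in> S'" "S' \<subseteq> B" "open (F ` S')" "smooth_on (F ` S') G"
      "\<And>x. x \<in> S' \<Longrightarrow> G (F x) = x" "\<And>x. x \<in> S' \<Longrightarrow> (G has_derivative R x) (at (F x))"
    show thesis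
    proof (rule that[of "F ` S'" "\<lambda>z. snd (G z)"])
      show "open (F ` S')" by fact
      \<comment> \<open>The base point lies at the initial abscissa, so it is its own image and the
        image domain is a neighbourhood of it.\<close>
      have "F p = p" using p by (simp add: F_def)
      then show "p \<in> F ` S'" using G(2) by force
      show "F ` S' \<subseteq> \<Omega>" using mem G(3) by (auto simp: F_def)
      show "smooth_on (F ` S') (\<lambda>z. snd (G z))"
        by (rule smooth_on_linear[OF bounded_linear_snd G(4,5)])
      fix z assume "z \<in> F ` S'"
      then obtain x where x: "x \<in> S'" "z = F x" by blast
      then have xB: "x \<in> B" using G(3) by blast
      have D: "fderiv (\<lambda>z. snd (G z)) z h = snd (R x h)" for h
        using fderiv_at[OF has_derivative_snd[OF G(7)[OF x(1)]]] x(2) by simp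
      show "fderiv (\<lambda>z. snd (G z)) z (1, a z) = 0"
        unfolding D using \<Phi>x[OF xB] by (simp add: R_def x F_def)
      show "fderiv (\<lambda>z. snd (G z)) z (0, 1) > 0"
        unfolding D using \<Phi>w[OF xB] by (simp add: R_def)
    qed
  qed
qed

section \<open>Coordinates adapted to a frame of the plane\<close>

definition det2 :: "real^2 \<Rightarrow> real^2 \<Rightarrow> real" where
  "det2 x y = x $ 1 * y $ 2 - x $ 2 * y $ 1"

lemma det2_Cramer:
  assumes "det2 x y \<noteq> 0"
  shows "w = (det2 w y / det2 x y) *\<^sub>R x + (det2 x w / det2 x y) *\<^sub>R y"
proof -
  have "det2 x y *\<^sub>R w = det2 w y *\<^sub>R x + det2 x w *\<^sub>R y"
    by (simp add: vec_eq_iff forall_2 det2_def algebra_simps)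
  then have "w = inverse (det2 x y) *\<^sub>R (det2 w y *\<^sub>R x + det2 x w *\<^sub>R y)"
    using assms by (metis scaleR_scaleR left_inverse scaleR_one)
  then show ?thesis by (simp add: scaleR_add_right divide_inverse mult.commute)
qed

lemma det2_self [simp]: "det2 x x = 0"
  by (simp add: det2_def)

lemma det2_nonzeroI:
  assumes "\<And>s t. s *\<^sub>R x + t *\<^sub>R y = 0 \<Longrightarrow> s = 0 \<and> t = 0"
  shows "det2 x y \<noteq> 0"
proof
  assume 0: "det2 x y = 0"
  \<comment> \<open>If the determinant vanishes, (y2, - x2) and (y1, - x1) are coefficients of
    linear relations between x and y; independence makes them zero, so x = 0, itself a
    contradiction.\<close>
  have "y $ 2 = 0 \<and> - (x $ 2) = 0" "y $ 1 = 0 \<and> - (x $ 1) = 0"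
    by (rule assms, use 0 in \<open>simp add: vec_eq_iff forall_2 det2_def algebra_simps\<close>)+
  then have "x = 0" by (simp add: vec_eq_iff forall_2)
  then show False using assms[of 1 0] by simp
qed

lemma bounded_linear_det2_left: "bounded_linear (\<lambda>x. det2 x y)"
  and bounded_linear_det2_right: "bounded_linear (\<lambda>y. det2 x y)"
  by (simp_all add: det2_def linear_conv_bounded_linear[symmetric] linear_iff algebra_simps)

lemma smooth_on_det2:
  assumes "open S" "smooth_on S X" "smooth_on S Y"
  shows "smooth_on S (\<lambda>z. det2 (X z) (Y z))"
  unfolding det2_def using assms by (intro smooth_on_diff smooth_on_mult smooth_on_nth)

text \<open>In the linear coordinates given by the basis \<open>X p\<close>, \<open>Y p\<close>, the field \<open>X\<close> is near \<open>p\<close> a positive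
  multiple of \<open>(1, a)\<close>.\<close>

lemma first_integral:
  fixes X Y :: "real^2 \<Rightarrow> real^2"
  assumes S: "open S" "p \<in> S" and X: "smooth_on S X" and Y: "smooth_on S Y"
    and indep: "det2 (X p) (Y p) \<noteq> 0"
  obtains A and v :: "real^2 \<Rightarrow> real" where "open A" "p \<in> A" "A \<subseteq> S" "smooth_on A v"
    "\<And>z. z \<in> A \<Longrightarrow> fderiv v z (X z) = 0" "\<And>z. z \<in> A \<Longrightarrow> fderiv v z (Y z) > 0"
proof -
  define D where "D = det2 (X p) (Y p)"
  define \<alpha> where "\<alpha> w = det2 w (Y p) / D" for w
  define \<beta> where "\<beta> w = det2 (X p) w / D" for w
  have D: "D \<noteq> 0" using indep by (simp add: D_def)
  have bl: "bounded_linear \<alpha>" "bounded_linear \<beta>"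
    unfolding \<alpha>_def[abs_def] \<beta>_def[abs_def] divide_inverse
    by (intro bounded_linear_mult_const bounded_linear_det2_left bounded_linear_det2_right)+
  have base: "\<alpha> (X p) = 1" "\<beta> (X p) = 0" "\<alpha> (Y p) = 0" "\<beta> (Y p) = 1"
    using D by (auto simp: \<alpha>_def \<beta>_def D_def)
  have expand: "w = \<alpha> w *\<^sub>R X p + \<beta> w *\<^sub>R Y p" for w
    using det2_Cramer[OF indep, of w] by (simp add: \<alpha>_def \<beta>_def D_def)
  \<comment> \<open>\<open>K\<close> reads off coordinates with origin p relative to the basis X p,
    Y p, and \<open>L\<close> undoes this.\<close>
  define L where "L h = p + (fst h *\<^sub>R X p + snd h *\<^sub>R Y p)" for h :: "real \<times> real"
  define K where "K z = (\<alpha> (z - p), \<beta> (z - p))" for z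
  have LK: "L (K z) = z" for z
    using expand[of "z - p"] by (simp add: L_def K_def flip: expand)
  \<comment> \<open>Here the first component of X is positive, so X may be divided by it; a function
    is constant along X exactly if it is constant along (1, a).\<close>
  define S' where "S' = S \<inter> (\<lambda>z. \<alpha> (X z)) -` {0<..}"
  have S': "open S'"
    unfolding S'_def by (rule continuous_open_preimage[OF smooth_on_continuous_on S(1)])
      (use S X bl in \<open>auto intro: smooth_on_linear\<close>)
  have pS': "p \<in> S'" using S base by (simp add: S'_def)
  have Xpos: "\<alpha> (X z) > 0" if "z \<in> S'" for z using that by (simp add: S'_def)
  have X': "smooth_on S' X" by (rule smooth_on_subset[OF X]) (auto simp: S'_def)
  have smL: "smooth_on A L" if "open A" for A
    unfolding L_def
    by (intro smooth_on_add smooth_on_scaleR smooth_on_const that smooth_on_bounded_linear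
        bounded_linear_fst bounded_linear_snd)
  define \<Omega> where "\<Omega> = L -` S'"
  have \<Omega>: "open \<Omega>"
    unfolding \<Omega>_def using smooth_on_continuous_on[OF smL[OF open_UNIV]] S' by (intro open_vimage) auto
  have K\<Omega>: "K z \<in> \<Omega> \<longleftrightarrow> z \<in> S'" for z
    by (simp add: \<Omega>_def LK)
  define a where "a h = \<beta> (X (L h)) / \<alpha> (X (L h))" for h
  have XL: "smooth_on \<Omega> (\<lambda>h. X (L h))"
    by (rule smooth_on_compose[OF \<Omega> S' _ smL[OF \<Omega>] X']) (auto simp: \<Omega>_def)
  have a: "smooth_on \<Omega> a"
    unfolding a_def
    by (intro smooth_on_divide \<Omega> smooth_on_linear[OF bl(1) \<Omega> XL] smooth_on_linear[OF bl(2) \<Omega> XL])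
      (use Xpos in \<open>force simp: \<Omega>_def\<close>)
  show thesis
  proof (rule first_integral_scalar[OF \<Omega> _ a])
    show "K p \<in> \<Omega>" by (simp add: K\<Omega> pS')
    fix A and w :: "real \<times> real \<Rightarrow> real"
    assume A: "open A" "K p \<in> A" "A \<subseteq> \<Omega>" and w: "smooth_on A w"
      and w0: "\<And>z. z \<in> A \<Longrightarrow> fderiv w z (1, a z) = 0" and w1: "\<And>z. z \<in> A \<Longrightarrow> fderiv w z (0, 1) > 0"
    define v where "v z = w (K z)" for z
    have dK: "(K has_derivative (\<lambda>h. (\<alpha> h, \<beta> h))) (at z)" for z
      unfolding K_def
      by (intro has_derivative_Pair bounded_linear.has_derivative[OF bl(1)] bounded_linear.has_derivative[OF bl(2)])
        (auto intro!: derivative_eq_intros)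
    have smK: "smooth_on T K" if "open T" for T
      unfolding K_def
      by (intro smooth_on_Pair that smooth_on_linear[OF bl(1) that] smooth_on_linear[OF bl(2) that]
          smooth_on_diff smooth_on_const smooth_on_id)
    define A' where "A' = K -` A"
    have A': "open A'"
      unfolding A'_def using smooth_on_continuous_on[OF smK[OF open_UNIV]] A(1) by (intro open_vimage) auto
    have A'S: "A' \<subseteq> S'" using A(3) K\<Omega> unfolding A'_def by blast
    have v: "smooth_on A' v"
      unfolding v_def by (rule smooth_on_compose[OF A' A(1) _ smK[OF A'] w]) (auto simp: A'_def)
    have dv: "fderiv v z h = fderiv w (K z) (\<alpha> h, \<beta> h)" if "z \<in> A'" for z h
    proof -
      have "K z \<in> A" using that by (simp add: A'_def)
      from has_derivative_compose[OF dK smooth_on_has_derivative[OF w this]]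
      show ?thesis by (simp add: v_def[abs_def] fderiv_at)
    qed
    \<comment> \<open>The scalar result controls the derivative of v in the constant direction Y p
      only. Along the varying field Y it is positive at p, hence also nearby.\<close>
    define A'' where "A'' = A' \<inter> (\<lambda>z. fderiv v z (Y z)) -` {0<..}"
    have Y': "smooth_on A' Y" by (rule smooth_on_subset[OF Y]) (use A'S S'_def in auto)
    have "open A''"
      unfolding A''_def
      by (rule continuous_open_preimage[OF smooth_on_continuous_on[OF smooth_on_fderiv_field[OF A' v Y']] A']) simp
    show thesis
    proof (rule that[of A'' v])
      show "open A''" by fact
      have "p \<in> A'" using A(2) by (simp add: A'_def)
      then show "p \<in> A''"
        using dv w1[OF A(2)] base by (simp add: A''_def)
      show "A'' \<subseteq> S" using A'S by (auto simp: A''_def S'_def)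
      show "smooth_on A'' v" by (rule smooth_on_subset[OF v]) (simp add: A''_def)
      fix z assume z: "z \<in> A''"
      then have z': "z \<in> A'" "K z \<in> A" by (auto simp: A''_def A'_def)
      then have pos: "\<alpha> (X z) > 0" using A'S Xpos by blast
      have "(\<alpha> (X z), \<beta> (X z)) = \<alpha> (X z) *\<^sub>R (1, a (K z))"
        using pos by (simp add: a_def LK)
      then show "fderiv v z (X z) = 0"
        using dv[OF z'(1), of "X z"] linear_cmul[OF smooth_on_linear_fderiv[OF w z'(2)]] w0[OF z'(2)]
        by (metis scaleR_zero_right)
      show "fderiv v z (Y z) > 0" using z by (simp add: A''_def)
    qed
  qed
qed

text \<open>The form \<open>\<omega>\<close> with \<open>\<omega>(X) = 1\<close> and \<open>\<omega>(Y) = 0\<close> is closed because the bracket of \<open>X\<close> and \<open>Y\<close> is a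
  multiple of \<open>Y\<close>.\<close>

lemma dual_form_primitive:
  fixes X Y :: "real^2 \<Rightarrow> real^2"
  assumes S: "open S" "convex S" "p \<in> S" and X: "smooth_on S X" and Y: "smooth_on S Y"
    and indep: "\<And>z. z \<in> S \<Longrightarrow> det2 (X z) (Y z) \<noteq> 0"
    and bracket: "\<And>z. z \<in> S \<Longrightarrow> fderiv Y z (X z) - fderiv X z (Y z) = - (B z *\<^sub>R Y z)"
  obtains u :: "real^2 \<Rightarrow> real" where "smooth_on S u"
    "\<And>z w. z \<in> S \<Longrightarrow> fderiv u z w = det2 w (Y z) / det2 (X z) (Y z)"
proof -
  define P where "P z = Y z $ 2 / det2 (X z) (Y z)" for z
  define Q where "Q z = - (Y z $ 1) / det2 (X z) (Y z)" for z
  define \<omega> where "\<omega> z w = w $ 1 * P z + w $ 2 * Q z" for z and w :: "real^2"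
  have \<omega>: "\<omega> z w = det2 w (Y z) / det2 (X z) (Y z)" for z w
    by (simp add: \<omega>_def P_def Q_def det2_def diff_divide_distrib)
  have P: "smooth_on S P" and Q: "smooth_on S Q"
    unfolding P_def Q_def using indep S X Y
    by (intro smooth_on_divide smooth_on_nth smooth_on_minus smooth_on_det2; simp)+
  have "\<omega> z (X z) = 1" "\<omega> z (Y z) = 0" if "z \<in> S" for z
    using indep[OF that] by (simp_all add: \<omega>)
  note dual = this
  have sm: "smooth_on S (\<lambda>z. \<omega> z w)" for w
    unfolding \<omega>_def by (intro smooth_on_add smooth_on_mult smooth_on_const P Q S)
  have D\<omega>: "((\<lambda>x. \<omega> x (Z x)) has_derivative (\<lambda>w. (Z z $ 1 * fderiv P z w + Z z $ 2 * fderiv Q z w) + \<omega> z (fderiv Z z w))) (at z)"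
    if z: "z \<in> S" and Z: "smooth_on S Z" for z Z
  proof -
    have dZ: "((\<lambda>x. Z x $ i) has_derivative (\<lambda>w. fderiv Z z w $ i)) (at z)" for i
      by (rule bounded_linear.has_derivative[OF bounded_linear_vec_nth smooth_on_has_derivative[OF Z z]])
    from has_derivative_add[OF has_derivative_mult[OF dZ[of 1] smooth_on_has_derivative[OF P z]]
        has_derivative_mult[OF dZ[of 2] smooth_on_has_derivative[OF Q z]]]
    show ?thesis
      unfolding \<omega>_def by (rule has_derivative_eq_rhs) (auto simp: algebra_simps)
  qed
  have D\<omega>_const: "fderiv (\<lambda>x. \<omega> x v) z w = v $ 1 * fderiv P z w + v $ 2 * fderiv Q z w" if "z \<in> S" for z v w
    using fderiv_at[OF D\<omega>[OF that smooth_on_const[of S v]]] by (simp add: \<omega>_def)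
  show thesis
  proof (rule closed_one_form_primitive[OF S, of \<omega>])
    show "smooth_on S (\<lambda>z. \<omega> z w)" for w by (rule sm)
    show "linear (\<omega> z)" for z
      by (auto simp: \<omega>_def linear_iff algebra_simps)
    fix z v w assume z: "z \<in> S"
    \<comment> \<open>The product rule for the constants \<omega>(X) = 1 and \<omega>(Y) = 0 trades
      derivatives of the coefficients P and Q for derivatives of X and Y.\<close>
    have const: "(Z z $ 1 * fderiv P z h + Z z $ 2 * fderiv Q z h) + \<omega> z (fderiv Z z h) = 0"
      if Z: "smooth_on S Z" and c: "\<And>x. x \<in> S \<Longrightarrow> \<omega> x (Z x) = c" for Z c h
    proof -
      have "fderiv (\<lambda>x. \<omega> x (Z x)) z = fderiv (\<lambda>x. c) z"
        by (rule fderiv_cong_open[OF S(1) z]) (rule c)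
      then show ?thesis
        using fderiv_at[OF D\<omega>[OF z Z]] by (simp add: fun_eq_iff)
    qed
    have "\<omega> z (fderiv Y z (X z)) - \<omega> z (fderiv X z (Y z)) = \<omega> z (fderiv Y z (X z) - fderiv X z (Y z))"
      by (simp add: \<omega>_def algebra_simps)
    also have "\<dots> = - B z * \<omega> z (Y z)"
      by (simp add: bracket[OF z] \<omega>_def algebra_simps)
    also have "\<dots> = 0" using dual z by simp
    finally have "(X z $ 1 * fderiv P z (Y z) + X z $ 2 * fderiv Q z (Y z)) =
        (Y z $ 1 * fderiv P z (X z) + Y z $ 2 * fderiv Q z (X z))"
      using const[OF X dual(1), of "Y z"] const[OF Y dual(2), of "X z"] by simp
    moreover have lin: "fderiv R z h = h $ 1 * fderiv R z (axis 1 1) + h $ 2 * fderiv R z (axis 2 1)"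
      if "smooth_on S R" for R :: "real^2 \<Rightarrow> real" and h
      using linear_Basis_expansion[OF smooth_on_linear_fderiv[OF that z], of h]
      by (simp add: Basis_vec_def sum_2 UNIV_2 axis_eq_axis inner_axis)
    \<comment> \<open>In the plane d\<omega> has one coefficient, and d\<omega>(X, Y) is, up to
      sign, this coefficient times the determinant of the frame.\<close>
    ultimately have "det2 (X z) (Y z) * (fderiv P z (axis 2 1) - fderiv Q z (axis 1 1)) = 0"
      unfolding lin[OF P, of "X z"] lin[OF P, of "Y z"] lin[OF Q, of "X z"] lin[OF Q, of "Y z"]
      by (simp add: det2_def algebra_simps)
    then have "fderiv P z (axis 2 1) = fderiv Q z (axis 1 1)"
      using indep[OF z] by simp
    then show "fderiv (\<lambda>x. \<omega> x v) z w = fderiv (\<lambda>x. \<omega> x w) z v"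
      unfolding D\<omega>_const[OF z] lin[OF P, of v] lin[OF P, of w] lin[OF Q, of v] lin[OF Q, of w]
      by (simp add: algebra_simps)
  next
    fix u assume u: "smooth_on S u" "\<And>z. z \<in> S \<Longrightarrow> (u has_derivative \<omega> z) (at z)"
    show thesis
      by (rule that[OF u(1)]) (simp add: fderiv_at[OF u(2)] \<omega>)
  qed
qed

text \<open>With du(X) = 1, du(Y) = 0 and dv(X) = 0 the differential of F = (u, v) is diagonal in
  the frame, with entries 1 and k = dv(Y) > 0. Its inverse is therefore explicit and smooth, and the
  local inverse applies.\<close>

lemma frame_coordinates:
  fixes X Y :: "real^2 \<Rightarrow> real^2"
  assumes S: "open S" "p \<in> S" and X: "smooth_on S X" and Y: "smooth_on S Y"
    and indep: "\<And>z. z \<in> S \<Longrightarrow> det2 (X z) (Y z) \<noteq> 0"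
    and bracket: "\<And>z. z \<in> S \<Longrightarrow> fderiv Y z (X z) - fderiv X z (Y z) = - (B z *\<^sub>R Y z)"
  obtains S' a b and F G :: "real^2 \<Rightarrow> real^2" and k :: "real^2 \<Rightarrow> real" where "open S'" "p \<in> S'" "S' \<subseteq> S" "smooth_on S' F" "F ` S' = box a b"
    "smooth_on (box a b) G" "\<And>x. x \<in> S' \<Longrightarrow> G (F x) = x"
    "\<And>x. x \<in> S' \<Longrightarrow> fderiv F x (X x) = axis 1 1" "\<And>x. x \<in> S' \<Longrightarrow> fderiv F x (Y x) = k x *\<^sub>R axis 2 1"
    "\<And>x. x \<in> S' \<Longrightarrow> k x > 0"
proof (rule first_integral[OF S X Y indep[OF S(2)]])
  fix A and v :: "real^2 \<Rightarrow> real"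
  assume A: "open A" "p \<in> A" "A \<subseteq> S" and v: "smooth_on A v"
    and vX: "\<And>z. z \<in> A \<Longrightarrow> fderiv v z (X z) = 0" and vY: "\<And>z. z \<in> A \<Longrightarrow> fderiv v z (Y z) > 0"
  obtain r where r: "r > 0" "ball p r \<subseteq> A" using A open_contains_ball by blast
  \<comment> \<open>A ball is convex, as needed for the primitive of the dual form.\<close>
  define C where "C = ball p r"
  have C: "open C" "convex C" "p \<in> C" and CS: "C \<subseteq> S" and CA: "C \<subseteq> A"
    using r A by (auto simp: C_def)
  note XC = smooth_on_subset[OF X CS] and YC = smooth_on_subset[OF Y CS] and vC = smooth_on_subset[OF v CA]
  show thesis
  proof (rule dual_form_primitive[OF C XC YC])
    show "det2 (X z) (Y z) \<noteq> 0" if "z \<in> C" for z using indep CS that by blast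
    show "fderiv Y z (X z) - fderiv X z (Y z) = - (B z *\<^sub>R Y z)" if "z \<in> C" for z
      using bracket CS that by blast
    fix u :: "real^2 \<Rightarrow> real"
    assume u: "smooth_on C u" and du: "\<And>z w. z \<in> C \<Longrightarrow> fderiv u z w = det2 w (Y z) / det2 (X z) (Y z)"
    define F where "F z = u z *\<^sub>R axis 1 1 + v z *\<^sub>R (axis 2 1 :: real^2)" for z
    define k where "k z = fderiv v z (Y z)" for z
    define R where "R z h = h $ 1 *\<^sub>R X z + (h $ 2 / k z) *\<^sub>R Y z" for z and h :: "real^2"
    have k: "k z > 0" if "z \<in> C" for z using vY CA that by (auto simp: k_def)
    have smk: "smooth_on C k"
      unfolding k_def by (rule smooth_on_fderiv_field[OF C(1) vC YC])
    have F: "smooth_on C F"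
      unfolding F_def by (intro smooth_on_add smooth_on_scaleR smooth_on_const C u vC)
    have smR: "smooth_on C (\<lambda>z. R z h)" for h
      unfolding R_def using k
      by (intro smooth_on_add smooth_on_scaleR smooth_on_divide smooth_on_const C XC YC smk) force
    have DF: "fderiv F z h = fderiv u z h *\<^sub>R axis 1 1 + fderiv v z h *\<^sub>R axis 2 1" if "z \<in> C" for z h
    proof -
      have "(F has_derivative (\<lambda>h. fderiv u z h *\<^sub>R axis 1 1 + fderiv v z h *\<^sub>R axis 2 1)) (at z)"
        unfolding F_def
        by (intro has_derivative_add has_derivative_scaleR_left smooth_on_has_derivative[OF u that]
            smooth_on_has_derivative[OF vC that])
      then show ?thesis by (simp add: fderiv_at)
    qed
    have duX: "fderiv u z (X z) = 1" "fderiv u z (Y z) = 0" if "z \<in> C" for z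
      using du[OF that] indep CS that by auto
    have lin: "fderiv w z (s *\<^sub>R X z + t *\<^sub>R Y z) = s * fderiv w z (X z) + t * fderiv w z (Y z)"
      if "smooth_on C w" "z \<in> C" for w :: "real^2 \<Rightarrow> real" and s t z
    proof -
      note l = smooth_on_linear_fderiv[OF that]
      show ?thesis by (simp only: linear_add[OF l] linear_cmul[OF l] real_scaleR_def)
    qed
    have inv2: "fderiv F z (R z h) = h" if z: "z \<in> C" for z h
      unfolding DF[OF z] R_def lin[OF u z] lin[OF vC z] duX[OF z]
      using vX[of z] k[OF z] CA z by (auto simp: vec_eq_iff forall_2 k_def axis_def)
    have inv1: "R z (fderiv F z h) = h" if z: "z \<in> C" for z h
    proof -
      have d: "det2 (X z) (Y z) \<noteq> 0" using indep CS z by blast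
      define s where "s = det2 h (Y z) / det2 (X z) (Y z)"
      define t where "t = det2 (X z) h / det2 (X z) (Y z)"
      have h: "h = s *\<^sub>R X z + t *\<^sub>R Y z"
        unfolding s_def t_def by (rule det2_Cramer[OF d])
      show ?thesis
        unfolding DF[OF z] R_def unfolding h lin[OF u z] lin[OF vC z] duX[OF z]
        using vX[of z] k[OF z] CA z by (auto simp: k_def axis_def)
    qed
    show thesis
    proof (rule smooth_local_inverse[OF C(1,3) F smR inv1 inv2])
      fix S' G assume S': "open S'" "p \<in> S'" "S' \<subseteq> C" "open (F ` S')" "smooth_on (F ` S') G"
        and G: "\<And>x. x \<in> S' \<Longrightarrow> G (F x) = x"
      have "F p \<in> F ` S'" using S'(2) by blast
      then obtain e where e: "e > 0" "ball (F p) e \<subseteq> F ` S'"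
        using S'(4) open_contains_ball by blast
      \<comment> \<open>Coordinate lines in a box are connected, so that later a function with
        vanishing u-derivative depends on v alone.\<close>
      then obtain a b where ab: "F p \<in> box a b" "box a b \<subseteq> F ` S'"
        using rational_boxes[OF e(1), of "F p"] by blast
      define S'' where "S'' = S' \<inter> F -` box a b"
      show thesis
      proof (rule that[of S'' F a b G k])
        show "open S''"
          unfolding S''_def
          by (rule continuous_open_preimage[OF smooth_on_continuous_on S'(1)])
            (use smooth_on_subset[OF F S'(3)] in auto)
        show "p \<in> S''" using ab S' by (simp add: S''_def)
        show "S'' \<subseteq> S" using S'(3) CS by (auto simp: S''_def)
        show "smooth_on S'' F" by (rule smooth_on_subset[OF F]) (use S'(3) in \<open>auto simp: S''_def\<close>)
        show "F ` S'' = box a b" using ab(2) by (auto simp: S''_def)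
        show "smooth_on (box a b) G" by (rule smooth_on_subset[OF S'(5) ab(2)])
        fix x assume "x \<in> S''"
        then have x: "x \<in> S'" "x \<in> C" using S'(3) by (auto simp: S''_def)
        show "G (F x) = x" by (rule G[OF x(1)])
        show "fderiv F x (X x) = axis 1 1" "fderiv F x (Y x) = k x *\<^sub>R axis 2 1"
          unfolding DF[OF x(2)] duX[OF x(2)] using vX CA x(2) by (auto simp: k_def)
        show "k x > 0" by (rule k[OF x(2)])
      qed
    qed
  qed
qed

section \<open>Charts and tangent vectors\<close>

locale smooth_mfd =
  fixes M :: "('a, 'n::finite) manifold"
  assumes smooth_manifold: "smooth_manifold M"
begin

lemma is_chart: "c \<in> charts M \<Longrightarrow> is_chart (mtop M) c"
  using smooth_manifold by (simp add: smooth_manifold_def)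

lemma chart_open: "c \<in> charts M \<Longrightarrow> opens M (fst c)"
  using is_chart by (simp add: is_chart_def)

lemma chart_subset_points: "c \<in> charts M \<Longrightarrow> fst c \<subseteq> points M"
  by (rule openin_subset[OF chart_open])

lemma chart_at: "p \<in> points M \<Longrightarrow> chart_at M p \<in> charts M \<and> p \<in> fst (chart_at M p)"
proof -
  assume "p \<in> points M"
  then have "p \<in> (\<Union>c\<in>charts M. fst c)"
    using smooth_manifold by (simp add: smooth_manifold_def)
  then have "\<exists>c. c \<in> charts M \<and> p \<in> fst c" by blast
  then show ?thesis unfolding chart_at_def by (rule someI_ex)
qed

lemma chart_homeomorphic:
  "c \<in> charts M \<Longrightarrow> homeomorphic_map (subtopology (mtop M) (fst c)) (top_of_set (snd c ` fst c)) (snd c)"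
  using is_chart by (simp add: is_chart_def)

lemma chart_topspace: "c \<in> charts M \<Longrightarrow> topspace (subtopology (mtop M) (fst c)) = fst c"
  using chart_subset_points by (simp add: inf.absorb2)

lemma chart_inj: "c \<in> charts M \<Longrightarrow> inj_on (snd c) (fst c)"
  using homeomorphic_imp_injective_map[OF chart_homeomorphic] chart_topspace by simp

lemma chart_inv_left: "c \<in> charts M \<Longrightarrow> p \<in> fst c \<Longrightarrow> chart_inv c (snd c p) = p"
  unfolding chart_inv_def using chart_inj by (rule inv_into_f_f)

lemma chart_image_open:
  assumes c: "c \<in> charts M" and W: "opens M W"
  shows "open (snd c ` (fst c \<inter> W))"
proof -
  have "openin (subtopology (mtop M) (fst c)) (fst c \<inter> W)"
    using W by (simp add: openin_subtopology_Int2)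
  then have "openin (top_of_set (snd c ` fst c)) (snd c ` (fst c \<inter> W))"
    using chart_homeomorphic[OF c] homeomorphic_imp_open_map open_map_def by blast
  moreover have "open (snd c ` fst c)"
    using is_chart[OF c] by (simp add: is_chart_def)
  ultimately show ?thesis by (rule openin_open_trans)
qed

lemma chart_image_open': "c \<in> charts M \<Longrightarrow> opens M W \<Longrightarrow> W \<subseteq> fst c \<Longrightarrow> open (snd c ` W)"
  using chart_image_open[of c W] by (simp add: inf.absorb2)

lemma chart_overlap_open:
  "c \<in> charts M \<Longrightarrow> d \<in> charts M \<Longrightarrow> open (snd c ` (fst c \<inter> fst d))"
  by (rule chart_image_open[OF _ chart_open])

lemma chart_preimage_open:
  assumes c: "c \<in> charts M" and A: "open A"
  shows "opens M {p \<in> fst c. snd c p \<in> A}"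
proof -
  have "continuous_map (subtopology (mtop M) (fst c)) (top_of_set (snd c ` fst c)) (snd c)"
    using chart_homeomorphic[OF c] by (rule homeomorphic_imp_continuous_map)
  moreover have "openin (top_of_set (snd c ` fst c)) (snd c ` fst c \<inter> A)"
    using A by (rule openin_open_Int)
  ultimately have "openin (subtopology (mtop M) (fst c)) {p \<in> fst c. snd c p \<in> snd c ` fst c \<inter> A}"
    using openin_continuous_map_preimage by (subst (2) chart_topspace[OF c, symmetric])
  then have "openin (subtopology (mtop M) (fst c)) {p \<in> fst c. snd c p \<in> A}"
    by (simp cong: conj_cong)
  then show ?thesis
    using chart_open[OF c] by (rule openin_trans_full)
qed

lemma transition_smooth:
  "c \<in> charts M \<Longrightarrow> d \<in> charts M \<Longrightarrow> smooth_on (snd c ` (fst c \<inter> fst d)) (snd d \<circ> chart_inv c)"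
  using smooth_manifold by (simp add: smooth_manifold_def smooth_transition_def)

lemma transition_differentiable:
  assumes "c \<in> charts M" "d \<in> charts M" "p \<in> fst c" "p \<in> fst d"
  shows "((snd d \<circ> chart_inv c) has_derivative fderiv (snd d \<circ> chart_inv c) (snd c p)) (at (snd c p))"
  by (rule smooth_on_has_derivative[OF transition_smooth[OF assms(1,2)]]) (use assms in blast)

text \<open>Near the image of p the expression of h in d factors through the transition to c, so the
  chain rule applies. Independence of the chart for derivatives and differentiability rests on
  this.\<close>

lemma change_of_chart:
  assumes c: "c \<in> charts M" "p \<in> fst c" and d: "d \<in> charts M" "p \<in> fst d"
    and h: "(h \<circ> chart_inv c) differentiable at (snd c p)"
  shows "((h \<circ> chart_inv d) has_derivative
    (\<lambda>w. fderiv (h \<circ> chart_inv c) (snd c p) (fderiv (snd c \<circ> chart_inv d) (snd d p) w))) (at (snd d p))"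
proof -
  have *: "(snd c \<circ> chart_inv d) (snd d p) = snd c p"
    using chart_inv_left d by simp
  have "(h \<circ> chart_inv c has_derivative fderiv (h \<circ> chart_inv c) (snd c p)) (at ((snd c \<circ> chart_inv d) (snd d p)))"
    unfolding * using h by (rule fderiv_works)
  then have "((\<lambda>z. (h \<circ> chart_inv c) ((snd c \<circ> chart_inv d) z)) has_derivative
    (\<lambda>w. fderiv (h \<circ> chart_inv c) (snd c p) (fderiv (snd c \<circ> chart_inv d) (snd d p) w))) (at (snd d p))"
    by (rule has_derivative_compose[OF transition_differentiable[OF d(1) c(1) d(2) c(2)]])
  then show ?thesis
  proof (rule has_derivative_transform_within_open)
    show "open (snd d ` (fst d \<inter> fst c))" by (rule chart_overlap_open[OF d(1) c(1)])
    show "snd d p \<in> snd d ` (fst d \<inter> fst c)" using c d by blast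
    fix z assume "z \<in> snd d ` (fst d \<inter> fst c)"
    then obtain q where "q \<in> fst d" "q \<in> fst c" "z = snd d q" by blast
    then show "(h \<circ> chart_inv c) ((snd c \<circ> chart_inv d) z) = (h \<circ> chart_inv d) z"
      using chart_inv_left c d by simp
  qed
qed

lemma transition_self:
  assumes "c \<in> charts M" "p \<in> fst c"
  shows "fderiv (snd c \<circ> chart_inv c) (snd c p) w = w"
proof -
  have "fderiv (snd c \<circ> chart_inv c) (snd c p) = fderiv (\<lambda>z. z) (snd c p)"
  proof (rule fderiv_cong_open)
    show "open (snd c ` fst c)" "snd c p \<in> snd c ` fst c"
      using chart_overlap_open[OF assms(1,1)] assms by auto
    fix z assume "z \<in> snd c ` fst c"
    then show "(snd c \<circ> chart_inv c) z = z"
      using chart_inv_left[OF assms(1)] by auto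
  qed
  then show ?thesis by simp
qed

lemma transition_compose:
  assumes "c \<in> charts M" "p \<in> fst c" "d \<in> charts M" "p \<in> fst d" "e \<in> charts M" "p \<in> fst e"
  shows "fderiv (snd e \<circ> chart_inv d) (snd d p) (fderiv (snd d \<circ> chart_inv c) (snd c p) w) =
    fderiv (snd e \<circ> chart_inv c) (snd c p) w"
  using fderiv_at[OF change_of_chart[OF assms(3,4) assms(1,2)
      differentiableI[OF transition_differentiable[OF assms(3,5,4,6)]]]]
  by simp

lemma transition_linear:
  assumes "c \<in> charts M" "p \<in> fst c" "d \<in> charts M" "p \<in> fst d"
  shows "linear (fderiv (snd d \<circ> chart_inv c) (snd c p))"
  by (rule has_derivative_linear[OF transition_differentiable[OF assms(1,3,2,4)]])

section \<open>Tangent vectors as compatible families of components\<close>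

lemma tangent_transform:
  assumes "x \<in> tangent_space M p" "c \<in> charts M" "p \<in> fst c" "d \<in> charts M" "p \<in> fst d"
  shows "x d = fderiv (snd d \<circ> chart_inv c) (snd c p) (x c)"
proof -
  have "\<forall>c\<in>charts M. \<forall>d\<in>charts M. p \<in> fst c \<inter> fst d \<longrightarrow>
      x d = fderiv (snd d \<circ> chart_inv c) (snd c p) (x c)"
    using assms(1) unfolding tangent_space_def mem_Collect_eq by (rule conjunct1)
  from this[rule_format, OF assms(2,4)] assms(3,5) show ?thesis by blast
qed

lemma tangent_outside: "x \<in> tangent_space M p \<Longrightarrow> \<not> (c \<in> charts M \<and> p \<in> fst c) \<Longrightarrow> x c = 0"
  unfolding tangent_space_def mem_Collect_eq by (drule conjunct2, drule spec[of _ c], drule mp)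

text \<open>The components in the remaining charts around p follow from the transformation rule, and
  at all other arguments both families are zero by convention. Identities between tangent vectors
  are mostly verified in this way, in a single chart.\<close>

lemma tangent_eqI:
  assumes "x \<in> tangent_space M p" "y \<in> tangent_space M p" "c \<in> charts M" "p \<in> fst c" "x c = y c"
  shows "x = y"
proof
  fix d
  show "x d = y d"
  proof (cases "d \<in> charts M \<and> p \<in> fst d")
    case True
    then show ?thesis
      using tangent_transform[OF assms(1,3,4)] tangent_transform[OF assms(2,3,4)] assms(5) by simp
  next
    case False
    then show ?thesis using tangent_outside[OF assms(1) False] tangent_outside[OF assms(2) False] by simp
  qed
qed

lemma vec_in_chart_tangent:
  assumes "c \<in> charts M" "p \<in> fst c"
  shows "vec_in_chart M c p w \<in> tangent_space M p"
  unfolding tangent_space_def mem_Collect_eq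
proof (intro conjI ballI impI allI)
  fix d e assume "d \<in> charts M" "e \<in> charts M" "p \<in> fst d \<inter> fst e"
  then show "vec_in_chart M c p w e = fderiv (snd e \<circ> chart_inv d) (snd d p) (vec_in_chart M c p w d)"
    using transition_compose[OF assms, of d e w] by (simp add: vec_in_chart_def)
next
  fix d assume "\<not> (d \<in> charts M \<and> p \<in> fst d)"
  then show "vec_in_chart M c p w d = 0" unfolding vec_in_chart_def by (rule if_not_P)
qed

lemma vec_in_chart_self:
  "c \<in> charts M \<Longrightarrow> p \<in> fst c \<Longrightarrow> vec_in_chart M c p w c = w"
  by (simp add: vec_in_chart_def transition_self)

lemma vec_in_chart_component:
  assumes "x \<in> tangent_space M p" "c \<in> charts M" "p \<in> fst c"
  shows "vec_in_chart M c p (x c) = x"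
  by (rule tangent_eqI[OF vec_in_chart_tangent[OF assms(2,3)] assms]) (rule vec_in_chart_self[OF assms(2,3)])

lemma tangent_add:
  assumes p: "p \<in> points M" and xy: "x \<in> tangent_space M p" "y \<in> tangent_space M p"
  shows "x + y \<in> tangent_space M p"
  unfolding tangent_space_def mem_Collect_eq
proof (intro conjI ballI impI allI)
  fix c d assume "c \<in> charts M" "d \<in> charts M" "p \<in> fst c \<inter> fst d"
  then show "(x + y) d = fderiv (snd d \<circ> chart_inv c) (snd c p) ((x + y) c)"
    using tangent_transform[OF xy(1), of c d] tangent_transform[OF xy(2), of c d]
      linear_add[OF transition_linear[of c p d]] by simp
next
  fix c assume c: "\<not> (c \<in> charts M \<and> p \<in> fst c)"
  show "(x + y) c = 0" using tangent_outside[OF xy(1) c] tangent_outside[OF xy(2) c] by simp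
qed

lemma tangent_scale:
  assumes p: "p \<in> points M" and x: "x \<in> tangent_space M p"
  shows "a *\<^sub>R x \<in> tangent_space M p"
  unfolding tangent_space_def mem_Collect_eq
proof (intro conjI ballI impI allI)
  fix c d assume "c \<in> charts M" "d \<in> charts M" "p \<in> fst c \<inter> fst d"
  then show "(a *\<^sub>R x) d = fderiv (snd d \<circ> chart_inv c) (snd c p) ((a *\<^sub>R x) c)"
    using tangent_transform[OF x, of c d] linear_cmul[OF transition_linear[of c p d]]
    by (simp add: scaleR_fun_def)
next
  fix c assume c: "\<not> (c \<in> charts M \<and> p \<in> fst c)"
  show "(a *\<^sub>R x) c = 0" using tangent_outside[OF x c] by (simp add: scaleR_fun_def)
qed

lemma tangent_zero: "p \<in> points M \<Longrightarrow> 0 \<in> tangent_space M p"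
  unfolding tangent_space_def mem_Collect_eq
  using linear_0[OF transition_linear] by (auto simp del: split_paired_All)

lemma tangent_sum:
  assumes p: "p \<in> points M" and v: "\<And>i. i \<in> I \<Longrightarrow> v i \<in> tangent_space M p"
  shows "(\<Sum>i\<in>I. v i) \<in> tangent_space M p"
proof (cases "finite I")
  case True
  then show ?thesis
    using v
  proof (induction I rule: finite_induct)
    case empty
    show ?case unfolding sum.empty by (rule tangent_zero[OF p])
  next
    case (insert i I)
    show ?case
      unfolding sum.insert[OF insert(1,2)]
      by (rule tangent_add[OF p insert.prems insert.IH]) (use insert.prems in auto)
  qed
next
  case False
  then show ?thesis using tangent_zero[OF p] by (simp only: sum.infinite not_False_eq_True)
qed

lemma tangent_diff:
  assumes "p \<in> points M" "x \<in> tangent_space M p" "y \<in> tangent_space M p"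
  shows "x - y \<in> tangent_space M p"
  using tangent_add[OF assms(1,2) tangent_scale[OF assms(1,3), of "-1"]] by simp

lemma coord_field_tangent: "c \<in> charts M \<Longrightarrow> p \<in> fst c \<Longrightarrow> coord_field M c k p \<in> tangent_space M p"
  unfolding coord_field_def by (rule vec_in_chart_tangent)

lemma coord_field_self: "c \<in> charts M \<Longrightarrow> p \<in> fst c \<Longrightarrow> coord_field M c k p c = axis k 1"
  unfolding coord_field_def by (rule vec_in_chart_self)

lemma tangent_coord_expansion:
  assumes "x \<in> tangent_space M p" "c \<in> charts M" "p \<in> fst c"
  shows "x = (\<Sum>k\<in>UNIV. (x c $ k) *\<^sub>R coord_field M c k p)"
proof (rule tangent_eqI[OF assms(1) _ assms(2,3)])
  have p: "p \<in> points M" using chart_subset_points assms by blast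
  show "(\<Sum>k\<in>UNIV. (x c $ k) *\<^sub>R coord_field M c k p) \<in> tangent_space M p"
    by (intro tangent_sum[OF p] tangent_scale[OF p] coord_field_tangent assms(2,3))
  have "(\<Sum>k\<in>I. (x c $ k) *\<^sub>R coord_field M c k p) c = (\<Sum>k\<in>I. (x c $ k) *\<^sub>R axis k 1)" if "finite I" for I
    using that by (induction I rule: finite_induct) (auto simp: scaleR_fun_def coord_field_self assms)
  then have "(\<Sum>k\<in>UNIV. (x c $ k) *\<^sub>R coord_field M c k p) c = (\<Sum>k\<in>UNIV. (x c $ k) *\<^sub>R axis k 1)" by simp
  also have "\<dots> = x c"
    by (simp add: vec_eq_iff axis_def if_distrib cong: if_cong)
  finally show "x c = (\<Sum>k\<in>UNIV. (x c $ k) *\<^sub>R coord_field M c k p) c" by simp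
qed

text \<open>Differentiability in the very chart that \<open>tderiv\<close> selects, so that the
  calculus rules for \<open>tderiv\<close> are proved without changing charts;
  \<open>mdiff_chart\<close> restores the independence of the choice.\<close>

definition mdiff :: "'a \<Rightarrow> ('a \<Rightarrow> 'b::real_normed_vector) \<Rightarrow> bool" where
  "mdiff p h \<longleftrightarrow> (h \<circ> chart_inv (chart_at M p)) differentiable at (snd (chart_at M p) p)"

lemma mdiff_chart:
  assumes "c \<in> charts M" "p \<in> fst c"
  shows "mdiff p h \<longleftrightarrow> (h \<circ> chart_inv c) differentiable at (snd c p)"
proof -
  have "chart_at M p \<in> charts M" "p \<in> fst (chart_at M p)"
    using chart_at chart_subset_points assms by blast+
  then show ?thesis
    unfolding mdiff_def
    using differentiableI[OF change_of_chart[of "chart_at M p" p c h]]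
      differentiableI[OF change_of_chart[of c p "chart_at M p" h]] assms by blast
qed

lemma tderiv_chart:
  assumes c: "c \<in> charts M" "p \<in> fst c" and x: "x \<in> tangent_space M p"
    and h: "(h \<circ> chart_inv c) differentiable at (snd c p)"
  shows "tderiv M p x h = fderiv (h \<circ> chart_inv c) (snd c p) (x c)"
proof -
  have a: "chart_at M p \<in> charts M" "p \<in> fst (chart_at M p)"
    using chart_at chart_subset_points c by blast+
  show ?thesis
    unfolding tderiv_def Let_def fderiv_at[OF change_of_chart[OF c a h]]
    using tangent_transform[OF x a c] by simp
qed

lemma mdiff_has_derivative:
  "mdiff p h \<Longrightarrow> ((h \<circ> chart_inv (chart_at M p)) has_derivative
    fderiv (h \<circ> chart_inv (chart_at M p)) (snd (chart_at M p) p)) (at (snd (chart_at M p) p))"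
  unfolding mdiff_def by (rule fderiv_works)

lemma tderiv_eq:
  assumes "((h \<circ> chart_inv (chart_at M p)) has_derivative D) (at (snd (chart_at M p) p))"
  shows "tderiv M p x h = D (x (chart_at M p))"
  using fderiv_at[OF assms] by (simp add: tderiv_def Let_def)

lemma point_of_chart_at: "p \<in> points M \<Longrightarrow> chart_inv (chart_at M p) (snd (chart_at M p) p) = p"
  using chart_inv_left[of "chart_at M p" p] chart_at[of p] by simp

lemma
  assumes W: "opens M W" "p \<in> W" and eq: "\<And>q. q \<in> W \<Longrightarrow> h q = k q"
  shows tderiv_cong: "tderiv M p x h = tderiv M p x k" and mdiff_cong: "mdiff p h \<longleftrightarrow> mdiff p k"
proof -
  let ?c = "chart_at M p"
  have c: "?c \<in> charts M" "p \<in> fst ?c"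
    using chart_at[of p] openin_subset[OF W(1)] W(2) by auto
  have *: "open (snd ?c ` (fst ?c \<inter> W))" "snd ?c p \<in> snd ?c ` (fst ?c \<inter> W)"
    using chart_image_open[OF c(1) W(1)] c W by auto
  have **: "(h \<circ> chart_inv ?c) z = (k \<circ> chart_inv ?c) z" if "z \<in> snd ?c ` (fst ?c \<inter> W)" for z
    using that eq chart_inv_left[OF c(1)] by auto
  show "tderiv M p x h = tderiv M p x k"
    unfolding tderiv_def Let_def by (simp only: fderiv_cong_open[OF * **])
  show "mdiff p h \<longleftrightarrow> mdiff p k"
    unfolding mdiff_def by (rule differentiable_cong_open[OF * **])
qed

lemma tderiv_const: "tderiv M p x (\<lambda>q. c) = 0" and mdiff_const: "mdiff p (\<lambda>q. c)"
  by (simp_all add: tderiv_def Let_def o_def mdiff_def)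

lemma
  assumes "bounded_bilinear B" "p \<in> points M" "mdiff p h" "mdiff p k"
  shows tderiv_bilinear: "tderiv M p x (\<lambda>q. B (h q) (k q)) = B (h p) (tderiv M p x k) + B (tderiv M p x h) (k p)"
    and mdiff_bilinear: "mdiff p (\<lambda>q. B (h q) (k q))"
proof -
  note D = bounded_bilinear.FDERIV[OF assms(1) mdiff_has_derivative[OF assms(3)] mdiff_has_derivative[OF assms(4)]]
  have eq: "(\<lambda>q. B (h q) (k q)) \<circ> chart_inv (chart_at M p) =
      (\<lambda>z. B ((h \<circ> chart_inv (chart_at M p)) z) ((k \<circ> chart_inv (chart_at M p)) z))"
    by (simp add: o_def)
  show "tderiv M p x (\<lambda>q. B (h q) (k q)) = B (h p) (tderiv M p x k) + B (tderiv M p x h) (k p)"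
    using tderiv_eq[of "\<lambda>q. B (h q) (k q)" p, unfolded eq, OF D] point_of_chart_at[OF assms(2)]
    by (simp add: tderiv_def Let_def)
  show "mdiff p (\<lambda>q. B (h q) (k q))"
    unfolding mdiff_def eq by (rule differentiableI[OF D])
qed

lemmas tderiv_mult = tderiv_bilinear[OF bounded_bilinear_mult]
  and mdiff_mult = mdiff_bilinear[OF bounded_bilinear_mult]

lemma
  assumes "mdiff p h" "mdiff p k"
  shows tderiv_add: "tderiv M p x (\<lambda>q. h q + k q) = tderiv M p x h + tderiv M p x k"
    and mdiff_add: "mdiff p (\<lambda>q. h q + k q)"
proof -
  note D = has_derivative_add[OF mdiff_has_derivative[OF assms(1)] mdiff_has_derivative[OF assms(2)]]
  have eq: "(\<lambda>q. h q + k q) \<circ> chart_inv (chart_at M p) =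
      (\<lambda>z. (h \<circ> chart_inv (chart_at M p)) z + (k \<circ> chart_inv (chart_at M p)) z)"
    by (simp add: o_def)
  show "tderiv M p x (\<lambda>q. h q + k q) = tderiv M p x h + tderiv M p x k"
    using tderiv_eq[of "\<lambda>q. h q + k q" p, unfolded eq, OF D] by (simp add: tderiv_def Let_def)
  show "mdiff p (\<lambda>q. h q + k q)"
    unfolding mdiff_def eq by (rule differentiableI[OF D])
qed

lemma
  assumes "finite I" "\<And>i. i \<in> I \<Longrightarrow> mdiff p (h i)"
  shows tderiv_sum: "tderiv M p x (\<lambda>q. \<Sum>i\<in>I. h i q) = (\<Sum>i\<in>I. tderiv M p x (h i))" (is ?A)
    and mdiff_sum: "mdiff p (\<lambda>q. \<Sum>i\<in>I. h i q)" (is ?B)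
proof -
  have "?A \<and> ?B"
    using assms by (induction I rule: finite_induct) (auto simp: tderiv_const mdiff_const tderiv_add mdiff_add)
  then show ?A ?B by auto
qed

lemma
  assumes "bounded_linear L" "mdiff p h"
  shows tderiv_linear: "tderiv M p x (\<lambda>q. L (h q)) = L (tderiv M p x h)"
    and mdiff_linear: "mdiff p (\<lambda>q. L (h q))"
proof -
  note D = bounded_linear.has_derivative[OF assms(1) mdiff_has_derivative[OF assms(2)]]
  have eq: "(\<lambda>q. L (h q)) \<circ> chart_inv (chart_at M p) = (\<lambda>z. L ((h \<circ> chart_inv (chart_at M p)) z))"
    by (simp add: o_def)
  show "tderiv M p x (\<lambda>q. L (h q)) = L (tderiv M p x h)"
    using tderiv_eq[of "\<lambda>q. L (h q)" p, unfolded eq, OF D] by (simp add: tderiv_def Let_def)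
  show "mdiff p (\<lambda>q. L (h q))"
    unfolding mdiff_def eq by (rule differentiableI[OF D])
qed

lemma tderiv_real_compose:
  fixes h :: "'a \<Rightarrow> real" and f :: "real \<Rightarrow> real"
  assumes "p \<in> points M" "mdiff p h" "(f has_real_derivative f') (at (h p))"
  shows "tderiv M p x (\<lambda>q. f (h q)) = f' * tderiv M p x h"
proof -
  have "(f has_derivative (*) f') (at ((h \<circ> chart_inv (chart_at M p)) (snd (chart_at M p) p)))"
    using assms(3) point_of_chart_at[OF assms(1)] by (simp add: has_field_derivative_def)
  note D = has_derivative_compose[OF mdiff_has_derivative[OF assms(2)] this]
  have eq: "(\<lambda>q. f (h q)) \<circ> chart_inv (chart_at M p) = (\<lambda>z. f ((h \<circ> chart_inv (chart_at M p)) z))"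
    by (simp add: o_def)
  show ?thesis
    using tderiv_eq[of "\<lambda>q. f (h q)" p, unfolded eq, OF D] by (simp add: tderiv_def Let_def)
qed

lemma tderiv_vector_linear:
  assumes "mdiff p h"
  shows "linear (\<lambda>x. tderiv M p x h)"
  using has_derivative_linear[OF mdiff_has_derivative[OF assms]]
  by (simp add: tderiv_def Let_def linear_iff scaleR_fun_def)

section \<open>Smooth functions and vector fields in charts\<close>

lemma smooth_fun_chart:
  assumes "smooth_fun M W h" "c \<in> charts M"
  shows "smooth_on (snd c ` (fst c \<inter> W)) (h \<circ> chart_inv c)"
  using assms by (simp add: smooth_fun_def)

lemma smooth_fun_mdiff:
  assumes "smooth_fun M W h" "opens M W" "p \<in> W"
  shows "mdiff p h"
proof -
  have c: "chart_at M p \<in> charts M" "p \<in> fst (chart_at M p)"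
    using chart_at[of p] openin_subset[OF assms(2)] assms(3) by auto
  show ?thesis
    unfolding mdiff_def
    by (rule smooth_on_differentiable[OF smooth_fun_chart[OF assms(1) c(1)]]) (use c assms in blast)
qed

lemma smooth_fun_subset:
  assumes "smooth_fun M W h" "W' \<subseteq> W"
  shows "smooth_fun M W' h"
  unfolding smooth_fun_def
proof
  fix c assume "c \<in> charts M"
  from smooth_fun_chart[OF assms(1) this] show "smooth_on (snd c ` (fst c \<inter> W')) (h \<circ> chart_inv c)"
    by (rule smooth_on_subset) (use assms(2) in blast)
qed

text \<open>In any other chart the expression of h is the one in \<open>c\<close> composed with a
  smooth transition.\<close>

lemma smooth_funI:
  assumes c: "c \<in> charts M" and W: "opens M W" "W \<subseteq> fst c" and h: "smooth_on (snd c ` W) (h \<circ> chart_inv c)"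
  shows "smooth_fun M W h"
  unfolding smooth_fun_def
proof
  fix d assume d: "d \<in> charts M"
  have o: "open (snd d ` (fst d \<inter> W))" by (rule chart_image_open[OF d W(1)])
  have "smooth_on (snd d ` (fst d \<inter> W)) (snd c \<circ> chart_inv d)"
    by (rule smooth_on_subset[OF transition_smooth[OF d c]]) (use W in auto)
  then have sm: "smooth_on (snd d ` (fst d \<inter> W)) (\<lambda>z. (h \<circ> chart_inv c) ((snd c \<circ> chart_inv d) z))"
  proof (rule smooth_on_compose[OF o chart_image_open'[OF c W] _ _ h, rotated])
    show "(snd c \<circ> chart_inv d) ` snd d ` (fst d \<inter> W) \<subseteq> snd c ` W"
      using chart_inv_left[OF d] by auto
  qed
  have eq: "(h \<circ> chart_inv c) ((snd c \<circ> chart_inv d) z) = (h \<circ> chart_inv d) z"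
    if "z \<in> snd d ` (fst d \<inter> W)" for z
    using that W chart_inv_left[OF d] chart_inv_left[OF c] by auto
  show "smooth_on (snd d ` (fst d \<inter> W)) (h \<circ> chart_inv d)"
    by (rule smooth_on_transform[OF sm o eq])
qed

lemma smooth_fun_scaleR:
  fixes h :: "'a \<Rightarrow> real"
  assumes "opens M W" "smooth_fun M W h" "smooth_fun M W k"
  shows "smooth_fun M W (\<lambda>q. h q *\<^sub>R k q)"
  unfolding smooth_fun_def
proof
  fix c assume c: "c \<in> charts M"
  from smooth_on_scaleR[OF chart_image_open[OF c assms(1)] smooth_fun_chart[OF assms(2) c] smooth_fun_chart[OF assms(3) c]]
  show "smooth_on (snd c ` (fst c \<inter> W)) ((\<lambda>q. h q *\<^sub>R k q) \<circ> chart_inv c)"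
    by (simp add: o_def)
qed

lemma smooth_fun_add:
  assumes "opens M W" "smooth_fun M W h" "smooth_fun M W k"
  shows "smooth_fun M W (\<lambda>q. h q + k q)"
  unfolding smooth_fun_def
proof
  fix c assume c: "c \<in> charts M"
  from smooth_on_add[OF chart_image_open[OF c assms(1)] smooth_fun_chart[OF assms(2) c] smooth_fun_chart[OF assms(3) c]]
  show "smooth_on (snd c ` (fst c \<inter> W)) ((\<lambda>q. h q + k q) \<circ> chart_inv c)"
    by (simp add: o_def)
qed

lemma smooth_vfield_tangent: "smooth_vfield M W X \<Longrightarrow> p \<in> W \<Longrightarrow> X p \<in> tangent_space M p"
  by (simp add: smooth_vfield_def)

lemma smooth_vfield_component:
  "smooth_vfield M W X \<Longrightarrow> c \<in> charts M \<Longrightarrow> smooth_fun M (fst c \<inter> W) (\<lambda>p. X p c)"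
  by (simp add: smooth_vfield_def)

lemma smooth_vfield_chart:
  assumes "smooth_vfield M W X" "c \<in> charts M"
  shows "smooth_on (snd c ` (fst c \<inter> W)) (\<lambda>z. X (chart_inv c z) c)"
  using smooth_fun_chart[OF smooth_vfield_component[OF assms] assms(2)] by (simp add: o_def inf.left_idem)

lemma smooth_vfield_subset: "smooth_vfield M W X \<Longrightarrow> W' \<subseteq> W \<Longrightarrow> smooth_vfield M W' X"
  unfolding smooth_vfield_def
proof (intro conjI ballI)
  fix c assume *: "(\<forall>p\<in>W. X p \<in> tangent_space M p) \<and> (\<forall>c\<in>charts M. smooth_fun M (fst c \<inter> W) (\<lambda>p. X p c))"
    "W' \<subseteq> W" "c \<in> charts M"
  show "smooth_fun M (fst c \<inter> W') (\<lambda>p. X p c)"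
    by (rule smooth_fun_subset[of "fst c \<inter> W"]) (use * in auto)
qed auto

text \<open>In another chart the components are the derivative of the transition along the
  components in \<open>c\<close>, that is, a smooth map differentiated along a smooth field.\<close>

lemma smooth_vfieldI:
  assumes c: "c \<in> charts M" and W: "opens M W" "W \<subseteq> fst c" and t: "\<And>p. p \<in> W \<Longrightarrow> X p \<in> tangent_space M p"
    and s: "smooth_on (snd c ` W) (\<lambda>z. X (chart_inv c z) c)"
  shows "smooth_vfield M W X"
  unfolding smooth_vfield_def
proof (intro conjI ballI)
  fix d assume d: "d \<in> charts M"
  have dW: "opens M (fst d \<inter> W)" using chart_open[OF d] W by blast
  show "smooth_fun M (fst d \<inter> W) (\<lambda>p. X p d)"
  proof (rule smooth_funI[OF c dW])
    show "fst d \<inter> W \<subseteq> fst c" using W by blast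
    have o: "open (snd c ` (fst d \<inter> W))" by (rule chart_image_open'[OF c dW]) (use W in blast)
    have sm: "smooth_on (snd c ` (fst d \<inter> W)) (\<lambda>z. fderiv (snd d \<circ> chart_inv c) z (X (chart_inv c z) c))"
      by (rule smooth_on_fderiv_field[OF o smooth_on_subset[OF transition_smooth[OF c d]] smooth_on_subset[OF s]])
        (use W in auto)
    have eq: "fderiv (snd d \<circ> chart_inv c) z (X (chart_inv c z) c) = ((\<lambda>p. X p d) \<circ> chart_inv c) z"
      if z: "z \<in> snd c ` (fst d \<inter> W)" for z
    proof -
      obtain q where q: "q \<in> fst d" "q \<in> W" "z = snd c q" using z by blast
      then have "q \<in> fst c" using W by blast
      then show ?thesis
        using tangent_transform[OF t[OF q(2)] c _ d q(1)] q(3) chart_inv_left[OF c] by simp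
    qed
    show "smooth_on (snd c ` (fst d \<inter> W)) ((\<lambda>p. X p d) \<circ> chart_inv c)"
      by (rule smooth_on_transform[OF sm o eq])
  qed
qed (use t in auto)

lemma smooth_vfield_scale:
  assumes W: "opens M W" and h: "smooth_fun M W h" and X: "smooth_vfield M W X"
  shows "smooth_vfield M W (\<lambda>q. h q *\<^sub>R X q)"
  unfolding smooth_vfield_def
proof (intro conjI ballI)
  fix p assume "p \<in> W"
  then show "h p *\<^sub>R X p \<in> tangent_space M p"
    using tangent_scale smooth_vfield_tangent[OF X] openin_subset[OF W] by blast
next
  fix c assume c: "c \<in> charts M"
  have "smooth_fun M (fst c \<inter> W) (\<lambda>p. h p *\<^sub>R X p c)"
    by (rule smooth_fun_scaleR[OF _ smooth_fun_subset[OF h] smooth_vfield_component[OF X c]])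
      (use W chart_open[OF c] in auto)
  then show "smooth_fun M (fst c \<inter> W) (\<lambda>p. (h p *\<^sub>R X p) c)"
    by (simp add: scaleR_fun_def)
qed

lemma smooth_vfield_add:
  assumes W: "opens M W" and X: "smooth_vfield M W X" and Y: "smooth_vfield M W Y"
  shows "smooth_vfield M W (\<lambda>q. X q + Y q)"
  unfolding smooth_vfield_def
proof (intro conjI ballI)
  fix p assume "p \<in> W"
  then show "X p + Y p \<in> tangent_space M p"
    using tangent_add smooth_vfield_tangent[OF X] smooth_vfield_tangent[OF Y] openin_subset[OF W] by blast
next
  fix c assume c: "c \<in> charts M"
  show "smooth_fun M (fst c \<inter> W) (\<lambda>p. (X p + Y p) c)"
    using smooth_fun_add[OF openin_Int[OF chart_open[OF c] W] smooth_vfield_component[OF X c]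
        smooth_vfield_component[OF Y c]] by simp
qed

lemma smooth_vfield_coord_field:
  assumes c: "c \<in> charts M"
  shows "smooth_vfield M (fst c) (coord_field M c k)"
proof (rule smooth_vfieldI[OF c chart_open[OF c] order_refl])
  show "coord_field M c k p \<in> tangent_space M p" if "p \<in> fst c" for p
    by (rule coord_field_tangent[OF c that])
  have "open (snd c ` fst c)" using chart_image_open'[OF c chart_open[OF c]] by simp
  then show "smooth_on (snd c ` fst c) (\<lambda>z. coord_field M c k (chart_inv c z) c)"
    by (rule smooth_on_transform[OF smooth_on_const]) (auto simp: coord_field_self[OF c] chart_inv_left[OF c])
qed

lemma lie_bracket_chart:
  assumes W: "opens M W" "p \<in> W" and X: "smooth_vfield M W X" and Y: "smooth_vfield M W Y"
    and c: "c \<in> charts M" "p \<in> fst c"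
  shows "lie_bracket M X Y p c =
    fderiv (\<lambda>z. Y (chart_inv c z) c) (snd c p) (X p c) - fderiv (\<lambda>z. X (chart_inv c z) c) (snd c p) (Y p c)"
proof -
  have "tderiv M p (A p) (\<lambda>q. Z q c) = fderiv (\<lambda>z. Z (chart_inv c z) c) (snd c p) (A p c)"
    if "smooth_vfield M W A" "smooth_vfield M W Z" for A Z
  proof -
    have "((\<lambda>q. Z q c) \<circ> chart_inv c) differentiable at (snd c p)"
      using smooth_on_differentiable[OF smooth_vfield_chart[OF that(2) c(1)], of "snd c p"] c W
      by (simp add: o_def)
    from tderiv_chart[OF c smooth_vfield_tangent[OF that(1) W(2)] this] show ?thesis
      by (simp add: o_def)
  qed
  then show ?thesis
    using X Y c by (simp add: lie_bracket_def)
qed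

text \<open>A chart followed by a diffeomorphism \<open>F\<close> of an open part of its image has
  smooth transitions with every chart, \<open>G\<close> serving for those out of the new chart.
  Maximality of the atlas then turns compatibility into membership.\<close>

lemma new_chart:
  assumes c: "c \<in> charts M" and A: "open A" "A \<subseteq> snd c ` fst c" "open (F ` A)"
    and F: "smooth_on A F" and G: "smooth_on (F ` A) G" "\<And>z. z \<in> A \<Longrightarrow> G (F z) = z"
  defines "c' \<equiv> ({p \<in> fst c. snd c p \<in> A}, F \<circ> snd c)"
  shows "c' \<in> charts M"
    and "\<And>z. z \<in> F ` A \<Longrightarrow> chart_inv c' z = chart_inv c (G z)"
    and "\<And>p x. p \<in> fst c' \<Longrightarrow> x \<in> tangent_space M p \<Longrightarrow> x c' = fderiv F (snd c p) (x c)"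
proof -
  have img: "snd c ` fst c' = A" using A(2) by (auto simp: c'_def)
  have img': "snd c' ` fst c' = F ` A"
    using img by (simp add: c'_def flip: image_image)
  have op: "opens M (fst c')" using chart_preimage_open[OF c A(1)] by (simp add: c'_def)
  have sub: "fst c' \<subseteq> fst c" by (auto simp: c'_def)
  have injF: "inj_on F A" using G(2) by (metis inj_onI)
  have inj': "inj_on (snd c') (fst c')"
    unfolding c'_def snd_conv using comp_inj_on[of "snd c" "fst c'" F] inj_on_subset[OF chart_inj[OF c] sub] injF img
    by (simp add: c'_def)
  have inv_left: "chart_inv c' (snd c' p) = p" if "p \<in> fst c'" for p
    unfolding chart_inv_def by (rule inv_into_f_f[OF inj' that])
  show inv: "chart_inv c' z = chart_inv c (G z)" if z: "z \<in> F ` A" for z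
  proof -
    obtain p where p: "p \<in> fst c'" "z = snd c' p" using z img' by blast
    then have "snd c p \<in> A" "z = F (snd c p)" by (auto simp: c'_def)
    then have "chart_inv c (G z) = p" using G(2) chart_inv_left[OF c, of p] sub p(1) by auto
    then show ?thesis using inv_left p by simp
  qed
  have "homeomorphic_map (subtopology (mtop M) (fst c')) (top_of_set A) (snd c)"
    using homeomorphic_map_subtopologies[OF chart_homeomorphic[OF c], of "fst c'" A] img A(2) sub chart_topspace[OF c]
    by (simp add: subtopology_subtopology inf.absorb2)
  moreover have "homeomorphic_map (top_of_set A) (top_of_set (F ` A)) F"
    unfolding homeomorphic_map_maps homeomorphic_maps_def
    using smooth_on_continuous_on[OF F] smooth_on_continuous_on[OF G(1)] G(2)
    by (intro exI[of _ G]) (auto simp: continuous_map_in_subtopology)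
  ultimately have hom: "homeomorphic_map (subtopology (mtop M) (fst c')) (top_of_set (snd c' ` fst c')) (snd c')"
    unfolding img' using homeomorphic_map_compose by (fastforce simp: c'_def)
  have chart': "is_chart (mtop M) c'"
    unfolding is_chart_def using op hom A(3) img' by simp
  have "smooth_transition c' d \<and> smooth_transition d c'" if d: "d \<in> charts M" for d
  proof
    have o: "open (snd c ` (fst c' \<inter> fst d))"
      by (rule chart_image_open'[OF c openin_Int[OF op chart_open[OF d]]]) (use sub in blast)
    have eqF: "snd c' ` (fst c' \<inter> fst d) = F ` snd c ` (fst c' \<inter> fst d)"
      by (simp add: c'_def image_comp)
    have subA: "snd c ` (fst c' \<inter> fst d) \<subseteq> A" using img by blast
    \<comment> \<open>Images under F are preimages under its continuous inverse, hence open.\<close>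
    have oF: "open (snd c' ` (fst c' \<inter> fst d))"
    proof -
      have "F ` snd c ` (fst c' \<inter> fst d) = F ` A \<inter> G -` (snd c ` (fst c' \<inter> fst d))"
        using subA G(2) by force
      then show ?thesis
        unfolding eqF using continuous_open_preimage[OF smooth_on_continuous_on[OF G(1)] A(3) o] by simp
    qed
    show "smooth_transition c' d"
      unfolding smooth_transition_def
    proof (subst smooth_on_cong[OF oF])
      show "(snd d \<circ> chart_inv c') z = (snd d \<circ> chart_inv c) (G z)" if "z \<in> snd c' ` (fst c' \<inter> fst d)" for z
        using inv[of z] that subA eqF by auto
      have "smooth_on (snd c' ` (fst c' \<inter> fst d)) G"
        by (rule smooth_on_subset[OF G(1)]) (use eqF subA in blast)
      moreover have "smooth_on (snd c ` (fst c' \<inter> fst d)) (snd d \<circ> chart_inv c)"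
        by (rule smooth_on_subset[OF transition_smooth[OF c d]]) (use sub in blast)
      ultimately show "smooth_on (snd c' ` (fst c' \<inter> fst d)) (\<lambda>z. (snd d \<circ> chart_inv c) (G z))"
        by (rule smooth_on_compose[OF oF o, rotated]) (use subA G(2) in \<open>auto simp: eqF\<close>)
    qed
    have od: "open (snd d ` (fst d \<inter> fst c'))" by (rule chart_image_open[OF d op])
    show "smooth_transition d c'"
      unfolding smooth_transition_def
    proof (subst smooth_on_cong[OF od])
      show "(snd c' \<circ> chart_inv d) z = F ((snd c \<circ> chart_inv d) z)" for z
        by (simp add: c'_def)
      have "smooth_on (snd d ` (fst d \<inter> fst c')) (snd c \<circ> chart_inv d)"
        by (rule smooth_on_subset[OF transition_smooth[OF d c]]) (use sub in blast)
      then show "smooth_on (snd d ` (fst d \<inter> fst c')) (\<lambda>z. F ((snd c \<circ> chart_inv d) z))"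
        by (rule smooth_on_compose[OF od A(1) _ _ F, rotated])
          (use img chart_inv_left[OF d] in auto)
    qed
  qed
  moreover have "is_chart (mtop M) c' \<and> (\<forall>d\<in>charts M. smooth_transition c' d \<and> smooth_transition d c')
      \<longrightarrow> c' \<in> charts M"
    using smooth_manifold unfolding smooth_manifold_def by (elim conjE) (rule spec)
  ultimately show charts': "c' \<in> charts M"
    using chart' by blast
  fix p x assume p: "p \<in> fst c'" and x: "x \<in> tangent_space M p"
  have pc: "p \<in> fst c" using p sub by blast
  have "fderiv (snd c' \<circ> chart_inv c) (snd c p) = fderiv F (snd c p)"
  proof (rule fderiv_cong_open[OF A(1)])
    show "snd c p \<in> A" using p img by blast
    fix z assume "z \<in> A"
    then obtain q where "q \<in> fst c" "z = snd c q" using A(2) by blast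
    then show "(snd c' \<circ> chart_inv c) z = F z"
      using chart_inv_left[OF c] by (simp add: c'_def)
  qed
  then show "x c' = fderiv F (snd c p) (x c)"
    using tangent_transform[OF x c pc charts' p] by simp
qed

end

section \<open>Metrics, connections and submanifolds\<close>

lemma fderiv_field_has_derivative:
  fixes \<phi> :: "'a::euclidean_space \<Rightarrow> 'b::real_normed_vector"
  assumes S: "open S" "z \<in> S" and \<phi>: "smooth_on S \<phi>" and X: "smooth_on S X"
  shows "((\<lambda>x. fderiv \<phi> x (X x)) has_derivative
    (\<lambda>w. fderiv (\<lambda>x. fderiv \<phi> x (X z)) z w + fderiv \<phi> z (fderiv X z w))) (at z)"
proof -
  have D2: "((\<lambda>x. fderiv \<phi> x v) has_derivative fderiv (\<lambda>x. fderiv \<phi> x v) z) (at z)" for v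
    by (rule smooth_on_has_derivative[OF smooth_on_fderiv[OF \<phi>] S(2)])
  have DX: "((\<lambda>x. X x \<bullet> b) has_derivative (\<lambda>w. fderiv X z w \<bullet> b)) (at z)" for b
    by (rule has_derivative_inner_left[OF smooth_on_has_derivative[OF X S(2)]])
  have expand: "fderiv \<phi> x v = (\<Sum>b\<in>Basis. (v \<bullet> b) *\<^sub>R fderiv \<phi> x b)" if "x \<in> S" for x v
    by (rule linear_Basis_expansion[OF smooth_on_linear_fderiv[OF \<phi> that]])
  have "((\<lambda>x. \<Sum>b\<in>Basis. (v \<bullet> b) *\<^sub>R fderiv \<phi> x b) has_derivative
      (\<lambda>w. \<Sum>b\<in>Basis. (v \<bullet> b) *\<^sub>R fderiv (\<lambda>x. fderiv \<phi> x b) z w)) (at z)" for v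
    by (intro has_derivative_sum has_derivative_scaleR_right D2)
  then have D2_sum: "((\<lambda>x. fderiv \<phi> x v) has_derivative
      (\<lambda>w. \<Sum>b\<in>Basis. (v \<bullet> b) *\<^sub>R fderiv (\<lambda>x. fderiv \<phi> x b) z w)) (at z)" for v
    by (rule has_derivative_transform_within_open[OF _ S]) (rule expand[symmetric])
  have D2_expand: "fderiv (\<lambda>x. fderiv \<phi> x v) z w = (\<Sum>b\<in>Basis. (v \<bullet> b) *\<^sub>R fderiv (\<lambda>x. fderiv \<phi> x b) z w)" for v w
    by (rule fun_cong[OF fderiv_at[OF D2_sum]])
  have "((\<lambda>x. \<Sum>b\<in>Basis. (X x \<bullet> b) *\<^sub>R fderiv \<phi> x b) has_derivative
      (\<lambda>w. \<Sum>b\<in>Basis. (X z \<bullet> b) *\<^sub>R fderiv (\<lambda>x. fderiv \<phi> x b) z w + (fderiv X z w \<bullet> b) *\<^sub>R fderiv \<phi> z b)) (at z)"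
    by (intro has_derivative_sum has_derivative_scaleR D2 DX)
  then have "((\<lambda>x. fderiv \<phi> x (X x)) has_derivative
      (\<lambda>w. \<Sum>b\<in>Basis. (X z \<bullet> b) *\<^sub>R fderiv (\<lambda>x. fderiv \<phi> x b) z w + (fderiv X z w \<bullet> b) *\<^sub>R fderiv \<phi> z b)) (at z)"
    by (rule has_derivative_transform_within_open[OF _ S]) (rule expand[symmetric])
  moreover have "(\<Sum>b\<in>Basis. (X z \<bullet> b) *\<^sub>R fderiv (\<lambda>x. fderiv \<phi> x b) z w + (fderiv X z w \<bullet> b) *\<^sub>R fderiv \<phi> z b) =
      fderiv (\<lambda>x. fderiv \<phi> x (X z)) z w + fderiv \<phi> z (fderiv X z w)" for w
    unfolding sum.distrib D2_expand[symmetric] expand[OF S(2), symmetric] by simp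
  ultimately show ?thesis by simp
qed

text \<open>The second-order terms cancel by symmetry. The rule is used for functions on the
  manifold and, with \<phi> the inclusion of the surface in charts, for the image of a
  bracket.\<close>

lemma fderiv_commutator:
  fixes \<phi> :: "'a::euclidean_space \<Rightarrow> 'b::banach"
  assumes S: "open S" "z \<in> S" and \<phi>: "smooth_on S \<phi>" and X: "smooth_on S X" and Y: "smooth_on S Y"
  shows "fderiv (\<lambda>x. fderiv \<phi> x (Y x)) z (X z) - fderiv (\<lambda>x. fderiv \<phi> x (X x)) z (Y z) =
    fderiv \<phi> z (fderiv Y z (X z) - fderiv X z (Y z))"
  using symmetric_second_fderiv[OF S \<phi>, of "Y z" "X z"]
    linear_diff[OF smooth_on_linear_fderiv[OF \<phi> S(2)]]
  by (simp add: fderiv_at[OF fderiv_field_has_derivative[OF S \<phi> Y]]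
      fderiv_at[OF fderiv_field_has_derivative[OF S \<phi> X]])

text \<open>The pointwise axioms are kept apart because they pass to the induced metric by linearity
  and injectivity of \<open>incl_diff\<close>; ambient and induced metric then share one
  algebra.\<close>

locale tangent_metric = smooth_mfd M for M :: "('a, 'n::finite) manifold" +
  fixes g :: "('a, 'n) metric"
  assumes g_sym: "\<And>p x y. p \<in> points M \<Longrightarrow> x \<in> tangent_space M p \<Longrightarrow> y \<in> tangent_space M p \<Longrightarrow> g p x y = g p y x"
    and g_pos: "\<And>p x. p \<in> points M \<Longrightarrow> x \<in> tangent_space M p \<Longrightarrow> x \<noteq> 0 \<Longrightarrow> g p x x > 0"
    and g_lin: "\<And>p x y z a b. p \<in> points M \<Longrightarrow> x \<in> tangent_space M p \<Longrightarrow> y \<in> tangent_space M p \<Longrightarrow>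
      z \<in> tangent_space M p \<Longrightarrow> g p (a *\<^sub>R x + b *\<^sub>R y) z = a * g p x z + b * g p y z"
begin

lemma g_add:
  assumes "p \<in> points M" "x \<in> tangent_space M p" "y \<in> tangent_space M p" "z \<in> tangent_space M p"
  shows "g p (x + y) z = g p x z + g p y z"
  using g_lin[OF assms, of 1 1] by simp

lemma g_scale:
  assumes "p \<in> points M" "x \<in> tangent_space M p" "z \<in> tangent_space M p"
  shows "g p (a *\<^sub>R x) z = a * g p x z"
  using g_lin[OF assms(1,2,2,3), of a 0] by (simp only: scaleR_zero_left add_0_right mult_zero_left)

lemma g_lin_right:
  assumes "p \<in> points M" "x \<in> tangent_space M p" "y \<in> tangent_space M p" "z \<in> tangent_space M p"
  shows "g p z (a *\<^sub>R x + b *\<^sub>R y) = a * g p z x + b * g p z y"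
  using g_lin[OF assms, of a b] g_sym[OF assms(1,4)] tangent_add tangent_scale assms by metis

lemma g_scale_right:
  assumes "p \<in> points M" "x \<in> tangent_space M p" "z \<in> tangent_space M p"
  shows "g p z (a *\<^sub>R x) = a * g p z x"
  using g_lin_right[OF assms(1,2,2,3), of a 0] by (simp only: scaleR_zero_left add_0_right mult_zero_left)

lemma g_zero: "p \<in> points M \<Longrightarrow> z \<in> tangent_space M p \<Longrightarrow> g p 0 z = 0"
  using g_scale[OF _ tangent_zero, of p z 0] by (simp only: scaleR_zero_left mult_zero_left)

lemma g_sum:
  assumes p: "p \<in> points M" and v: "\<And>i. i \<in> I \<Longrightarrow> v i \<in> tangent_space M p" and z: "z \<in> tangent_space M p"
    and I: "finite I"
  shows "g p (\<Sum>i\<in>I. a i *\<^sub>R v i) z = (\<Sum>i\<in>I. a i * g p (v i) z)"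
  using I v
proof (induction I rule: finite_induct)
  case empty
  show ?case unfolding sum.empty by (rule g_zero[OF p z])
next
  case (insert i I)
  have "g p (a i *\<^sub>R v i + (\<Sum>i\<in>I. a i *\<^sub>R v i)) z = g p (a i *\<^sub>R v i) z + g p (\<Sum>i\<in>I. a i *\<^sub>R v i) z"
    by (rule g_add[OF p tangent_scale[OF p] tangent_sum[OF p] z]) (use insert.prems tangent_scale[OF p] in auto)
  moreover have "g p (a i *\<^sub>R v i) z = a i * g p (v i) z"
    by (rule g_scale[OF p _ z]) (use insert.prems in auto)
  moreover have "g p (\<Sum>i\<in>I. a i *\<^sub>R v i) z = (\<Sum>i\<in>I. a i * g p (v i) z)"
    by (rule insert.IH) (use insert.prems in auto)
  ultimately show ?case
    unfolding sum.insert[OF insert(1,2)] by (simp only:)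
qed

lemma g_sum_right:
  assumes p: "p \<in> points M" and v: "\<And>i. i \<in> I \<Longrightarrow> v i \<in> tangent_space M p" and z: "z \<in> tangent_space M p"
    and I: "finite I"
  shows "g p z (\<Sum>i\<in>I. a i *\<^sub>R v i) = (\<Sum>i\<in>I. a i * g p z (v i))"
proof -
  have "(\<Sum>i\<in>I. a i *\<^sub>R v i) \<in> tangent_space M p"
    by (rule tangent_sum[OF p]) (rule tangent_scale[OF p v])
  then have "g p z (\<Sum>i\<in>I. a i *\<^sub>R v i) = g p (\<Sum>i\<in>I. a i *\<^sub>R v i) z"
    by (rule g_sym[OF p z])
  also have "\<dots> = (\<Sum>i\<in>I. a i * g p (v i) z)" by (rule g_sum[OF p v z I])
  also have "\<dots> = (\<Sum>i\<in>I. a i * g p z (v i))"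
    by (rule sum.cong) (use g_sym[OF p v z] in auto)
  finally show ?thesis .
qed

end

locale riemannian = smooth_mfd M for M :: "('a, 'n::finite) manifold" +
  fixes g :: "('a, 'n) metric"
  assumes riemannian_metric: "riemannian_metric M g"
begin

sublocale tangent_metric M g
proof
  fix p x y z and a b :: real assume p: "p \<in> points M" "x \<in> tangent_space M p"
  have *: "\<forall>p\<in>points M. \<forall>x\<in>tangent_space M p. \<forall>y\<in>tangent_space M p.
        g p x y = g p y x \<and> (x \<noteq> 0 \<longrightarrow> g p x x > 0) \<and>
        (\<forall>z\<in>tangent_space M p. \<forall>a b. g p (a *\<^sub>R x + b *\<^sub>R y) z = a * g p x z + b * g p y z)"
    using riemannian_metric unfolding riemannian_metric_def by (rule conjunct1)
  show "x \<noteq> 0 \<Longrightarrow> g p x x > 0" using * p by blast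
  assume y: "y \<in> tangent_space M p"
  show "g p x y = g p y x" using * p y by blast
  assume z: "z \<in> tangent_space M p"
  show "g p (a *\<^sub>R x + b *\<^sub>R y) z = a * g p x z + b * g p y z" using * p y z by blast
qed

lemma metric_coefficient_smooth:
  assumes "c \<in> charts M"
  shows "smooth_fun M (fst c) (\<lambda>p. g p (coord_field M c i p) (coord_field M c j p))"
proof -
  have "\<forall>c\<in>charts M. \<forall>i j. smooth_fun M (fst c) (\<lambda>p. g p (coord_field M c i p) (coord_field M c j p))"
    using riemannian_metric unfolding riemannian_metric_def by (rule conjunct2)
  from this[rule_format, OF assms] show ?thesis .
qed

end

section \<open>Rules for the Levi-Civita connection\<close>

locale levi_civita_mfd = smooth_mfd M for M :: "('a, 'n::finite) manifold" +
  fixes g :: "('a, 'n) metric" and nabla :: "('a, 'n) connection"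
  assumes levi_civita: "levi_civita M g nabla"
begin

lemma nabla_connD:
  assumes "opens M W" "smooth_vfield M W Y" 
  shows "(\<forall>X. smooth_vfield M W X \<longrightarrow> smooth_vfield M W (\<lambda>p. nabla Y p (X p))) \<and>
     (\<forall>p\<in>W. \<forall>x\<in>tangent_space M p.
        nabla Y p x \<in> tangent_space M p \<and>
        (\<forall>y\<in>tangent_space M p. \<forall>a b.
           nabla Y p (a *\<^sub>R x + b *\<^sub>R y) = a *\<^sub>R nabla Y p x + b *\<^sub>R nabla Y p y) \<and>
        (\<forall>Z. smooth_vfield M W Z \<longrightarrow> nabla (\<lambda>q. Y q + Z q) p x = nabla Y p x + nabla Z p x) \<and>
        (\<forall>h. smooth_fun M W h \<longrightarrow>
           nabla (\<lambda>q. h q *\<^sub>R Y q) p x = tderiv M p x h *\<^sub>R Y p + h p *\<^sub>R nabla Y p x) \<and>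
        (\<forall>Z. smooth_vfield M W Z \<and> (\<forall>q\<in>W. Z q = Y q) \<longrightarrow> nabla Z p x = nabla Y p x))"
proof -
  have "is_connection M nabla" using levi_civita unfolding levi_civita_def by (rule conjunct1)
  from this[unfolded is_connection_def, rule_format, OF conjI[OF assms]] show ?thesis by (simp only:)
qed

lemma nabla_tangent:
  assumes "opens M W" "smooth_vfield M W Y" "p \<in> W" "x \<in> tangent_space M p"
  shows "nabla Y p x \<in> tangent_space M p"
  using nabla_connD[OF assms(1,2), THEN conjunct2, rule_format, OF assms(3,4), THEN conjunct1] .

lemma nabla_lin:
  assumes "opens M W" "smooth_vfield M W Y" "p \<in> W" "x \<in> tangent_space M p" "y \<in> tangent_space M p"
  shows "nabla Y p (a *\<^sub>R x + b *\<^sub>R y) = a *\<^sub>R nabla Y p x + b *\<^sub>R nabla Y p y"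
  using nabla_connD[OF assms(1,2), THEN conjunct2, rule_format, OF assms(3,4), THEN conjunct2, THEN conjunct1,
      rule_format, OF assms(5)] .

lemma nabla_add:
  assumes "opens M W" "smooth_vfield M W Y" "smooth_vfield M W Z" "p \<in> W" "x \<in> tangent_space M p"
  shows "nabla (\<lambda>q. Y q + Z q) p x = nabla Y p x + nabla Z p x"
  using nabla_connD[OF assms(1,2), THEN conjunct2, rule_format, OF assms(4,5), THEN conjunct2, THEN conjunct2,
      THEN conjunct1, rule_format, OF assms(3)] .

lemma nabla_scale:
  assumes "opens M W" "smooth_vfield M W Y" "smooth_fun M W h" "p \<in> W" "x \<in> tangent_space M p"
  shows "nabla (\<lambda>q. h q *\<^sub>R Y q) p x = tderiv M p x h *\<^sub>R Y p + h p *\<^sub>R nabla Y p x"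
  using nabla_connD[OF assms(1,2), THEN conjunct2, rule_format, OF assms(4,5), THEN conjunct2, THEN conjunct2,
      THEN conjunct2, THEN conjunct1, rule_format, OF assms(3)] .

lemma nabla_cong:
  assumes "opens M W" "smooth_vfield M W Y" "smooth_vfield M W Z" "\<And>q. q \<in> W \<Longrightarrow> Z q = Y q"
    "p \<in> W" "x \<in> tangent_space M p"
  shows "nabla Z p x = nabla Y p x"
  using nabla_connD[OF assms(1,2), THEN conjunct2, rule_format, OF assms(5,6), THEN conjunct2, THEN conjunct2,
      THEN conjunct2, THEN conjunct2, rule_format, OF conjI[OF assms(3)]] assms(4) by blast

lemma nabla_smooth:
  assumes "opens M W" "smooth_vfield M W Y" "smooth_vfield M W X"
  shows "smooth_vfield M W (\<lambda>p. nabla Y p (X p))"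
  using nabla_connD[OF assms(1,2), THEN conjunct1, rule_format, OF assms(3)] .

lemma levi_civitaD:
  assumes "opens M W" "smooth_vfield M W Y" "smooth_vfield M W Z" "p \<in> W"
  shows "nabla Z p (Y p) - nabla Y p (Z p) = lie_bracket M Y Z p"
    and "x \<in> tangent_space M p \<Longrightarrow>
      tderiv M p x (\<lambda>q. g q (Y q) (Z q)) = g p (nabla Y p x) (Z p) + g p (Y p) (nabla Z p x)"
proof -
  have "\<forall>W Y Z. opens M W \<and> smooth_vfield M W Y \<and> smooth_vfield M W Z \<longrightarrow>
        (\<forall>p\<in>W. nabla Z p (Y p) - nabla Y p (Z p) = lie_bracket M Y Z p \<and>
           (\<forall>x\<in>tangent_space M p.
              tderiv M p x (\<lambda>q. g q (Y q) (Z q)) = g p (nabla Y p x) (Z p) + g p (Y p) (nabla Z p x)))"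
    using levi_civita unfolding levi_civita_def by (rule conjunct2)
  note * = this[rule_format, OF conjI[OF assms(1) conjI[OF assms(2,3)]] assms(4)]
  show "nabla Z p (Y p) - nabla Y p (Z p) = lie_bracket M Y Z p"
    by (rule *[THEN conjunct1])
  show "x \<in> tangent_space M p \<Longrightarrow>
      tderiv M p x (\<lambda>q. g q (Y q) (Z q)) = g p (nabla Y p x) (Z p) + g p (Y p) (nabla Z p x)"
    by (rule *[THEN conjunct2, rule_format])
qed

lemma nabla_sum:
  assumes W: "opens M W" "smooth_vfield M W Y" "p \<in> W" and v: "\<And>i. i \<in> I \<Longrightarrow> v i \<in> tangent_space M p"
    and I: "finite I" "I \<noteq> {}"
  shows "nabla Y p (\<Sum>i\<in>I. a i *\<^sub>R v i) = (\<Sum>i\<in>I. a i *\<^sub>R nabla Y p (v i))"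
  using I v
proof (induction I rule: finite_ne_induct)
  case (singleton i)
  have p: "p \<in> points M" using openin_subset[OF W(1)] W(3) by blast
  have "v i \<in> tangent_space M p" using singleton by simp
  from nabla_lin[OF W this this, of "a i" 0]
  have "nabla Y p (a i *\<^sub>R v i) = a i *\<^sub>R nabla Y p (v i)"
    by (simp only: scaleR_zero_left add_0_right)
  then show ?case by (simp only: sum.insert sum.empty finite.emptyI empty_iff not_False_eq_True add_0_right)
next
  case (insert i I)
  have p: "p \<in> points M" using openin_subset[OF W(1)] W(3) by blast
  have vi: "v i \<in> tangent_space M p" and vI: "\<And>j. j \<in> I \<Longrightarrow> v j \<in> tangent_space M p"
    using insert.prems by auto
  have "(\<Sum>i\<in>I. a i *\<^sub>R v i) \<in> tangent_space M p"
    by (intro tangent_sum tangent_scale p vI)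
  from nabla_lin[OF W vi this, of "a i" 1]
  have "nabla Y p (a i *\<^sub>R v i + (\<Sum>i\<in>I. a i *\<^sub>R v i)) = a i *\<^sub>R nabla Y p (v i) + nabla Y p (\<Sum>i\<in>I. a i *\<^sub>R v i)"
    by (simp only: scaleR_one)
  also have "nabla Y p (\<Sum>i\<in>I. a i *\<^sub>R v i) = (\<Sum>i\<in>I. a i *\<^sub>R nabla Y p (v i))"
    by (rule insert.IH) (rule vI)
  finally show ?case unfolding sum.insert[OF insert(1,3)] .
qed

text \<open>Symmetry of the Christoffel symbols: coordinate fields have constant components in their
  own chart, so the torsion identity has bracket zero there.\<close>

lemma coord_fields_commute:
  assumes c: "c \<in> charts M" "p \<in> fst c"
  shows "nabla (coord_field M c k) p (coord_field M c j p) c = nabla (coord_field M c j) p (coord_field M c k p) c"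
proof -
  note o = chart_open[OF c(1)]
  have const: "tderiv M p x (\<lambda>q. coord_field M c i q c) = 0" for x i
    using tderiv_cong[OF o c(2), of "\<lambda>q. coord_field M c i q c" "\<lambda>q. axis i 1" x] coord_field_self[OF c(1)]
    by (simp add: tderiv_const)
  have "nabla (coord_field M c k) p (coord_field M c j p) - nabla (coord_field M c j) p (coord_field M c k p) =
      lie_bracket M (coord_field M c j) (coord_field M c k) p"
    by (rule levi_civitaD(1)[OF o smooth_vfield_coord_field[OF c(1)] smooth_vfield_coord_field[OF c(1)] c(2)])
  from fun_cong[OF this, of c] show ?thesis
    using c by (simp add: lie_bracket_def const)
qed

end

lemma sum_fun_apply: "(\<Sum>i\<in>I. f i) x = (\<Sum>i\<in>I. f i x)"
  by (induction I rule: infinite_finite_induct) auto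

section \<open>Immersed submanifolds and covariant derivatives along them\<close>

locale riemannian_submanifold = M: riemannian M g + MC: levi_civita_mfd M g nabla + S: smooth_mfd S
  for M :: "('a, 'm::finite) manifold" and g and nabla and S :: "('a, 'n::finite) manifold" +
  assumes submanifold: "submanifold M S"
begin

lemma points_subset: "p \<in> points S \<Longrightarrow> p \<in> points M"
proof -
  have "continuous_map (mtop S) (mtop M) (\<lambda>p. p)"
    using submanifold by (simp add: submanifold_def)
  then show "p \<in> points S \<Longrightarrow> p \<in> points M"
    using continuous_map_image_subset_topspace by fastforce
qed

lemma restrict_open:
  assumes "opens M W"
  shows "opens S (W \<inter> points S)"
proof -
  have "continuous_map (mtop S) (mtop M) (\<lambda>p. p)"
    using submanifold by (simp add: submanifold_def)
  from openin_continuous_map_preimage[OF this assms] show ?thesis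
    by (simp add: Collect_conj_eq Int_commute)
qed

lemma chart_restrict_open: "c \<in> charts M \<Longrightarrow> opens S (fst c \<inter> points S)"
  by (rule restrict_open[OF M.chart_open])

lemma chart_restrict_smooth: "c \<in> charts M \<Longrightarrow> smooth_fun S (fst c \<inter> points S) (snd c)"
  using submanifold unfolding submanifold_def by blast

lemma chart_restrict_mdiff:
  assumes "c \<in> charts M" "p \<in> fst c" "p \<in> points S"
  shows "S.mdiff p (snd c)"
  by (rule S.smooth_fun_mdiff[OF chart_restrict_smooth[OF assms(1)] chart_restrict_open[OF assms(1)]])
    (use assms in blast)

lemma
  assumes c: "c \<in> charts M" "p \<in> fst c" and p: "p \<in> points S"
    and H: "(H \<circ> chart_inv c) differentiable at (snd c p)"
  shows mdiff_restrict: "S.mdiff p H"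
    and tderiv_restrict_chart: "tderiv S p x H = fderiv (H \<circ> chart_inv c) (snd c p) (tderiv S p x (snd c))"
proof -
  let ?d = "chart_at S p"
  have W: "opens S (fst c \<inter> points S)" "p \<in> fst c \<inter> points S"
    using chart_restrict_open c p by auto
  have eq: "H q = (H \<circ> chart_inv c) (snd c q)" if "q \<in> fst c \<inter> points S" for q
    using M.chart_inv_left[OF c(1)] that by simp
  have "(snd c \<circ> chart_inv ?d) (snd ?d p) = snd c p"
    using S.point_of_chart_at[OF p] by simp
  then have "((H \<circ> chart_inv c) has_derivative fderiv (H \<circ> chart_inv c) (snd c p))
      (at ((snd c \<circ> chart_inv ?d) (snd ?d p)))"
    using fderiv_works[OF H] by simp
  from has_derivative_compose[OF S.mdiff_has_derivative[OF chart_restrict_mdiff[OF c p]] this]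
  have D: "((\<lambda>q. (H \<circ> chart_inv c) (snd c q)) \<circ> chart_inv ?d has_derivative
      (\<lambda>w. fderiv (H \<circ> chart_inv c) (snd c p) (fderiv (snd c \<circ> chart_inv ?d) (snd ?d p) w))) (at (snd ?d p))"
    by (simp add: o_def)
  have "S.mdiff p (\<lambda>q. (H \<circ> chart_inv c) (snd c q))"
    unfolding S.mdiff_def by (rule differentiableI[OF D])
  then show "S.mdiff p H"
    using S.mdiff_cong[OF W eq] by simp
  have "tderiv S p x H = tderiv S p x (\<lambda>q. (H \<circ> chart_inv c) (snd c q))"
    by (rule S.tderiv_cong[OF W eq])
  also have "\<dots> = fderiv (H \<circ> chart_inv c) (snd c p) (tderiv S p x (snd c))"
    unfolding S.tderiv_eq[OF D] by (simp add: tderiv_def Let_def)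
  finally show "tderiv S p x H = fderiv (H \<circ> chart_inv c) (snd c p) (tderiv S p x (snd c))" .
qed

lemma incl_component: "c \<in> charts M \<Longrightarrow> p \<in> fst c \<Longrightarrow> incl_diff M S p x c = tderiv S p x (snd c)"
  by (simp add: incl_diff_def)

lemma incl_tangent:
  assumes p: "p \<in> points S"
  shows "incl_diff M S p x \<in> tangent_space M p"
  unfolding tangent_space_def mem_Collect_eq
proof (intro conjI ballI impI allI)
  fix c d assume c: "c \<in> charts M" "d \<in> charts M" and pc: "p \<in> fst c \<inter> fst d"
  have "(snd d \<circ> chart_inv c) differentiable at (snd c p)"
    by (rule differentiableI[OF M.transition_differentiable]) (use c pc in auto)
  then show "incl_diff M S p x d = fderiv (snd d \<circ> chart_inv c) (snd c p) (incl_diff M S p x c)"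
    using tderiv_restrict_chart[of c p "snd d" x] incl_component[of c p x] incl_component[of d p x] c pc p by simp
next
  fix c assume "\<not> (c \<in> charts M \<and> p \<in> fst c)"
  then show "incl_diff M S p x c = 0" unfolding incl_diff_def by (rule if_not_P)
qed

lemma tderiv_restrict:
  assumes c: "c \<in> charts M" "p \<in> fst c" and p: "p \<in> points S" and H: "M.mdiff p H"
  shows "tderiv S p x H = tderiv M p (incl_diff M S p x) H"
proof -
  have H: "(H \<circ> chart_inv c) differentiable at (snd c p)"
    using H M.mdiff_chart[OF c] by blast
  show ?thesis
    using tderiv_restrict_chart[OF c p H] M.tderiv_chart[OF c incl_tangent[OF p] H] incl_component[OF c] by simp
qed

lemma incl_linear:
  assumes p: "p \<in> points S"
  shows "incl_diff M S p (a *\<^sub>R x + b *\<^sub>R y) = a *\<^sub>R incl_diff M S p x + b *\<^sub>R incl_diff M S p y"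
proof
  fix c
  show "incl_diff M S p (a *\<^sub>R x + b *\<^sub>R y) c = (a *\<^sub>R incl_diff M S p x + b *\<^sub>R incl_diff M S p y) c"
  proof (cases "c \<in> charts M \<and> p \<in> fst c")
    case True
    then have lin: "linear (\<lambda>x. tderiv S p x (snd c))"
      using S.tderiv_vector_linear[OF chart_restrict_mdiff] p by blast
    show ?thesis
      using True linear_add[OF lin, of "a *\<^sub>R x" "b *\<^sub>R y"] linear_cmul[OF lin, of a x] linear_cmul[OF lin, of b y]
      by (simp add: incl_diff_def scaleR_fun_def)
  next
    case False
    then have "incl_diff M S p z c = 0" for z
      unfolding incl_diff_def by (rule if_not_P)
    then show ?thesis by (simp add: scaleR_fun_def)
  qed
qed

lemma incl_scale: "p \<in> points S \<Longrightarrow> incl_diff M S p (a *\<^sub>R x) = a *\<^sub>R incl_diff M S p x"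
  using incl_linear[of p a x 0 x] by (simp only: scaleR_zero_left add_0_right)

lemma incl_inj:
  assumes "p \<in> points S" "x \<in> tangent_space S p" "y \<in> tangent_space S p" "incl_diff M S p x = incl_diff M S p y"
  shows "x = y"
proof -
  have "inj_on (incl_diff M S p) (tangent_space S p)"
    using submanifold assms(1) unfolding submanifold_def by blast
  then show ?thesis using assms by (simp add: inj_on_def)
qed

text \<open>The covariant derivative along \<open>S\<close> computed in one fixed chart \<open>c\<close> of \<open>M\<close>. Working in a fixed chart
  makes it unnecessary to know how the defining formula transforms under a change of chart.\<close>

definition chart_covderiv :: "('a, 'm) chart \<Rightarrow> ('a, 'm) vfield \<Rightarrow> 'a \<Rightarrow> ('a, 'n) tangent \<Rightarrow> ('a, 'm) tangent" where
  "chart_covderiv c V p x = (\<Sum>i\<in>UNIV. (tderiv S p x (\<lambda>q. V q c) $ i) *\<^sub>R coord_field M c i p)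
     + (\<Sum>k\<in>UNIV. (V p c $ k) *\<^sub>R nabla (coord_field M c k) p (incl_diff M S p x))"

context
  fixes c p
  assumes c: "c \<in> charts M" "p \<in> fst c" and p: "p \<in> points S"
begin

lemma coord_tangent: "coord_field M c k p \<in> tangent_space M p"
  by (rule M.coord_field_tangent[OF c])

lemma nabla_coord_tangent: "nabla (coord_field M c k) p (incl_diff M S p x) \<in> tangent_space M p"
  by (rule MC.nabla_tangent[OF M.chart_open[OF c(1)] M.smooth_vfield_coord_field[OF c(1)] c(2) incl_tangent[OF p]])

lemma chart_covderiv_tangent: "chart_covderiv c V p x \<in> tangent_space M p"
  unfolding chart_covderiv_def
  by (intro M.tangent_add M.tangent_sum M.tangent_scale points_subset p coord_tangent nabla_coord_tangent)

lemma chart_covderiv_component: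
  "chart_covderiv c V p x c = tderiv S p x (\<lambda>q. V q c)
     + (\<Sum>k\<in>UNIV. (V p c $ k) *\<^sub>R nabla (coord_field M c k) p (incl_diff M S p x) c)"
proof -
  have "(\<Sum>i\<in>UNIV. (w $ i) *\<^sub>R coord_field M c i p) c = w" for w
  proof -
    have "(\<Sum>i\<in>UNIV. (w $ i) *\<^sub>R coord_field M c i p) c = (\<Sum>i\<in>UNIV. (w $ i) *\<^sub>R (axis i 1 :: real^'m))"
      by (simp add: sum_fun_apply scaleR_fun_def M.coord_field_self[OF c])
    also have "\<dots> = w" by (simp add: vec_eq_iff axis_def if_distrib cong: if_cong)
    finally show ?thesis .
  qed
  then show ?thesis
    by (simp add: chart_covderiv_def sum_fun_apply scaleR_fun_def)
qed

text \<open>Both sides have the same component in \<open>c\<close> by definition; once the left side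
  is known to be a tangent vector, its other components are determined. For V and N this is known
  from the equations they satisfy.\<close>

lemma covderiv_along_eq_chart_covderiv:
  assumes "covderiv_along M S nabla V p x \<in> tangent_space M p"
  shows "covderiv_along M S nabla V p x = chart_covderiv c V p x"
  by (rule M.tangent_eqI[OF assms chart_covderiv_tangent c])
    (use c in \<open>simp add: covderiv_along_def chart_covderiv_component\<close>)

text \<open>Both fields are expanded in the coordinate frame of \<open>c\<close> and the product
  rule is applied; the derivatives of the metric coefficients come from compatibility of the ambient
  connection for coordinate fields.\<close>

lemma chart_covderiv_metric:
  assumes x: "x \<in> tangent_space S p"
    and W: "opens S W" "p \<in> W" and YW: "\<And>q. q \<in> W \<Longrightarrow> Y q \<in> tangent_space M q"
    and ZW: "\<And>q. q \<in> W \<Longrightarrow> Z q \<in> tangent_space M q"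
    and Y: "S.mdiff p (\<lambda>q. Y q c)" and Z: "S.mdiff p (\<lambda>q. Z q c)"
  shows "tderiv S p x (\<lambda>q. g q (Y q) (Z q)) = g p (chart_covderiv c Y p x) (Z p) + g p (Y p) (chart_covderiv c Z p x)"
proof -
  have pM: "p \<in> points M" by (rule points_subset[OF p])
  define G where "G i j q = g q (coord_field M c i q) (coord_field M c j q)" for i j q
  define y where "y i q = Y q c $ i" for i q
  define z where "z i q = Z q c $ i" for i q
  let ?I = "incl_diff M S p x"
  let ?d = "\<lambda>i. coord_field M c i p"
  let ?N = "\<lambda>i. nabla (coord_field M c i) p ?I"
  have W': "opens S (W \<inter> (fst c \<inter> points S))" "p \<in> W \<inter> (fst c \<inter> points S)"
    using openin_Int[OF W(1) chart_restrict_open[OF c(1)]] W(2) c(2) p by auto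
  have expandY: "g q (Y q) v = (\<Sum>i\<in>UNIV. y i q * g q (coord_field M c i q) v)"
    if "q \<in> W \<inter> (fst c \<inter> points S)" "v \<in> tangent_space M q" for q v
  proof -
    have q: "q \<in> points M" "q \<in> W" "q \<in> fst c" using that points_subset by auto
    have "g q (Y q) v = g q (\<Sum>i\<in>UNIV. y i q *\<^sub>R coord_field M c i q) v"
      unfolding y_def by (subst M.tangent_coord_expansion[OF YW[OF q(2)] c(1) q(3)]) (rule refl)
    also have "\<dots> = (\<Sum>i\<in>UNIV. y i q * g q (coord_field M c i q) v)"
      by (rule M.g_sum[OF q(1) M.coord_field_tangent[OF c(1) q(3)] that(2)]) simp
    finally show ?thesis .
  qed
  have expandZ: "g q v (Z q) = (\<Sum>i\<in>UNIV. z i q * g q v (coord_field M c i q))"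
    if "q \<in> W \<inter> (fst c \<inter> points S)" "v \<in> tangent_space M q" for q v
  proof -
    have q: "q \<in> points M" "q \<in> W" "q \<in> fst c" using that points_subset by auto
    have "g q v (Z q) = g q v (\<Sum>i\<in>UNIV. z i q *\<^sub>R coord_field M c i q)"
      unfolding z_def by (subst M.tangent_coord_expansion[OF ZW[OF q(2)] c(1) q(3)]) (rule refl)
    also have "\<dots> = (\<Sum>i\<in>UNIV. z i q * g q v (coord_field M c i q))"
      by (rule M.g_sum_right[OF q(1) M.coord_field_tangent[OF c(1) q(3)] that(2)]) simp
    finally show ?thesis .
  qed
  have expand: "g q (Y q) (Z q) = (\<Sum>i\<in>UNIV. \<Sum>j\<in>UNIV. y i q * (z j q * G i j q))"
    if "q \<in> W \<inter> (fst c \<inter> points S)" for q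
    using that expandY[OF that ZW] expandZ[OF that M.coord_field_tangent[OF c(1)]]
    by (simp add: G_def sum_distrib_left)
  have my: "S.mdiff p (y i)" and ty: "tderiv S p x (y i) = tderiv S p x (\<lambda>q. Y q c) $ i" for i
    unfolding y_def
    by (rule S.mdiff_linear[OF bounded_linear_vec_nth Y], rule S.tderiv_linear[OF bounded_linear_vec_nth Y])
  have mz: "S.mdiff p (z i)" and tz: "tderiv S p x (z i) = tderiv S p x (\<lambda>q. Z q c) $ i" for i
    unfolding z_def
    by (rule S.mdiff_linear[OF bounded_linear_vec_nth Z], rule S.tderiv_linear[OF bounded_linear_vec_nth Z])
  have MG: "M.mdiff p (G i j)" for i j
    unfolding G_def by (rule M.smooth_fun_mdiff[OF M.metric_coefficient_smooth[OF c(1)] M.chart_open[OF c(1)] c(2)])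
  have mG: "S.mdiff p (G i j)" for i j
    by (rule mdiff_restrict[OF c p]) (use MG M.mdiff_chart[OF c] in blast)
  have tG: "tderiv S p x (G i j) = g p (?N i) (?d j) + g p (?d i) (?N j)" for i j
    unfolding tderiv_restrict[OF c p MG] unfolding G_def
    by (rule MC.levi_civitaD(2)[OF M.chart_open[OF c(1)] M.smooth_vfield_coord_field[OF c(1)]
          M.smooth_vfield_coord_field[OF c(1)] c(2) incl_tangent[OF p]])
  have "tderiv S p x (\<lambda>q. g q (Y q) (Z q)) = tderiv S p x (\<lambda>q. \<Sum>i\<in>UNIV. \<Sum>j\<in>UNIV. y i q * (z j q * G i j q))"
    by (rule S.tderiv_cong[OF W' expand])
  also have "\<dots> = (\<Sum>i\<in>UNIV. \<Sum>j\<in>UNIV. y i p * (z j p * tderiv S p x (G i j) + tderiv S p x (z j) * G i j p)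
      + tderiv S p x (y i) * (z j p * G i j p))"
    by (simp add: S.tderiv_sum S.mdiff_sum S.tderiv_mult S.mdiff_mult my mz mG p)
  \<comment> \<open>The terms are grouped by the field being differentiated; of the derivative of
    \<open>G\<close>, each group receives the half belonging to that field.\<close>
  also have "\<dots> = (\<Sum>i\<in>UNIV. \<Sum>j\<in>UNIV. tderiv S p x (y i) * (z j p * G i j p) + y i p * (z j p * g p (?N i) (?d j)))
      + (\<Sum>i\<in>UNIV. \<Sum>j\<in>UNIV. y i p * (tderiv S p x (z j) * G i j p) + y i p * (z j p * g p (?d i) (?N j)))"
    by (simp add: tG algebra_simps flip: sum.distrib)
  also have "(\<Sum>i\<in>UNIV. \<Sum>j\<in>UNIV. tderiv S p x (y i) * (z j p * G i j p) + y i p * (z j p * g p (?N i) (?d j))) =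
      g p (chart_covderiv c Y p x) (Z p)"
  proof -
    have "g p (chart_covderiv c Y p x) (Z p) =
        (\<Sum>i\<in>UNIV. tderiv S p x (y i) * g p (?d i) (Z p)) + (\<Sum>i\<in>UNIV. y i p * g p (?N i) (Z p))"
      unfolding chart_covderiv_def ty y_def
      by (simp only: M.g_add[OF pM M.tangent_sum[OF pM M.tangent_scale[OF pM coord_tangent]]
            M.tangent_sum[OF pM M.tangent_scale[OF pM nabla_coord_tangent]] ZW[OF W(2)]]
          M.g_sum[OF pM coord_tangent ZW[OF W(2)] finite] M.g_sum[OF pM nabla_coord_tangent ZW[OF W(2)] finite])
    then show ?thesis
      by (simp add: expandZ[OF W'(2) coord_tangent] expandZ[OF W'(2) nabla_coord_tangent] G_def
          sum_distrib_left sum.distrib)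
  qed
  also have "(\<Sum>i\<in>UNIV. \<Sum>j\<in>UNIV. y i p * (tderiv S p x (z j) * G i j p) + y i p * (z j p * g p (?d i) (?N j))) =
      g p (Y p) (chart_covderiv c Z p x)"
  proof -
    have "g p v (chart_covderiv c Z p x) =
        (\<Sum>j\<in>UNIV. tderiv S p x (z j) * g p v (?d j)) + (\<Sum>j\<in>UNIV. z j p * g p v (?N j))"
      if v: "v \<in> tangent_space M p" for v
    proof -
      have "g p v (a + b) = g p v a + g p v b" if "a \<in> tangent_space M p" "b \<in> tangent_space M p" for a b
        using M.g_lin_right[OF pM that v, of 1 1] by (simp only: scaleR_one mult_1)
      then show ?thesis
        unfolding chart_covderiv_def tz z_def
        by (simp only: M.tangent_sum[OF pM M.tangent_scale[OF pM coord_tangent]]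
              M.tangent_sum[OF pM M.tangent_scale[OF pM nabla_coord_tangent]]
            M.g_sum_right[OF pM coord_tangent v finite] M.g_sum_right[OF pM nabla_coord_tangent v finite])
    qed
    from this[OF coord_tangent] show ?thesis
      by (simp add: expandY[OF W'(2) chart_covderiv_tangent] G_def sum_distrib_left sum.distrib distrib_left)
  qed
  finally show ?thesis .
qed

text \<open>In charts the image of a tangent field is the differential of the inclusion along the
  field, the form to which the Euclidean commutator rule applies.\<close>

lemma incl_field_chart:
  assumes W: "opens S W" "p \<in> W" and X: "smooth_vfield S W X"
  obtains A where "open A" "snd (chart_at S p) p \<in> A"
    "smooth_on A (snd c \<circ> chart_inv (chart_at S p))"
    "smooth_on A (\<lambda>z. X (chart_inv (chart_at S p) z) (chart_at S p))"
    "\<And>z. z \<in> A \<Longrightarrow> ((\<lambda>q. incl_diff M S q (X q) c) \<circ> chart_inv (chart_at S p)) z =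
       fderiv (snd c \<circ> chart_inv (chart_at S p)) z (X (chart_inv (chart_at S p) z) (chart_at S p))"
proof -
  let ?d = "chart_at S p"
  have d: "?d \<in> charts S" "p \<in> fst ?d" using S.chart_at[OF p] by auto
  define A where "A = snd ?d ` (fst ?d \<inter> (W \<inter> (fst c \<inter> points S)))"
  have A: "open A"
    unfolding A_def by (rule S.chart_image_open[OF d(1) openin_Int[OF W(1) chart_restrict_open[OF c(1)]]])
  have \<phi>: "smooth_on A (snd c \<circ> chart_inv ?d)"
    by (rule smooth_on_subset[OF S.smooth_fun_chart[OF chart_restrict_smooth[OF c(1)] d(1)]]) (auto simp: A_def)
  have X': "smooth_on A (\<lambda>z. X (chart_inv ?d z) ?d)"
    by (rule smooth_on_subset[OF S.smooth_vfield_chart[OF X d(1)]]) (auto simp: A_def)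
  have eq: "((\<lambda>q. incl_diff M S q (X q) c) \<circ> chart_inv ?d) z =
      fderiv (snd c \<circ> chart_inv ?d) z (X (chart_inv ?d z) ?d)" if z: "z \<in> A" for z
  proof -
    obtain q where q: "q \<in> fst ?d" "q \<in> W" "q \<in> fst c" "q \<in> points S" "z = snd ?d q"
      using z unfolding A_def by blast
    have "(snd c \<circ> chart_inv ?d) differentiable at (snd ?d q)"
      using smooth_on_differentiable[OF \<phi> z] q(5) by simp
    from S.tderiv_chart[OF d(1) q(1) S.smooth_vfield_tangent[OF X q(2)] this] show ?thesis
      using S.chart_inv_left[OF d(1) q(1)] q(5) incl_component[OF c(1) q(3)] by simp
  qed
  show thesis
    by (rule that[OF A _ \<phi> X' eq]) (use d W c p in \<open>auto simp: A_def\<close>)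
qed

lemma incl_mdiff:
  assumes W: "opens S W" "p \<in> W" and X: "smooth_vfield S W X"
  shows "S.mdiff p (\<lambda>q. incl_diff M S q (X q) c)"
proof (rule incl_field_chart[OF assms])
  fix A
  assume A: "open A" "snd (chart_at S p) p \<in> A" and \<phi>: "smooth_on A (snd c \<circ> chart_inv (chart_at S p))"
    and X': "smooth_on A (\<lambda>z. X (chart_inv (chart_at S p) z) (chart_at S p))"
    and eq: "\<And>z. z \<in> A \<Longrightarrow> ((\<lambda>q. incl_diff M S q (X q) c) \<circ> chart_inv (chart_at S p)) z =
       fderiv (snd c \<circ> chart_inv (chart_at S p)) z (X (chart_inv (chart_at S p) z) (chart_at S p))"
  have "((\<lambda>q. incl_diff M S q (X q) c) \<circ> chart_inv (chart_at S p)) differentiable at (snd (chart_at S p) p) \<longleftrightarrow>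
      (\<lambda>z. fderiv (snd c \<circ> chart_inv (chart_at S p)) z (X (chart_inv (chart_at S p) z) (chart_at S p)))
        differentiable at (snd (chart_at S p) p)"
    by (rule differentiable_cong_open[OF A]) (rule eq)
  then show "S.mdiff p (\<lambda>q. incl_diff M S q (X q) c)"
    unfolding S.mdiff_def using differentiableI[OF fderiv_field_has_derivative[OF A \<phi> X']] by (simp only:)
qed

lemma tderiv_incl_commutator:
  assumes W: "opens S W" "p \<in> W" and X: "smooth_vfield S W X" and Y: "smooth_vfield S W Y"
  shows "tderiv S p (X p) (\<lambda>q. incl_diff M S q (Y q) c) - tderiv S p (Y p) (\<lambda>q. incl_diff M S q (X q) c)
    = incl_diff M S p (lie_bracket S X Y p) c"
proof (rule incl_field_chart[OF W X])
  let ?d = "chart_at S p"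
  let ?\<phi> = "snd c \<circ> chart_inv ?d"
  let ?z = "snd ?d p"
  let ?X = "\<lambda>z. X (chart_inv ?d z) ?d"
  let ?Y = "\<lambda>z. Y (chart_inv ?d z) ?d"
  fix A
  assume A: "open A" "?z \<in> A" and \<phi>: "smooth_on A ?\<phi>" and X': "smooth_on A ?X"
    and eqX: "\<And>z. z \<in> A \<Longrightarrow> ((\<lambda>q. incl_diff M S q (X q) c) \<circ> chart_inv ?d) z = fderiv ?\<phi> z (?X z)"
  show ?thesis
  proof (rule incl_field_chart[OF W Y])
    fix A'
    assume A': "open A'" "?z \<in> A'" and \<phi>': "smooth_on A' ?\<phi>" and Y': "smooth_on A' ?Y"
      and eqY: "\<And>z. z \<in> A' \<Longrightarrow> ((\<lambda>q. incl_diff M S q (Y q) c) \<circ> chart_inv ?d) z = fderiv ?\<phi> z (?Y z)"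
    have AA: "open (A \<inter> A')" "?z \<in> A \<inter> A'" using A A' by auto
    have d: "?d \<in> charts S" "p \<in> fst ?d" using S.chart_at[OF p] by auto
    have at: "chart_inv ?d ?z = p" by (rule S.point_of_chart_at[OF p])
    have "tderiv S p (X p) (\<lambda>q. incl_diff M S q (Y q) c) = fderiv (\<lambda>z. fderiv ?\<phi> z (?Y z)) ?z (?X ?z)"
      unfolding tderiv_def Let_def at by (simp only: fderiv_cong_open[OF A' eqY])
    moreover have "tderiv S p (Y p) (\<lambda>q. incl_diff M S q (X q) c) = fderiv (\<lambda>z. fderiv ?\<phi> z (?X z)) ?z (?Y ?z)"
      unfolding tderiv_def Let_def at by (simp only: fderiv_cong_open[OF A eqX])
    moreover have "fderiv (\<lambda>z. fderiv ?\<phi> z (?Y z)) ?z (?X ?z) - fderiv (\<lambda>z. fderiv ?\<phi> z (?X z)) ?z (?Y ?z)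
        = fderiv ?\<phi> ?z (fderiv ?Y ?z (?X ?z) - fderiv ?X ?z (?Y ?z))"
      by (rule fderiv_commutator[OF AA smooth_on_subset[OF \<phi>] smooth_on_subset[OF X'] smooth_on_subset[OF Y']]) auto
    moreover have "fderiv ?Y ?z (?X ?z) - fderiv ?X ?z (?Y ?z) = lie_bracket S X Y p ?d"
      using S.lie_bracket_chart[OF W X Y d] by (simp add: at)
    moreover have "fderiv ?\<phi> ?z (lie_bracket S X Y p ?d) = incl_diff M S p (lie_bracket S X Y p) c"
      using incl_component[OF c] by (simp add: tderiv_def Let_def)
    ultimately show ?thesis by (simp only:)
  qed
qed

text \<open>The derivative terms give the image of the bracket by
  \<open>tderiv_incl_commutator\<close>. The remaining terms are bilinear in the two vectors with
  coefficients \<open>\<Gamma>\<close> symmetric in the lower indices, so they cancel.\<close>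

lemma chart_covderiv_torsion_free:
  assumes W: "opens S W" "p \<in> W" and X: "smooth_vfield S W X" and Y: "smooth_vfield S W Y"
  shows "chart_covderiv c (\<lambda>q. incl_diff M S q (Y q)) p (X p) c - chart_covderiv c (\<lambda>q. incl_diff M S q (X q)) p (Y p) c
    = incl_diff M S p (lie_bracket S X Y p) c"
proof -
  let ?X = "incl_diff M S p (X p)"
  let ?Y = "incl_diff M S p (Y p)"
  define \<Gamma> where "\<Gamma> k j = nabla (coord_field M c k) p (coord_field M c j p) c" for k j
  have \<Gamma>: "\<Gamma> k j = \<Gamma> j k" for k j
    unfolding \<Gamma>_def by (rule MC.coord_fields_commute[OF c])
  have expand: "nabla (coord_field M c k) p v c = (\<Sum>j\<in>UNIV. (v c $ j) *\<^sub>R \<Gamma> k j)"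
    if v: "v \<in> tangent_space M p" for v k
  proof -
    have "nabla (coord_field M c k) p v = nabla (coord_field M c k) p (\<Sum>j\<in>UNIV. (v c $ j) *\<^sub>R coord_field M c j p)"
      by (subst M.tangent_coord_expansion[OF v c]) (rule refl)
    also have "\<dots> = (\<Sum>j\<in>UNIV. (v c $ j) *\<^sub>R nabla (coord_field M c k) p (coord_field M c j p))"
      by (rule MC.nabla_sum[OF M.chart_open[OF c(1)] M.smooth_vfield_coord_field[OF c(1)] c(2) coord_tangent]) auto
    finally show ?thesis
      by (simp add: sum_fun_apply scaleR_fun_def \<Gamma>_def)
  qed
  have "(\<Sum>k\<in>UNIV. (?Y c $ k) *\<^sub>R nabla (coord_field M c k) p ?X c) =
      (\<Sum>k\<in>UNIV. \<Sum>j\<in>UNIV. ((?Y c $ k) * (?X c $ j)) *\<^sub>R \<Gamma> k j)"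
    by (simp add: expand[OF incl_tangent[OF p]] scaleR_sum_right)
  also have "\<dots> = (\<Sum>j\<in>UNIV. \<Sum>k\<in>UNIV. ((?Y c $ k) * (?X c $ j)) *\<^sub>R \<Gamma> k j)"
    by (rule sum.swap)
  also have "\<dots> = (\<Sum>j\<in>UNIV. \<Sum>k\<in>UNIV. ((?X c $ j) * (?Y c $ k)) *\<^sub>R \<Gamma> j k)"
    by (intro sum.cong refl) (metis \<Gamma> mult.commute)
  also have "\<dots> = (\<Sum>k\<in>UNIV. (?X c $ k) *\<^sub>R nabla (coord_field M c k) p ?Y c)"
    by (simp add: expand[OF incl_tangent[OF p]] scaleR_sum_right)
  finally show ?thesis
    using tderiv_incl_commutator[OF W X Y] by (simp add: chart_covderiv_component)
qed

end

end

section \<open>Framed surfaces\<close>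

context smooth_mfd
begin

lemma tderiv_field_chart:
  assumes W: "opens M W" and h: "smooth_fun M W h" and X: "smooth_vfield M W X"
    and c: "c \<in> charts M" and z: "z \<in> snd c ` (fst c \<inter> W)"
  shows "((\<lambda>q. tderiv M q (X q) h) \<circ> chart_inv c) z = fderiv (h \<circ> chart_inv c) z (X (chart_inv c z) c)"
proof -
  obtain q where q: "q \<in> fst c" "q \<in> W" "z = snd c q" using z by blast
  have "(h \<circ> chart_inv c) differentiable at (snd c q)"
    using smooth_on_differentiable[OF smooth_fun_chart[OF h c] z] q(3) by simp
  from tderiv_chart[OF c q(1) smooth_vfield_tangent[OF X q(2)] this] show ?thesis
    using chart_inv_left[OF c q(1)] q(3) by simp
qed

lemma smooth_fun_tderiv:
  assumes W: "opens M W" and h: "smooth_fun M W h" and X: "smooth_vfield M W X"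
  shows "smooth_fun M W (\<lambda>q. tderiv M q (X q) h)"
  unfolding smooth_fun_def
proof
  fix c assume c: "c \<in> charts M"
  have o: "open (snd c ` (fst c \<inter> W))" by (rule chart_image_open[OF c W])
  show "smooth_on (snd c ` (fst c \<inter> W)) ((\<lambda>q. tderiv M q (X q) h) \<circ> chart_inv c)"
    by (rule smooth_on_transform[OF smooth_on_fderiv_field[OF o smooth_fun_chart[OF h c] smooth_vfield_chart[OF X c]] o])
      (rule tderiv_field_chart[OF W h X c, symmetric])
qed

lemma tderiv_commutator:
  fixes h :: "'a \<Rightarrow> 'b::banach"
  assumes W: "opens M W" "p \<in> W" and h: "smooth_fun M W h" and X: "smooth_vfield M W X" and Y: "smooth_vfield M W Y"
  shows "tderiv M p (X p) (\<lambda>q. tderiv M q (Y q) h) - tderiv M p (Y p) (\<lambda>q. tderiv M q (X q) h) =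
    tderiv M p (lie_bracket M X Y p) h"
proof -
  let ?c = "chart_at M p"
  let ?A = "snd ?c ` (fst ?c \<inter> W)"
  have p: "p \<in> points M" using openin_subset[OF W(1)] W(2) by blast
  have c: "?c \<in> charts M" "p \<in> fst ?c" using chart_at[OF p] by auto
  have A: "open ?A" "snd ?c p \<in> ?A" using chart_image_open[OF c(1) W(1)] c W by auto
  have at: "chart_inv ?c (snd ?c p) = p" by (rule point_of_chart_at[OF p])
  have 1: "tderiv M p x (\<lambda>q. tderiv M q (Z q) h) =
      fderiv (\<lambda>z. fderiv (h \<circ> chart_inv ?c) z (Z (chart_inv ?c z) ?c)) (snd ?c p) (x ?c)"
    if Z: "smooth_vfield M W Z" for Z x
  proof -
    have "fderiv ((\<lambda>q. tderiv M q (Z q) h) \<circ> chart_inv ?c) (snd ?c p) =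
        fderiv (\<lambda>z. fderiv (h \<circ> chart_inv ?c) z (Z (chart_inv ?c z) ?c)) (snd ?c p)"
      by (rule fderiv_cong_open[OF A]) (rule tderiv_field_chart[OF W(1) h Z c(1)])
    then show ?thesis by (simp add: tderiv_def Let_def o_def)
  qed
  have 2: "fderiv (\<lambda>z. Y (chart_inv ?c z) ?c) (snd ?c p) (X p ?c) - fderiv (\<lambda>z. X (chart_inv ?c z) ?c) (snd ?c p) (Y p ?c)
      = lie_bracket M X Y p ?c"
    by (rule lie_bracket_chart[OF W X Y c, symmetric])
  show ?thesis
    unfolding 1[OF X] 1[OF Y]
    using fderiv_commutator[OF A smooth_fun_chart[OF h c(1)] smooth_vfield_chart[OF X c(1)] smooth_vfield_chart[OF Y c(1)]]
    unfolding at 2 by (simp add: tderiv_def Let_def)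
qed

lemma tderiv_vec_add:
  assumes "mdiff p h"
  shows "tderiv M p (a *\<^sub>R x + b *\<^sub>R y) h = a *\<^sub>R tderiv M p x h + b *\<^sub>R tderiv M p y h"
  using linear_add[OF tderiv_vector_linear[OF assms], of "a *\<^sub>R x" "b *\<^sub>R y"]
    linear_cmul[OF tderiv_vector_linear[OF assms], of a x] linear_cmul[OF tderiv_vector_linear[OF assms], of b y]
  by (simp only:)

lemma smooth_fun_linear:
  assumes "bounded_linear L" "opens M W" "smooth_fun M W h"
  shows "smooth_fun M W (\<lambda>q. L (h q))"
  unfolding smooth_fun_def
proof
  fix c assume c: "c \<in> charts M"
  from smooth_on_linear[OF assms(1) chart_image_open[OF c assms(2)] smooth_fun_chart[OF assms(3) c]]
  show "smooth_on (snd c ` (fst c \<inter> W)) ((\<lambda>q. L (h q)) \<circ> chart_inv c)"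
    by (simp add: o_def)
qed

lemma smooth_fun_mult:
  fixes h k :: "'a \<Rightarrow> real"
  assumes "opens M W" "smooth_fun M W h" "smooth_fun M W k"
  shows "smooth_fun M W (\<lambda>q. h q * k q)"
  using smooth_fun_scaleR[OF assms] by simp

lemma smooth_fun_diff:
  assumes "opens M W" "smooth_fun M W h" "smooth_fun M W k"
  shows "smooth_fun M W (\<lambda>q. h q - k q)"
  using smooth_fun_add[OF assms(1,2) smooth_fun_linear[OF bounded_linear_minus[OF bounded_linear_ident] assms(1,3)]]
  by simp

lemma partial_deriv_tderiv:
  assumes "c \<in> charts M" "p \<in> fst c" "mdiff p h" "x \<in> tangent_space M p" "x c = axis k 1"
  shows "partial_deriv c k h p = tderiv M p x h"
proof -
  have "(h \<circ> chart_inv c) differentiable at (snd c p)"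
    using mdiff_chart[OF assms(1,2), of h] assms(3) by blast
  from tderiv_chart[OF assms(1,2,4) this] show ?thesis
    using assms(5) by (simp add: partial_deriv_def)
qed

end

text \<open>In coordinates det(Lx, Ly) is det L times det(x, y), and for eigenvectors it is also a b
  det(x, y).\<close>

lemma endo_det_eigenbasis:
  fixes M :: "('a, 2) manifold"
  assumes M: "smooth_manifold M" "p \<in> points M"
    and L: "\<And>x. x \<in> tangent_space M p \<Longrightarrow> L x \<in> tangent_space M p"
    and lin: "\<And>x y a b. x \<in> tangent_space M p \<Longrightarrow> y \<in> tangent_space M p \<Longrightarrow> L (a *\<^sub>R x + b *\<^sub>R y) = a *\<^sub>R L x + b *\<^sub>R L y"
    and x: "x \<in> tangent_space M p" "L x = a *\<^sub>R x" and y: "y \<in> tangent_space M p" "L y = b *\<^sub>R y"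
    and indep: "\<And>c. c \<in> charts M \<Longrightarrow> p \<in> fst c \<Longrightarrow> det2 (x c) (y c) \<noteq> 0"
  shows "endo_det M p L = a * b"
proof -
  interpret smooth_mfd M by unfold_locales (rule M(1))
  let ?c = "chart_at M p"
  have c: "?c \<in> charts M" "p \<in> fst ?c" using chart_at[OF M(2)] by auto
  define \<phi> where "\<phi> w = L (vec_in_chart M ?c p w) ?c" for w
  have vec: "vec_in_chart M ?c p (s *\<^sub>R v + t *\<^sub>R w) = s *\<^sub>R vec_in_chart M ?c p v + t *\<^sub>R vec_in_chart M ?c p w" for s t v w
    by (rule tangent_eqI[OF vec_in_chart_tangent[OF c] tangent_add[OF M(2) tangent_scale[OF M(2) vec_in_chart_tangent[OF c]]
            tangent_scale[OF M(2) vec_in_chart_tangent[OF c]]] c])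
      (simp add: vec_in_chart_self[OF c] scaleR_fun_def)
  have \<phi>: "\<phi> (s *\<^sub>R v + t *\<^sub>R w) = s *\<^sub>R \<phi> v + t *\<^sub>R \<phi> w" for s t v w
    unfolding \<phi>_def vec lin[OF vec_in_chart_tangent[OF c] vec_in_chart_tangent[OF c]] by (simp add: scaleR_fun_def)
  have expand: "\<phi> w = w $ 1 *\<^sub>R \<phi> (axis 1 1) + w $ 2 *\<^sub>R \<phi> (axis 2 1)" for w
    unfolding \<phi>[symmetric] by (rule arg_cong[of _ _ \<phi>]) (simp add: vec_eq_iff forall_2 axis_def)
  have ex: "\<phi> (x ?c) = a *\<^sub>R x ?c" and ey: "\<phi> (y ?c) = b *\<^sub>R y ?c"
    unfolding \<phi>_def vec_in_chart_component[OF x(1) c] vec_in_chart_component[OF y(1) c] x(2) y(2)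
    by (simp_all add: scaleR_fun_def)
  have "det2 (\<phi> (x ?c)) (\<phi> (y ?c)) = det2 (\<phi> (axis 1 1)) (\<phi> (axis 2 1)) * det2 (x ?c) (y ?c)"
    unfolding expand[of "x ?c"] expand[of "y ?c"] by (simp add: det2_def algebra_simps)
  then have "(a * b) * det2 (x ?c) (y ?c) = det2 (\<phi> (axis 1 1)) (\<phi> (axis 2 1)) * det2 (x ?c) (y ?c)"
    unfolding ex ey by (simp add: det2_def algebra_simps)
  then have "det2 (\<phi> (axis 1 1)) (\<phi> (axis 2 1)) = a * b"
    using indep[OF c] by simp
  moreover have "endo_det M p L = det (matrix \<phi>)"
    by (simp add: endo_det_def Let_def \<phi>_def[abs_def])
  ultimately show ?thesis
    by (simp add: det_2 matrix_def det2_def mult.commute)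
qed

section \<open>Orthonormal frames on a surface\<close>

locale surface = tangent_metric S gS + levi_civita_mfd S gS nablaS
  for S :: "('a, 2) manifold" and gS nablaS

locale framed_surface = surface +
  fixes U :: "'a set" and e1 e2 :: "('a, 2) vfield"
  assumes U: "opens S U" and e1: "smooth_vfield S U e1" and e2: "smooth_vfield S U e2"
    and orthonormal: "\<And>p. p \<in> U \<Longrightarrow> gS p (e1 p) (e1 p) = 1"
      "\<And>p. p \<in> U \<Longrightarrow> gS p (e2 p) (e2 p) = 1" "\<And>p. p \<in> U \<Longrightarrow> gS p (e1 p) (e2 p) = 0"
begin

lemma U_points: "p \<in> U \<Longrightarrow> p \<in> points S"
  using openin_subset[OF U] by blast

lemma e_tangent: "p \<in> U \<Longrightarrow> e1 p \<in> tangent_space S p" "p \<in> U \<Longrightarrow> e2 p \<in> tangent_space S p"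
  by (rule smooth_vfield_tangent[OF e1], assumption, rule smooth_vfield_tangent[OF e2])

lemma orthonormal': "p \<in> U \<Longrightarrow> gS p (e2 p) (e1 p) = 0"
  using g_sym[OF U_points e_tangent, of p] orthonormal(3) by simp

lemma g_frame:
  assumes "p \<in> U"
  shows "gS p (a *\<^sub>R e1 p + b *\<^sub>R e2 p) (e1 p) = a" "gS p (a *\<^sub>R e1 p + b *\<^sub>R e2 p) (e2 p) = b"
  using g_lin[OF U_points[OF assms] e_tangent(1)[OF assms] e_tangent(2)[OF assms] e_tangent(1)[OF assms], of a b]
    g_lin[OF U_points[OF assms] e_tangent(1)[OF assms] e_tangent(2)[OF assms] e_tangent(2)[OF assms], of a b]
    orthonormal[OF assms] orthonormal'[OF assms] by (simp_all only: mult_1_right mult_zero_right add_0_right add_0_left)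

lemma frame_tangent: "p \<in> U \<Longrightarrow> a *\<^sub>R e1 p + b *\<^sub>R e2 p \<in> tangent_space S p"
  by (intro tangent_add tangent_scale U_points e_tangent)

lemma frame_indep:
  assumes p: "p \<in> U" and c: "c \<in> charts S" "p \<in> fst c"
  shows "det2 (e1 p c) (e2 p c) \<noteq> 0"
proof (rule det2_nonzeroI)
  fix a b assume 0: "a *\<^sub>R e1 p c + b *\<^sub>R e2 p c = 0"
  have "a *\<^sub>R e1 p + b *\<^sub>R e2 p = 0"
    by (rule tangent_eqI[OF frame_tangent[OF p] tangent_zero[OF U_points[OF p]] c])
      (use 0 in \<open>simp add: scaleR_fun_def\<close>)
  then have "gS p 0 (e1 p) = a" "gS p 0 (e2 p) = b"
    using g_frame[OF p, of a b] by simp_all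
  then show "a = 0 \<and> b = 0"
    using g_zero[OF U_points[OF p]] e_tangent[OF p] by simp
qed

lemma frame_expansion:
  assumes p: "p \<in> U" and y: "y \<in> tangent_space S p"
  shows "y = gS p y (e1 p) *\<^sub>R e1 p + gS p y (e2 p) *\<^sub>R e2 p"
proof -
  let ?c = "chart_at S p"
  have c: "?c \<in> charts S" "p \<in> fst ?c" using chart_at[OF U_points[OF p]] by auto
  define a where "a = det2 (y ?c) (e2 p ?c) / det2 (e1 p ?c) (e2 p ?c)"
  define b where "b = det2 (e1 p ?c) (y ?c) / det2 (e1 p ?c) (e2 p ?c)"
  have "y ?c = a *\<^sub>R e1 p ?c + b *\<^sub>R e2 p ?c"
    unfolding a_def b_def by (rule det2_Cramer[OF frame_indep[OF p c]])
  then have "y = a *\<^sub>R e1 p + b *\<^sub>R e2 p"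
    by (intro tangent_eqI[OF y frame_tangent[OF p] c]) (simp add: scaleR_fun_def)
  then show ?thesis using g_frame[OF p, of a b] by simp
qed

lemma frame_eqI:
  assumes p: "p \<in> U" and "x \<in> tangent_space S p" "y \<in> tangent_space S p"
    "gS p x (e1 p) = gS p y (e1 p)" "gS p x (e2 p) = gS p y (e2 p)"
  shows "x = y"
  using frame_expansion[OF p assms(2)] frame_expansion[OF p assms(3)] assms(4,5) by simp

lemma lie_bracket_tangent:
  assumes "opens S W" "smooth_vfield S W X" "smooth_vfield S W Y" "p \<in> W"
  shows "lie_bracket S X Y p \<in> tangent_space S p"
  unfolding levi_civitaD(1)[OF assms, symmetric]
  using openin_subset[OF assms(1)] assms(4)
  by (intro tangent_diff nabla_tangent[OF assms(1)] smooth_vfield_tangent[OF assms(2)]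
      smooth_vfield_tangent[OF assms(3)] assms) auto

end

text \<open>The bracket relation is the only fact about the ambient space on which the connection,
  the adapted chart and the Gauss curvature depend; from here on the argument is intrinsic.\<close>

locale adapted_surface = framed_surface +
  fixes B :: "'a \<Rightarrow> real"
  assumes bracket: "\<And>p. p \<in> U \<Longrightarrow> lie_bracket S e1 e2 p = - (B p *\<^sub>R e2 p)"
begin

text \<open>Orthonormality makes the connection skew in the frame, leaving one unknown for each of
  the two directions. The two components of the torsion identity determine these: the one along
  \<open>e1\<close> gives 0, the one along \<open>e2\<close> gives B.\<close>

lemma nabla_frame:
  assumes p: "p \<in> U"
  shows "nablaS e1 p (e1 p) = 0" "nablaS e2 p (e1 p) = 0"
    "nablaS e1 p (e2 p) = B p *\<^sub>R e2 p" "nablaS e2 p (e2 p) = - (B p *\<^sub>R e1 p)"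
proof -
  have pS: "p \<in> points S" by (rule U_points[OF p])
  note t = e_tangent[OF p]
  have nt: "nablaS X p x \<in> tangent_space S p" if "smooth_vfield S U X" "x \<in> tangent_space S p" for X x
    by (rule nabla_tangent[OF U that(1) p that(2)])
  have const: "gS p (nablaS X p x) (Y p) + gS p (X p) (nablaS Y p x) = 0"
    if X: "smooth_vfield S U X" and Y: "smooth_vfield S U Y" and x: "x \<in> tangent_space S p"
      and c: "\<And>q. q \<in> U \<Longrightarrow> gS q (X q) (Y q) = k" for X Y x k
    using levi_civitaD(2)[OF U X Y p x] tderiv_cong[OF U p, of "\<lambda>q. gS q (X q) (Y q)" "\<lambda>q. k" x] c
    by (simp add: tderiv_const)
  have 11: "gS p (nablaS e1 p x) (e1 p) = 0" and 22: "gS p (nablaS e2 p x) (e2 p) = 0"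
    and 12: "gS p (nablaS e1 p x) (e2 p) = - gS p (nablaS e2 p x) (e1 p)" if x: "x \<in> tangent_space S p" for x
    using const[OF e1 e1 x orthonormal(1)] const[OF e2 e2 x orthonormal(2)] const[OF e1 e2 x orthonormal(3)]
      g_sym[OF pS t(1) nt[OF e1 x]] g_sym[OF pS t(2) nt[OF e2 x]] g_sym[OF pS t(1) nt[OF e2 x]] by simp_all
  have eq: "nablaS e2 p (e1 p) - nablaS e1 p (e2 p) = - (B p *\<^sub>R e2 p)"
    using levi_civitaD(1)[OF U e1 e2 p] bracket[OF p] by simp
  have "nablaS e2 p (e1 p) = 1 *\<^sub>R nablaS e1 p (e2 p) + (- B p) *\<^sub>R e2 p"
    using eq by (simp add: algebra_simps)
  then have tor: "gS p (nablaS e2 p (e1 p)) v = gS p (nablaS e1 p (e2 p)) v - B p * gS p (e2 p) v"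
    if "v \<in> tangent_space S p" for v
    using g_lin[OF pS nt[OF e1 t(2)] t(2) that, of 1 "- B p"] by simp
  have a: "gS p (nablaS e2 p (e1 p)) (e1 p) = 0"
    using tor[OF t(1)] 11[OF t(2)] orthonormal'[OF p] by simp
  have b: "gS p (nablaS e1 p (e2 p)) (e2 p) = B p"
    using tor[OF t(2)] 22[OF t(1)] orthonormal(2)[OF p] by simp
  have val: "gS p (s *\<^sub>R v) w = s * gS p v w" if "v \<in> tangent_space S p" "w \<in> tangent_space S p" for s v w
    by (rule g_scale[OF pS that])
  show "nablaS e1 p (e1 p) = 0" 
    by (rule frame_eqI[OF p nt[OF e1 t(1)] tangent_zero[OF pS]])
      (use 11[OF t(1)] 12[OF t(1)] a g_zero[OF pS] t in simp_all)
  show "nablaS e2 p (e1 p) = 0"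
    by (rule frame_eqI[OF p nt[OF e2 t(1)] tangent_zero[OF pS]])
      (use a 22[OF t(1)] g_zero[OF pS] t in simp_all)
  show "nablaS e1 p (e2 p) = B p *\<^sub>R e2 p"
    by (rule frame_eqI[OF p nt[OF e1 t(2)] tangent_scale[OF pS t(2)]])
      (use b 11[OF t(2)] orthonormal(2)[OF p] orthonormal'[OF p] val t in simp_all)
  have "nablaS e2 p (e2 p) = (- B p) *\<^sub>R e1 p"
    by (rule frame_eqI[OF p nt[OF e2 t(2)] tangent_scale[OF pS t(1)]])
      (use b 12[OF t(2)] 22[OF t(2)] orthonormal(1,3)[OF p] val[OF t(1) t(1)] val[OF t(1) t(1)] val[OF t(1) t(2)] in \<open>simp_all del: scaleR_minus_left\<close>)
  then show "nablaS e2 p (e2 p) = - (B p *\<^sub>R e1 p)" by simp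
qed

text \<open>The frame is read in some chart around p0, where the manifold bracket becomes the
  Euclidean one; \<open>frame_coordinates\<close> straightens it and \<open>new_chart\<close>
  carries the result back to the atlas.\<close>

lemma adapted_chart:
  assumes p0: "p0 \<in> U"
  obtains c a b k where "c \<in> charts S" "p0 \<in> fst c" "fst c \<subseteq> U" "snd c ` fst c = box a b"
    "smooth_fun S (fst c) k" "\<And>q. q \<in> fst c \<Longrightarrow> k q > (0::real)"
    "\<And>q. q \<in> fst c \<Longrightarrow> e1 q = coord_field S c 1 q"
    "\<And>q. q \<in> fst c \<Longrightarrow> e2 q = k q *\<^sub>R coord_field S c 2 q"
    "\<And>q. q \<in> fst c \<Longrightarrow> partial_deriv c 1 k q = - (B q * k q)"
proof -
  let ?c = "chart_at S p0"
  have c: "?c \<in> charts S" "p0 \<in> fst ?c" using chart_at[OF U_points[OF p0]] by auto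
  define A where "A = snd ?c ` (fst ?c \<inter> U)"
  define X where "X z = e1 (chart_inv ?c z) ?c" for z
  define Y where "Y z = e2 (chart_inv ?c z) ?c" for z
  have A: "open A" "snd ?c p0 \<in> A" unfolding A_def using chart_image_open[OF c(1) U] c p0 by auto
  have X: "smooth_on A X" and Y: "smooth_on A Y"
    unfolding A_def X_def Y_def by (rule smooth_vfield_chart[OF e1 c(1)], rule smooth_vfield_chart[OF e2 c(1)])
  have indep: "det2 (X z) (Y z) \<noteq> 0" if z: "z \<in> A" for z
  proof -
    obtain q where q: "q \<in> fst ?c" "q \<in> U" "z = snd ?c q" using z unfolding A_def by blast
    then show ?thesis
      using frame_indep[OF q(2) c(1) q(1)] chart_inv_left[OF c(1) q(1)] by (simp add: X_def Y_def)
  qed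
  have br: "fderiv Y z (X z) - fderiv X z (Y z) = - (B (chart_inv ?c z) *\<^sub>R Y z)" if z: "z \<in> A" for z
  proof -
    obtain q where q: "q \<in> fst ?c" "q \<in> U" "z = snd ?c q" using z unfolding A_def by blast
    have "lie_bracket S e1 e2 q ?c = fderiv Y z (X z) - fderiv X z (Y z)"
      using lie_bracket_chart[OF U q(2) e1 e2 c(1) q(1)] chart_inv_left[OF c(1) q(1)] q(3)
      by (simp add: X_def[abs_def] Y_def[abs_def])
    then show ?thesis
      using fun_cong[OF bracket[OF q(2)], of ?c] chart_inv_left[OF c(1) q(1)] q(3)
      by (simp add: Y_def scaleR_fun_def)
  qed
  show thesis
  proof (rule frame_coordinates[OF A X Y indep br])
    fix S' a b and F G :: "real^2 \<Rightarrow> real^2" and k :: "real^2 \<Rightarrow> real"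
    assume S': "open S'" "snd ?c p0 \<in> S'" "S' \<subseteq> A" and F: "smooth_on S' F" and img: "F ` S' = box a b"
      and G: "smooth_on (box a b) G" "\<And>x. x \<in> S' \<Longrightarrow> G (F x) = x"
      and FX: "\<And>x. x \<in> S' \<Longrightarrow> fderiv F x (X x) = axis 1 1"
      and FY: "\<And>x. x \<in> S' \<Longrightarrow> fderiv F x (Y x) = k x *\<^sub>R axis 2 1" and k: "\<And>x. x \<in> S' \<Longrightarrow> k x > 0"
    define c' where "c' = ({p \<in> fst ?c. snd ?c p \<in> S'}, F \<circ> snd ?c)"
    have S'c: "S' \<subseteq> snd ?c ` fst ?c" using S'(3) by (auto simp: A_def)
    have oF: "open (F ` S')" by (simp add: img open_box)
    have GF: "smooth_on (F ` S') G" using G(1) by (simp add: img)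
    note nc = new_chart[OF c(1) S'(1) S'c oF F GF G(2), folded c'_def]
    have c': "c' \<in> charts S" by (rule nc(1))
    have nc3: "x c' = fderiv F (snd ?c p) (x ?c)" if "p \<in> fst c'" "x \<in> tangent_space S p" for p x
      by (rule nc(3)[OF _ that])
    have sub: "fst c' \<subseteq> U"
    proof
      fix q assume q: "q \<in> fst c'"
      then have "snd ?c q \<in> A" "q \<in> fst ?c" using S'(3) by (auto simp: c'_def)
      then obtain r where "r \<in> fst ?c" "r \<in> U" "snd ?c q = snd ?c r" by (auto simp: A_def)
      then show "q \<in> U" using inj_onD[OF chart_inj[OF c(1)], of q r] \<open>q \<in> fst ?c\<close> by simp
    qed
    have comp: "e1 q c' = axis 1 1" "e2 q c' = k (snd ?c q) *\<^sub>R axis 2 1" and kq: "k (snd ?c q) > 0"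
      if q: "q \<in> fst c'" for q
    proof -
      have qq: "snd ?c q \<in> S'" "q \<in> fst ?c" "q \<in> U" using q sub by (auto simp: c'_def)
      have "X (snd ?c q) = e1 q ?c" "Y (snd ?c q) = e2 q ?c"
        using chart_inv_left[OF c(1) qq(2)] by (simp_all add: X_def Y_def)
      then show "e1 q c' = axis 1 1" "e2 q c' = k (snd ?c q) *\<^sub>R axis 2 1"
        using nc3[OF q e_tangent(1)[OF qq(3)]] nc3[OF q e_tangent(2)[OF qq(3)]] FX[OF qq(1)] FY[OF qq(1)]
        by simp_all
      show "k (snd ?c q) > 0" by (rule k[OF qq(1)])
    qed
    \<comment> \<open>Reading the factor off as a component of \<open>e2\<close> in the new chart
      makes its smoothness immediate.\<close>
    define \<kappa> where "\<kappa> q = e2 q c' $ 2" for q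
    have o': "opens S (fst c')" by (rule chart_open[OF c'])
    have e2': "smooth_vfield S (fst c') e2"
      by (rule smooth_vfield_subset[OF e2 sub])
    have \<kappa>eq: "\<kappa> q = k (snd ?c q)" if "q \<in> fst c'" for q
      using comp(2)[OF that] by (simp add: \<kappa>_def axis_def)
    have e2c: "e2 q c' = \<kappa> q *\<^sub>R axis 2 1" if "q \<in> fst c'" for q
      using comp(2)[OF that] \<kappa>eq[OF that] by simp
    have e2smooth: "smooth_fun S (fst c') (\<lambda>q. e2 q c')"
      using smooth_vfield_component[OF e2' c'] by simp
    have \<kappa>: "smooth_fun S (fst c') \<kappa>"
      unfolding \<kappa>_def by (rule smooth_fun_linear[OF bounded_linear_vec_nth o' e2smooth])
    show thesis
    proof (rule that[OF c' _ sub _ \<kappa>])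
      show "p0 \<in> fst c'" using S'(2) c(2) by (simp add: c'_def)
      have "snd ?c ` fst c' = S'" using S'c by (auto simp: c'_def)
      then show "snd c' ` fst c' = box a b" using img by (simp add: c'_def flip: image_image)
      fix q assume q: "q \<in> fst c'"
      have qU: "q \<in> U" and qS: "q \<in> points S" using q sub U_points by auto
      show "\<kappa> q > 0" using kq[OF q] \<kappa>eq[OF q] by simp
      show "e1 q = coord_field S c' 1 q"
        by (rule tangent_eqI[OF e_tangent(1)[OF qU] coord_field_tangent[OF c' q] c' q])
          (simp add: comp[OF q] coord_field_self[OF c' q])
      show "e2 q = \<kappa> q *\<^sub>R coord_field S c' 2 q"
        by (rule tangent_eqI[OF e_tangent(2)[OF qU] tangent_scale[OF qS coord_field_tangent[OF c' q]] c' q])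
          (simp add: e2c[OF q] coord_field_self[OF c' q] scaleR_fun_def)
      have m: "mdiff q (\<lambda>q. e2 q c')" by (rule smooth_fun_mdiff[OF e2smooth o' q])
      \<comment> \<open>\<open>e1\<close> has constant components in the new chart, so only the
        derivative of \<open>e2\<close> survives in the bracket.\<close>
      have "lie_bracket S e1 e2 q c' = tderiv S q (e1 q) (\<lambda>r. e2 r c') - tderiv S q (e2 q) (\<lambda>r. e1 r c')"
        using c' q by (simp add: lie_bracket_def)
      also have "tderiv S q (e2 q) (\<lambda>r. e1 r c') = 0"
        using tderiv_cong[OF o' q, of "\<lambda>r. e1 r c'" "\<lambda>r. axis 1 1" "e2 q"] comp(1) by (simp add: tderiv_const)
      finally have "tderiv S q (e1 q) (\<lambda>r. e2 r c') = - (B q *\<^sub>R e2 q c')"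
        using fun_cong[OF bracket[OF qU], of c'] by (simp add: scaleR_fun_def)
      then have "tderiv S q (e1 q) (\<lambda>r. e2 r c') $ 2 = - (B q * \<kappa> q)"
        by (simp add: \<kappa>_def)
      then have "tderiv S q (e1 q) \<kappa> = - (B q * \<kappa> q)"
        unfolding \<kappa>_def[abs_def] using tderiv_linear[OF bounded_linear_vec_nth m] by simp
      then show "partial_deriv c' 1 \<kappa> q = - (B q * \<kappa> q)"
        using partial_deriv_tderiv[OF c' q smooth_fun_mdiff[OF \<kappa> o' q] e_tangent(1)[OF qU] comp(1)[OF q]] by simp
    qed
  qed
qed

end

text \<open>The output of \<open>adapted_chart\<close> as a context. The box makes lines of constant
  v intervals, and \<open>nonempty\<close> supplies a reference value of u.\<close>

locale adapted_coordinates = adapted_surface +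
  fixes c :: "('a, 2) chart" and a b :: "real^2" and k :: "'a \<Rightarrow> real"
  assumes c: "c \<in> charts S" and cU: "fst c \<subseteq> U" and image: "snd c ` fst c = box a b"
    and nonempty: "fst c \<noteq> {}"
    and k: "smooth_fun S (fst c) k" and k_pos: "\<And>q. q \<in> fst c \<Longrightarrow> k q > 0"
    and e1_coord: "\<And>q. q \<in> fst c \<Longrightarrow> e1 q = coord_field S c 1 q"
    and e2_coord: "\<And>q. q \<in> fst c \<Longrightarrow> e2 q = k q *\<^sub>R coord_field S c 2 q"
    and k_u: "\<And>q. q \<in> fst c \<Longrightarrow> partial_deriv c 1 k q = - (B q * k q)"
begin

lemma c_open: "opens S (fst c)"
  by (rule chart_open[OF c])

lemma c_U: "q \<in> fst c \<Longrightarrow> q \<in> U"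
  using cU by blast

lemma e1_component: "q \<in> fst c \<Longrightarrow> e1 q c = axis 1 1"
  using e1_coord coord_field_self[OF c] by simp

lemma smooth_on_chart: "smooth_fun S (fst c) h \<Longrightarrow> smooth_on (box a b) (h \<circ> chart_inv c)"
  using smooth_fun_chart[OF _ c, of "fst c" h] image by simp

lemma smooth_from_chart: "smooth_on (box a b) (h \<circ> chart_inv c) \<Longrightarrow> smooth_fun S (fst c) h"
  by (rule smooth_funI[OF c c_open order_refl]) (simp add: image)

lemma mem_box: "q \<in> fst c \<Longrightarrow> snd c q \<in> box a b"
  using image by blast

lemma k_derivative: "q \<in> fst c \<Longrightarrow> fderiv (k \<circ> chart_inv c) (snd c q) (axis 1 1) = - (B q * k q)"
  using k_u by (simp add: partial_deriv_def)

lemma k_chart_pos: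
  assumes "z \<in> box a b"
  shows "(k \<circ> chart_inv c) z > 0"
proof -
  obtain q where "q \<in> fst c" "z = snd c q" using assms image by blast
  then show ?thesis using chart_inv_left[OF c] k_pos by simp
qed

text \<open>The logarithmic u-derivative of k is - B, and positivity of k makes the logarithm
  smooth.\<close>

lemma antiderivative_exists: "antiderivative_u S c B (\<lambda>q. - ln (k q))"
  unfolding antiderivative_u_def
proof (intro conjI ballI)
  have sk: "smooth_on (box a b) (k \<circ> chart_inv c)" by (rule smooth_on_chart[OF k])
  note pos = k_chart_pos
  have "smooth_on (box a b) (\<lambda>z. - ln ((k \<circ> chart_inv c) z))"
    by (intro smooth_on_minus smooth_on_ln open_box sk pos)
  then show "smooth_fun S (fst c) (\<lambda>q. - ln (k q))"
    by (intro smooth_from_chart) (simp add: o_def)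
  fix q assume q: "q \<in> fst c"
  note D = smooth_on_has_derivative[OF sk mem_box[OF q]]
  have "((\<lambda>z. - ln ((k \<circ> chart_inv c) z)) has_derivative
      (\<lambda>w. - (fderiv (k \<circ> chart_inv c) (snd c q) w * inverse ((k \<circ> chart_inv c) (snd c q))))) (at (snd c q))"
    using pos[OF mem_box[OF q]] by (intro has_derivative_minus has_derivative_ln D)
  then show "partial_deriv c 1 (\<lambda>q. - ln (k q)) q = B q"
    using k_pos[OF q] chart_inv_left[OF c q] k_derivative[OF q]
    by (simp add: partial_deriv_def o_def fderiv_at)
qed

text \<open>In \<psi> = k exp G the u-derivatives of the two factors cancel, so \<psi> depends on v
  alone; \<open>P\<close> is its reciprocal on one line u = u0. Restricting to that line also makes
  \<open>P\<close> smooth in v.\<close>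

lemma antiderivative_scale:
  assumes G: "antiderivative_u S c B G"
  obtains P :: "real \<Rightarrow> real" where "smooth_on ((\<lambda>q. snd c q $ 2) ` fst c) P"
    "\<And>q. q \<in> fst c \<Longrightarrow> P (snd c q $ 2) * exp (G q) = inverse (k q)"
    "\<And>q. q \<in> fst c \<Longrightarrow> P (snd c q $ 2) > 0"
proof -
  define \<psi> where "\<psi> z = (k \<circ> chart_inv c) z * exp ((G \<circ> chart_inv c) z)" for z
  have sk: "smooth_on (box a b) (k \<circ> chart_inv c)" by (rule smooth_on_chart[OF k])
  have sG: "smooth_on (box a b) (G \<circ> chart_inv c)"
    using G unfolding antiderivative_u_def by (intro smooth_on_chart) blast
  have s\<psi>: "smooth_on (box a b) \<psi>"
    unfolding \<psi>_def by (intro smooth_on_mult smooth_on_exp open_box sk sG)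
  have \<psi>: "\<psi> (snd c q) = k q * exp (G q)" if "q \<in> fst c" for q
    using chart_inv_left[OF c that] by (simp add: \<psi>_def)
  have zero: "fderiv \<psi> z (axis 1 1) = 0" if z: "z \<in> box a b" for z
  proof -
    obtain q where q: "q \<in> fst c" "z = snd c q" using z image by blast
    have Gu: "fderiv (G \<circ> chart_inv c) z (axis 1 1) = B q"
      using G q unfolding antiderivative_u_def partial_deriv_def by blast
    have "(\<psi> has_derivative (\<lambda>w. (k \<circ> chart_inv c) z * (fderiv (G \<circ> chart_inv c) z w * exp ((G \<circ> chart_inv c) z))
        + fderiv (k \<circ> chart_inv c) z w * exp ((G \<circ> chart_inv c) z))) (at z)"
      unfolding \<psi>_def
      by (rule has_derivative_eq_rhs[OF has_derivative_mult[OF smooth_on_has_derivative[OF sk z]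
            has_derivative_exp[OF smooth_on_has_derivative[OF sG z]]]]) (simp add: mult_ac)
    then show ?thesis
      using Gu k_derivative[OF q(1)] chart_inv_left[OF c q(1)] q(2) by (simp add: fderiv_at algebra_simps)
  qed
  \<comment> \<open>Any point of the chart serves: the line u = u0 through it crosses every line of
    constant v in the box.\<close>
  obtain q0 where q0: "q0 \<in> fst c" using nonempty by blast
  define u0 where "u0 = snd c q0 $ 1"
  define \<gamma> where "\<gamma> v = u0 *\<^sub>R axis 1 1 + v *\<^sub>R (axis 2 1 :: real^2)" for v
  have \<gamma>c: "\<gamma> v $ 1 = u0" "\<gamma> v $ 2 = v" for v by (simp_all add: \<gamma>_def axis_def)
  have u0: "a $ 1 < u0" "u0 < b $ 1"
    using mem_box[OF q0] by (auto simp: u0_def mem_box_cart)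
  have \<gamma>_box: "\<gamma> v \<in> box a b \<longleftrightarrow> a $ 2 < v \<and> v < b $ 2" for v
    using u0 by (auto simp: mem_box_cart forall_2 \<gamma>c)
  have I: "(\<lambda>q. snd c q $ 2) ` fst c = {a $ 2<..<b $ 2}"
  proof
    show "(\<lambda>q. snd c q $ 2) ` fst c \<subseteq> {a $ 2<..<b $ 2}"
      using mem_box by (auto simp: mem_box_cart)
    show "{a $ 2<..<b $ 2} \<subseteq> (\<lambda>q. snd c q $ 2) ` fst c"
    proof
      fix v assume "v \<in> {a $ 2<..<b $ 2}"
      then have "\<gamma> v \<in> snd c ` fst c" using \<gamma>_box image by auto
      then obtain q where "q \<in> fst c" "\<gamma> v = snd c q" by blast
      then show "v \<in> (\<lambda>q. snd c q $ 2) ` fst c" using \<gamma>c(2)[of v] by force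
    qed
  qed
  \<comment> \<open>\<open>J\<close> is the range of u - u0 over the box. It is an interval
    containing 0 and the offset of q, so a vanishing derivative makes the two values of \<psi>
    equal.\<close>
  have const: "\<psi> (snd c q) = \<psi> (\<gamma> (snd c q $ 2))" if q: "q \<in> fst c" for q
  proof -
    define z where "z = snd c q"
    define J where "J = {a $ 1 - u0<..<b $ 1 - u0}"
    have z: "z \<in> box a b" using mem_box[OF q] by (simp add: z_def)
    have line: "\<gamma> (z $ 2) + t *\<^sub>R axis 1 1 \<in> box a b" if "t \<in> J" for t
      using z that by (auto simp: J_def mem_box_cart forall_2 \<gamma>c axis_def)
    have "((\<lambda>t. \<psi> (\<gamma> (z $ 2) + t *\<^sub>R axis 1 1)) has_vector_derivative 0) (at t within J)" if "t \<in> J" for t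
      using has_derivative_along_line[OF smooth_on_has_derivative[OF s\<psi> line[OF that]], of J] zero[OF line[OF that]]
      by simp
    then obtain d where d: "\<And>t. t \<in> J \<Longrightarrow> \<psi> (\<gamma> (z $ 2) + t *\<^sub>R axis 1 1) = d"
      using has_vector_derivative_zero_constant[of J "\<lambda>t. \<psi> (\<gamma> (z $ 2) + t *\<^sub>R axis 1 1)"] by (auto simp: J_def)
    have "0 \<in> J" "z $ 1 - u0 \<in> J" using u0 z by (auto simp: J_def mem_box_cart)
    moreover have "\<gamma> (z $ 2) + (z $ 1 - u0) *\<^sub>R axis 1 1 = z"
      by (simp add: vec_eq_iff forall_2 \<gamma>c axis_def)
    ultimately have "\<psi> z = \<psi> (\<gamma> (z $ 2))" using d[of 0] d[of "z $ 1 - u0"] by simp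
    then show ?thesis by (simp add: z_def)
  qed
  define P where "P v = inverse (\<psi> (\<gamma> v))" for v
  have pos: "\<psi> z > 0" if z: "z \<in> box a b" for z
  proof -
    obtain q where q: "q \<in> fst c" "z = snd c q" using z image by blast
    then show ?thesis using \<psi>[OF q(1)] k_pos[OF q(1)] by simp
  qed
  have o: "open {a $ 2<..<b $ 2}" by simp
  have "smooth_on {a $ 2<..<b $ 2} \<gamma>"
    unfolding \<gamma>_def by (intro smooth_on_add smooth_on_scaleR smooth_on_const smooth_on_id o)
  moreover have "\<gamma> ` {a $ 2<..<b $ 2} \<subseteq> box a b"
    by (rule image_subsetI) (simp only: \<gamma>_box greaterThanLessThan_iff)
  ultimately have "smooth_on {a $ 2<..<b $ 2} (\<lambda>v. \<psi> (\<gamma> v))"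
    by (intro smooth_on_compose[OF o open_box[of a b] _ _ s\<psi>])
  then have "smooth_on {a $ 2<..<b $ 2} P"
    unfolding P_def
  proof (rule smooth_on_inverse[OF o])
    fix v assume "v \<in> {a $ 2<..<b $ 2}"
    then have "\<gamma> v \<in> box a b" by (simp only: \<gamma>_box greaterThanLessThan_iff)
    then show "\<psi> (\<gamma> v) \<noteq> 0" using pos by fastforce
  qed
  moreover have "P (snd c q $ 2) * exp (G q) = inverse (k q)" "P (snd c q $ 2) > 0" if q: "q \<in> fst c" for q
    using const[OF q] \<psi>[OF q] k_pos[OF q] pos[OF mem_box[OF q]] by (simp_all add: P_def field_simps)
  ultimately show thesis
    unfolding I[symmetric] by (rule that)
qed

lemma coord_expansion:
  assumes "q \<in> fst c" "x \<in> tangent_space S q"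
  shows "x = (x c $ 1) *\<^sub>R e1 q + (x c $ 2 / k q) *\<^sub>R e2 q"
  using tangent_coord_expansion[OF assms(2) c assms(1)] e1_coord[OF assms(1)] e2_coord[OF assms(1)] k_pos[OF assms(1)]
  by (simp add: sum_2)

lemma g_frame_combination:
  assumes p: "p \<in> U"
  shows "gS p (x1 *\<^sub>R e1 p + x2 *\<^sub>R e2 p) (y1 *\<^sub>R e1 p + y2 *\<^sub>R e2 p) = x1 * y1 + x2 * y2"
  using g_lin_right[OF U_points[OF p] e_tangent(1)[OF p] e_tangent(2)[OF p] frame_tangent[OF p], of x1 x2 y1 y2]
    g_frame[OF p, of x1 x2] by (simp add: mult.commute)

lemma metric_coordinates:
  assumes q: "q \<in> fst c" and x: "x \<in> tangent_space S q" and y: "y \<in> tangent_space S q"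
  shows "gS q x y = x c $ 1 * y c $ 1 + (inverse (k q))\<^sup>2 * (x c $ 2 * y c $ 2)"
proof -
  have "gS q x y = gS q ((x c $ 1) *\<^sub>R e1 q + (x c $ 2 / k q) *\<^sub>R e2 q) ((y c $ 1) *\<^sub>R e1 q + (y c $ 2 / k q) *\<^sub>R e2 q)"
    using coord_expansion[OF q x] coord_expansion[OF q y] by simp
  also have "\<dots> = (x c $ 1) * (y c $ 1) + (x c $ 2 / k q) * (y c $ 2 / k q)"
    by (rule g_frame_combination[OF c_U[OF q]])
  finally show ?thesis by (simp add: power2_eq_square divide_inverse mult_ac)
qed

text \<open>The function \<open>h = 1 / k\<close>, the length of \<open>\<partial>\<^sub>v\<close>, satisfies \<open>h\<^sub>u = B h\<close>. The connection form of the frame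
  is \<open>h\<^sub>u dv\<close>, so its curvature form is \<open>h\<^sub>u\<^sub>u du dv\<close>.\<close>

definition hu :: "'a \<Rightarrow> real" where
  "hu q = - fderiv (k \<circ> chart_inv c) (snd c q) (axis 1 1) / (k q)\<^sup>2"

lemma hu_eq: "q \<in> fst c \<Longrightarrow> hu q = B q / k q"
  using k_derivative k_pos[of q] by (simp add: hu_def power2_eq_square)

text \<open>The formula for \<open>hu\<close> involves only the smooth function k and its
  u-derivative. The form B / k of \<open>hu_eq\<close> would not show smoothness, since
  \<open>B\<close> is prescribed only through its pointwise values.\<close>

lemma hu_smooth: "smooth_fun S (fst c) hu"
proof (rule smooth_from_chart, rule smooth_on_transform[OF _ open_box])
  have sk: "smooth_on (box a b) (k \<circ> chart_inv c)" by (rule smooth_on_chart[OF k])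
  have pos: "(k \<circ> chart_inv c) z \<noteq> 0" if "z \<in> box a b" for z
    using k_chart_pos[OF that] by simp
  show "smooth_on (box a b) (\<lambda>z. - fderiv (k \<circ> chart_inv c) z (axis 1 1) / ((k \<circ> chart_inv c) z * (k \<circ> chart_inv c) z))"
    by (intro smooth_on_divide smooth_on_minus smooth_on_mult smooth_on_fderiv open_box sk) (simp add: pos[unfolded comp_apply])
  fix z assume "z \<in> box a b"
  then obtain q where "q \<in> fst c" "z = snd c q" using image by blast
  then show "- fderiv (k \<circ> chart_inv c) z (axis 1 1) / ((k \<circ> chart_inv c) z * (k \<circ> chart_inv c) z) = (hu \<circ> chart_inv c) z"
    using chart_inv_left[OF c] by (simp add: hu_def power2_eq_square)
qed

text \<open>In the chart B = hu k, which shows that B is differentiable there, and the product rule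
  gives B_u = hu_u k + hu k_u, where hu k_u = - B^2.\<close>

lemma hu_u:
  assumes q: "q \<in> fst c"
  shows "tderiv S q (coord_field S c 1 q) hu * k q = partial_deriv c 1 B q + (B q)\<^sup>2"
proof -
  have sk: "smooth_on (box a b) (k \<circ> chart_inv c)" by (rule smooth_on_chart[OF k])
  have sh: "smooth_on (box a b) (hu \<circ> chart_inv c)" by (rule smooth_on_chart[OF hu_smooth])
  note z = mem_box[OF q]
  have "((\<lambda>z. (hu \<circ> chart_inv c) z * (k \<circ> chart_inv c) z) has_derivative
      (\<lambda>w. (hu \<circ> chart_inv c) (snd c q) * fderiv (k \<circ> chart_inv c) (snd c q) w
        + fderiv (hu \<circ> chart_inv c) (snd c q) w * (k \<circ> chart_inv c) (snd c q))) (at (snd c q))"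
    by (rule has_derivative_mult[OF smooth_on_has_derivative[OF sh z] smooth_on_has_derivative[OF sk z]])
  then have "(B \<circ> chart_inv c has_derivative
      (\<lambda>w. (hu \<circ> chart_inv c) (snd c q) * fderiv (k \<circ> chart_inv c) (snd c q) w
        + fderiv (hu \<circ> chart_inv c) (snd c q) w * (k \<circ> chart_inv c) (snd c q))) (at (snd c q))"
  proof (rule has_derivative_transform_within_open[OF _ open_box z])
    fix z assume "z \<in> box a b"
    then obtain r where r: "r \<in> fst c" "z = snd c r" using image by blast
    then show "(hu \<circ> chart_inv c) z * (k \<circ> chart_inv c) z = (B \<circ> chart_inv c) z"
      using chart_inv_left[OF c r(1)] hu_eq[OF r(1)] k_pos[OF r(1)] by simp
  qed
  then have "partial_deriv c 1 B q = hu q * (- (B q * k q)) + fderiv (hu \<circ> chart_inv c) (snd c q) (axis 1 1) * k q"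
    using k_derivative[OF q] chart_inv_left[OF c q] by (simp add: partial_deriv_def fderiv_at)
  moreover have "fderiv (hu \<circ> chart_inv c) (snd c q) (axis 1 1) = tderiv S q (coord_field S c 1 q) hu"
    using partial_deriv_tderiv[OF c q smooth_fun_mdiff[OF hu_smooth c_open q] coord_field_tangent[OF c q] coord_field_self[OF c q]]
    by (simp add: partial_deriv_def)
  ultimately show ?thesis
    using hu_eq[OF q] k_pos[OF q] by (simp add: power2_eq_square)
qed

lemma smooth_k_inverse: "smooth_fun S (fst c) (\<lambda>q. inverse (k q))"
proof (rule smooth_from_chart)
  have "smooth_on (box a b) (\<lambda>z. inverse ((k \<circ> chart_inv c) z))"
  proof (rule smooth_on_inverse[OF open_box smooth_on_chart[OF k]])
    fix z assume "z \<in> box a b"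
    then obtain r where r: "r \<in> fst c" "z = snd c r" using image by blast
    then show "(k \<circ> chart_inv c) z \<noteq> 0" using chart_inv_left[OF c r(1)] k_pos[OF r(1)] by simp
  qed
  then show "smooth_on (box a b) ((\<lambda>q. inverse (k q)) \<circ> chart_inv c)" by (simp add: o_def)
qed

text \<open>Only the \<open>e2\<close> part of z contributes. Its coefficient is the v-component
  divided by k, and B / k = hu, so the connection form is hu dv.\<close>

lemma nabla_frame_direction:
  assumes q: "q \<in> fst c" and z: "z \<in> tangent_space S q"
  shows "nablaS e1 q z = (hu q * z c $ 2) *\<^sub>R e2 q" "nablaS e2 q z = (- (hu q * z c $ 2)) *\<^sub>R e1 q"
proof -
  note t = e_tangent[OF c_U[OF q]]
  have e: "z = (z c $ 1) *\<^sub>R e1 q + (z c $ 2 / k q) *\<^sub>R e2 q"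
    by (rule coord_expansion[OF q z])
  have "nablaS e1 q z = nablaS e1 q ((z c $ 1) *\<^sub>R e1 q + (z c $ 2 / k q) *\<^sub>R e2 q)"
    using e by (rule arg_cong)
  also have "\<dots> = (z c $ 1) *\<^sub>R nablaS e1 q (e1 q) + (z c $ 2 / k q) *\<^sub>R nablaS e1 q (e2 q)"
    by (rule nabla_lin[OF U e1 c_U[OF q] t])
  finally show "nablaS e1 q z = (hu q * z c $ 2) *\<^sub>R e2 q"
    using nabla_frame[OF c_U[OF q]] hu_eq[OF q] by (simp add: mult.commute)
  have "nablaS e2 q z = nablaS e2 q ((z c $ 1) *\<^sub>R e1 q + (z c $ 2 / k q) *\<^sub>R e2 q)"
    using e by (rule arg_cong)
  also have "\<dots> = (z c $ 1) *\<^sub>R nablaS e2 q (e1 q) + (z c $ 2 / k q) *\<^sub>R nablaS e2 q (e2 q)"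
    by (rule nabla_lin[OF U e2 c_U[OF q] t])
  finally show "nablaS e2 q z = (- (hu q * z c $ 2)) *\<^sub>R e1 q"
    using nabla_frame[OF c_U[OF q]] hu_eq[OF q] by (simp add: mult.commute)
qed

text \<open>Leibniz rule combined with the connection form. General coefficients are allowed so that
  the rule can be applied again to a first covariant derivative.\<close>

lemma nabla_combination:
  assumes W: "opens S W" "W \<subseteq> fst c" "q \<in> W" and \<alpha>: "smooth_fun S W \<alpha>" and \<beta>: "smooth_fun S W \<beta>"
    and Y: "smooth_vfield S W Y" "\<And>r. r \<in> W \<Longrightarrow> Y r = \<alpha> r *\<^sub>R e1 r + \<beta> r *\<^sub>R e2 r"
    and z: "z \<in> tangent_space S q"
  shows "nablaS Y q z = (tderiv S q z \<alpha> - hu q * z c $ 2 * \<beta> q) *\<^sub>R e1 q + (tderiv S q z \<beta> + hu q * z c $ 2 * \<alpha> q) *\<^sub>R e2 q"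
proof -
  have q: "q \<in> fst c" using W by blast
  have e1': "smooth_vfield S W e1" and e2': "smooth_vfield S W e2"
    by (rule smooth_vfield_subset[OF e1], use W cU in blast, rule smooth_vfield_subset[OF e2], use W cU in blast)
  note s1 = smooth_vfield_scale[OF W(1) \<alpha> e1'] and s2 = smooth_vfield_scale[OF W(1) \<beta> e2']
  have "nablaS Y q z = nablaS (\<lambda>r. \<alpha> r *\<^sub>R e1 r + \<beta> r *\<^sub>R e2 r) q z"
    by (rule nabla_cong[OF W(1) smooth_vfield_add[OF W(1) s1 s2] Y(1) Y(2) W(3) z])
  also have "\<dots> = nablaS (\<lambda>r. \<alpha> r *\<^sub>R e1 r) q z + nablaS (\<lambda>r. \<beta> r *\<^sub>R e2 r) q z"
    by (rule nabla_add[OF W(1) s1 s2 W(3) z])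
  also have "\<dots> = (tderiv S q z \<alpha> *\<^sub>R e1 q + \<alpha> q *\<^sub>R nablaS e1 q z) + (tderiv S q z \<beta> *\<^sub>R e2 q + \<beta> q *\<^sub>R nablaS e2 q z)"
    by (simp only: nabla_scale[OF W(1) e1' \<alpha> W(3) z] nabla_scale[OF W(1) e2' \<beta> W(3) z])
  also have "\<dots> = (tderiv S q z \<alpha> - hu q * z c $ 2 * \<beta> q) *\<^sub>R e1 q + (tderiv S q z \<beta> + hu q * z c $ 2 * \<alpha> q) *\<^sub>R e2 q"
    unfolding nabla_frame_direction[OF q z] by (simp add: algebra_simps)
  finally show ?thesis .
qed

text \<open>For \<omega> = hu dv one has R(X, Y)Y = d\<omega>(X, Y) (\<alpha> e2 - \<beta> e1),
  where \<alpha> and \<beta> are the frame coefficients of Y, and d\<omega>(X, Y) = huu \<Delta>.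
  Pairing with X gives - huu \<Delta>^2 / k.\<close>

lemma curvature_value:
  assumes W: "opens S W" "q \<in> W" "q \<in> fst c" and X: "smooth_vfield S W X" and Y: "smooth_vfield S W Y"
    and indep: "\<And>a b. a *\<^sub>R X q + b *\<^sub>R Y q = 0 \<Longrightarrow> a = 0 \<and> b = 0"
  shows "gS q (riemann_curvature S nablaS X Y Y q) (X q) /
           (gS q (X q) (X q) * gS q (Y q) (Y q) - (gS q (X q) (Y q))\<^sup>2) = - (partial_deriv c 1 B q + (B q)\<^sup>2)"
proof -
  define V where "V = W \<inter> fst c"
  have V: "opens S V" "q \<in> V" "V \<subseteq> fst c" "V \<subseteq> W"
    using W c_open by (auto simp: V_def)
  have qS: "q \<in> points S" and qU: "q \<in> U" using c_U[OF W(3)] U_points by auto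
  note X' = smooth_vfield_subset[OF X V(4)] and Y' = smooth_vfield_subset[OF Y V(4)]
  have comp: "smooth_fun S V (\<lambda>r. Z r c $ i)" if "smooth_vfield S V Z" for Z i
  proof -
    have "smooth_fun S V (\<lambda>r. Z r c)"
      using smooth_vfield_component[OF that c] V(3) by (simp add: inf.absorb2)
    then show ?thesis by (rule smooth_fun_linear[OF bounded_linear_vec_nth V(1)])
  qed
  have kV: "smooth_fun S V (\<lambda>r. inverse (k r))" and huV: "smooth_fun S V hu"
    by (rule smooth_fun_subset[OF smooth_k_inverse V(3)], rule smooth_fun_subset[OF hu_smooth V(3)])
  define \<alpha> where "\<alpha> r = Y r c $ 1" for r
  define \<beta> where "\<beta> r = inverse (k r) * Y r c $ 2" for r
  define x2 where "x2 r = X r c $ 2" for r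
  define y2 where "y2 r = Y r c $ 2" for r
  have x2_eq: "x2 = (\<lambda>r. X r c $ 2)" and y2_eq: "y2 = (\<lambda>r. Y r c $ 2)"
    by (rule ext, rule x2_def, rule ext, rule y2_def)
  have s\<alpha>: "smooth_fun S V \<alpha>" and s\<beta>: "smooth_fun S V \<beta>"
    unfolding \<alpha>_def \<beta>_def by (intro smooth_fun_mult comp V kV X' Y')+
  have Yeq: "Y r = \<alpha> r *\<^sub>R e1 r + \<beta> r *\<^sub>R e2 r" if "r \<in> V" for r
  proof -
    have "r \<in> fst c" using that V(3) by blast
    from coord_expansion[OF this smooth_vfield_tangent[OF Y' that]] show ?thesis
      by (simp only: \<alpha>_def \<beta>_def divide_inverse mult.commute)
  qed
  \<comment> \<open>\<open>A Z\<close> and \<open>C Z\<close> are the components along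
    \<open>e1\<close> and \<open>e2\<close> of the covariant derivative of Y along Z, kept as
    functions in order to differentiate once more.\<close>
  define A where "A Z r = tderiv S r (Z r) \<alpha> - (hu r * Z r c $ 2) * \<beta> r" for Z r
  define C where "C Z r = tderiv S r (Z r) \<beta> + (hu r * Z r c $ 2) * \<alpha> r" for Z r
  have nab: "nablaS Y r z = (tderiv S r z \<alpha> - hu r * z c $ 2 * \<beta> r) *\<^sub>R e1 r + (tderiv S r z \<beta> + hu r * z c $ 2 * \<alpha> r) *\<^sub>R e2 r"
    if "r \<in> V" "z \<in> tangent_space S r" for r z
    by (rule nabla_combination[OF V(1,3) that(1) s\<alpha> s\<beta> Y' Yeq that(2)])
  have sA: "smooth_fun S V (A Z)" and sC: "smooth_fun S V (C Z)" if "smooth_vfield S V Z" for Z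
    unfolding A_def C_def
    by (intro smooth_fun_diff smooth_fun_add smooth_fun_mult smooth_fun_tderiv comp V s\<alpha> s\<beta> huV that)+
  have nab2: "nablaS (\<lambda>r. nablaS Y r (Z r)) q z =
      (tderiv S q z (A Z) - hu q * z c $ 2 * C Z q) *\<^sub>R e1 q + (tderiv S q z (C Z) + hu q * z c $ 2 * A Z q) *\<^sub>R e2 q"
    if Z: "smooth_vfield S V Z" and z: "z \<in> tangent_space S q" for Z z
    by (rule nabla_combination[OF V(1,3,2) sA[OF Z] sC[OF Z] nabla_smooth[OF V(1) Y' Z] _ z])
      (simp add: nab smooth_vfield_tangent[OF Z] A_def C_def)
  note tX = smooth_vfield_tangent[OF X' V(2)] and tY = smooth_vfield_tangent[OF Y' V(2)]
  note tL = lie_bracket_tangent[OF V(1) X' Y' V(2)]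
  note m = smooth_fun_mdiff[OF _ V(1,2)]
  \<comment> \<open>One rule serves both components: \<open>C\<close> is the case \<phi> = \<beta>,
    \<psi> = \<alpha>, and \<open>A\<close> the case \<phi> = \<alpha>, \<psi> = - \<beta>.\<close>
  have dcoef: "tderiv S q v (\<lambda>r. tderiv S r (Z r) \<phi> + (hu r * z2 r) * \<psi> r) = tderiv S q v (\<lambda>r. tderiv S r (Z r) \<phi>)
      + ((hu q * z2 q) * tderiv S q v \<psi> + (hu q * tderiv S q v z2 + tderiv S q v hu * z2 q) * \<psi> q)"
    if Z: "smooth_vfield S V Z" and z2: "z2 = (\<lambda>r. Z r c $ 2)" and \<phi>: "smooth_fun S V \<phi>" and \<psi>: "smooth_fun S V \<psi>"
    for v Z z2 \<phi> \<psi>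
  proof -
    have "tderiv S q v (\<lambda>r. tderiv S r (Z r) \<phi> + (hu r * z2 r) * \<psi> r) =
        tderiv S q v (\<lambda>r. tderiv S r (Z r) \<phi>) + tderiv S q v (\<lambda>r. (hu r * z2 r) * \<psi> r)"
      unfolding z2 by (intro tderiv_add m smooth_fun_tderiv smooth_fun_mult comp V \<phi> \<psi> huV Z)
    also have "tderiv S q v (\<lambda>r. (hu r * z2 r) * \<psi> r) = (hu q * z2 q) * tderiv S q v \<psi> + tderiv S q v (\<lambda>r. hu r * z2 r) * \<psi> q"
      unfolding z2 by (intro tderiv_mult qS m smooth_fun_mult comp V \<psi> huV Z)
    also have "tderiv S q v (\<lambda>r. hu r * z2 r) = hu q * tderiv S q v z2 + tderiv S q v hu * z2 q"
      unfolding z2 by (intro tderiv_mult qS m comp huV Z)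
    finally show ?thesis .
  qed
  have neg: "smooth_fun S V (\<lambda>r. - \<beta> r)" "tderiv S q v (\<lambda>r. - \<beta> r) = - tderiv S q v \<beta>" for v
    using smooth_fun_linear[OF bounded_linear_minus[OF bounded_linear_ident] V(1) s\<beta>]
      tderiv_linear[OF bounded_linear_minus[OF bounded_linear_ident] m[OF s\<beta>], of v] by simp_all
  have dA: "tderiv S q v (A Z) = tderiv S q v (\<lambda>r. tderiv S r (Z r) \<alpha>)
      - ((hu q * z2 q) * tderiv S q v \<beta> + (hu q * tderiv S q v z2 + tderiv S q v hu * z2 q) * \<beta> q)"
    and dC: "tderiv S q v (C Z) = tderiv S q v (\<lambda>r. tderiv S r (Z r) \<beta>)
      + ((hu q * z2 q) * tderiv S q v \<alpha> + (hu q * tderiv S q v z2 + tderiv S q v hu * z2 q) * \<alpha> q)"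
    if "smooth_vfield S V Z" "z2 = (\<lambda>r. Z r c $ 2)" for v Z z2
    using dcoef[OF that s\<alpha> neg(1), of v] dcoef[OF that s\<beta> s\<alpha>, of v]
    by (simp_all add: A_def[abs_def] C_def[abs_def] that(2) neg(2))
  have LA: "tderiv S q (X q) (A Y) - tderiv S q (Y q) (A X) =
     tderiv S q (lie_bracket S X Y q) \<alpha> - (tderiv S q (X q) hu * y2 q - tderiv S q (Y q) hu * x2 q) * \<beta> q
     - hu q * (tderiv S q (X q) y2 - tderiv S q (Y q) x2) * \<beta> q
     - hu q * (y2 q * tderiv S q (X q) \<beta> - x2 q * tderiv S q (Y q) \<beta>)"
    unfolding dA[OF Y' y2_eq] dA[OF X' x2_eq]
    using tderiv_commutator[OF V(1,2) s\<alpha> X' Y'] by (simp add: algebra_simps)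
  have LC: "tderiv S q (X q) (C Y) - tderiv S q (Y q) (C X) =
     tderiv S q (lie_bracket S X Y q) \<beta> + (tderiv S q (X q) hu * y2 q - tderiv S q (Y q) hu * x2 q) * \<alpha> q
     + hu q * (tderiv S q (X q) y2 - tderiv S q (Y q) x2) * \<alpha> q
     + hu q * (y2 q * tderiv S q (X q) \<alpha> - x2 q * tderiv S q (Y q) \<alpha>)"
    unfolding dC[OF Y' y2_eq] dC[OF X' x2_eq]
    using tderiv_commutator[OF V(1,2) s\<beta> X' Y'] by (simp add: algebra_simps)
  \<comment> \<open>Through this identity the bracket term of the curvature cancels the derivatives
    of \<open>x2\<close> and \<open>y2\<close>.\<close>
  have Lc: "lie_bracket S X Y q c $ 2 = tderiv S q (X q) y2 - tderiv S q (Y q) x2"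
  proof -
    have mv: "mdiff q (\<lambda>r. Z r c)" if "smooth_vfield S V Z" for Z
      using m[of "\<lambda>r. Z r c"] smooth_vfield_component[OF that c] V(3) by (simp add: inf.absorb2)
    show ?thesis
      unfolding x2_def y2_def tderiv_linear[OF bounded_linear_vec_nth mv[OF X']] tderiv_linear[OF bounded_linear_vec_nth mv[OF Y']]
      using c W(3) by (simp add: lie_bracket_def)
  qed
  define \<Delta> where "\<Delta> = X q c $ 1 * Y q c $ 2 - X q c $ 2 * Y q c $ 1"
  define huu where "huu = tderiv S q (coord_field S c 1 q) hu"
  have dhu: "tderiv S q v hu = v c $ 1 * huu + v c $ 2 * tderiv S q (coord_field S c 2 q) hu"
    if v: "v \<in> tangent_space S q" for v
  proof -
    have "v = (v c $ 1) *\<^sub>R coord_field S c 1 q + (v c $ 2) *\<^sub>R coord_field S c 2 q"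
      using tangent_coord_expansion[OF v c W(3)] by (simp add: sum_2)
    from arg_cong[OF this, of "\<lambda>v. tderiv S q v hu"] show ?thesis
      unfolding tderiv_vec_add[OF m[OF huV]] by (simp add: huu_def)
  qed
  \<comment> \<open>Antisymmetrisation removes the v-derivative of hu, and only its u-derivative
    remains.\<close>
  have D: "tderiv S q (X q) hu * y2 q - tderiv S q (Y q) hu * x2 q = huu * \<Delta>"
    unfolding dhu[OF tX] dhu[OF tY] by (simp add: \<Delta>_def x2_def y2_def algebra_simps)
  have "riemann_curvature S nablaS X Y Y q = (- (huu * \<Delta> * \<beta> q)) *\<^sub>R e1 q + (huu * \<Delta> * \<alpha> q) *\<^sub>R e2 q"
  proof -
    have "riemann_curvature S nablaS X Y Y q =
       ((tderiv S q (X q) (A Y) - tderiv S q (Y q) (A X)) - hu q * x2 q * C Y q + hu q * y2 q * C X q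
         - (tderiv S q (lie_bracket S X Y q) \<alpha> - hu q * lie_bracket S X Y q c $ 2 * \<beta> q)) *\<^sub>R e1 q
       + ((tderiv S q (X q) (C Y) - tderiv S q (Y q) (C X)) + hu q * x2 q * A Y q - hu q * y2 q * A X q
         - (tderiv S q (lie_bracket S X Y q) \<beta> + hu q * lie_bracket S X Y q c $ 2 * \<alpha> q)) *\<^sub>R e2 q"
      unfolding riemann_curvature_def nab2[OF Y' tX] nab2[OF X' tY] nab[OF V(2) tL]
      by (simp add: x2_def y2_def algebra_simps)
    also have "((tderiv S q (X q) (A Y) - tderiv S q (Y q) (A X)) - hu q * x2 q * C Y q + hu q * y2 q * C X q
         - (tderiv S q (lie_bracket S X Y q) \<alpha> - hu q * lie_bracket S X Y q c $ 2 * \<beta> q)) = - (huu * \<Delta> * \<beta> q)"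
      unfolding LA Lc D by (simp add: C_def x2_def y2_def algebra_simps)
    also have "((tderiv S q (X q) (C Y) - tderiv S q (Y q) (C X)) + hu q * x2 q * A Y q - hu q * y2 q * A X q
         - (tderiv S q (lie_bracket S X Y q) \<beta> + hu q * lie_bracket S X Y q c $ 2 * \<alpha> q)) = huu * \<Delta> * \<alpha> q"
      unfolding LC Lc D by (simp add: A_def x2_def y2_def algebra_simps)
    finally show ?thesis .
  qed
  moreover have "X q = (X q c $ 1) *\<^sub>R e1 q + (X q c $ 2 / k q) *\<^sub>R e2 q"
    by (rule coord_expansion[OF W(3) tX])
  ultimately have num: "gS q (riemann_curvature S nablaS X Y Y q) (X q) =
      - (huu * \<Delta> * \<beta> q) * (X q c $ 1) + (huu * \<Delta> * \<alpha> q) * (X q c $ 2 / k q)"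
    using g_frame_combination[OF qU] by metis
  have kq: "k q > 0" by (rule k_pos[OF W(3)])
  \<comment> \<open>The numerator contains \<Delta> a second time, so \<Delta>^2 cancels against the
    Gram determinant and the quotient is the same for all pairs of fields.\<close>
  have num': "gS q (riemann_curvature S nablaS X Y Y q) (X q) = - (huu * \<Delta>\<^sup>2 / k q)"
    unfolding num using kq by (simp add: \<alpha>_def \<beta>_def \<Delta>_def field_simps power2_eq_square)
  have den: "gS q (X q) (X q) * gS q (Y q) (Y q) - (gS q (X q) (Y q))\<^sup>2 = (\<Delta> / k q)\<^sup>2"
    unfolding metric_coordinates[OF W(3) tX tX] metric_coordinates[OF W(3) tY tY] metric_coordinates[OF W(3) tX tY]
    using kq by (simp add: \<Delta>_def field_simps power2_eq_square)
  have "\<Delta> \<noteq> 0"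
    unfolding \<Delta>_def det2_def[symmetric]
  proof (rule det2_nonzeroI, rule indep)
    fix s t assume "s *\<^sub>R X q c + t *\<^sub>R Y q c = 0"
    then show "s *\<^sub>R X q + t *\<^sub>R Y q = 0"
      by (intro tangent_eqI[OF tangent_add[OF qS tangent_scale[OF qS tX] tangent_scale[OF qS tY]] tangent_zero[OF qS] c W(3)])
        (simp add: scaleR_fun_def)
  qed
  then have "gS q (riemann_curvature S nablaS X Y Y q) (X q) /
      (gS q (X q) (X q) * gS q (Y q) (Y q) - (gS q (X q) (Y q))\<^sup>2) = - (huu * k q)"
    unfolding num' den using kq by (simp add: field_simps power2_eq_square)
  then show ?thesis
    using hu_u[OF W(3)] by (simp add: huu_def)
qed

text \<open>\<open>curvature_value\<close> shows that the described number has the required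
  property; uniqueness needs one admissible pair of fields, and the frame provides it.\<close>

lemma gauss_curvature_eq:
  assumes q: "q \<in> fst c"
  shows "gauss_curvature S gS nablaS q = - (partial_deriv c 1 B q + (B q)\<^sup>2)"
  unfolding gauss_curvature_def
proof (rule the_equality)
  show "\<forall>W X Y. opens S W \<and> q \<in> W \<and> smooth_vfield S W X \<and> smooth_vfield S W Y \<and>
     (\<forall>a b. a *\<^sub>R X q + b *\<^sub>R Y q = 0 \<longrightarrow> a = 0 \<and> b = 0) \<longrightarrow>
     - (partial_deriv c 1 B q + (B q)\<^sup>2) = gS q (riemann_curvature S nablaS X Y Y q) (X q) /
           (gS q (X q) (X q) * gS q (Y q) (Y q) - (gS q (X q) (Y q))\<^sup>2)"
    using curvature_value[OF _ _ q, symmetric] by blast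
next
  fix K
  assume K: "\<forall>W X Y. opens S W \<and> q \<in> W \<and> smooth_vfield S W X \<and> smooth_vfield S W Y \<and>
     (\<forall>a b. a *\<^sub>R X q + b *\<^sub>R Y q = 0 \<longrightarrow> a = 0 \<and> b = 0) \<longrightarrow>
     K = gS q (riemann_curvature S nablaS X Y Y q) (X q) /
           (gS q (X q) (X q) * gS q (Y q) (Y q) - (gS q (X q) (Y q))\<^sup>2)"
  have qU: "q \<in> U" by (rule c_U[OF q])
  have indep: "s = 0 \<and> t = 0" if "s *\<^sub>R e1 q + t *\<^sub>R e2 q = 0" for s t
  proof -
    have "gS q 0 (e1 q) = s" "gS q 0 (e2 q) = t" using g_frame[OF qU, of s t] that by simp_all
    then show ?thesis using g_zero[OF U_points[OF qU]] e_tangent[OF qU] by simp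
  qed
  have "K = gS q (riemann_curvature S nablaS e1 e2 e2 q) (e1 q) /
           (gS q (e1 q) (e1 q) * gS q (e2 q) (e2 q) - (gS q (e1 q) (e2 q))\<^sup>2)"
    using K U qU e1 e2 indep by blast
  then show "K = - (partial_deriv c 1 B q + (B q)\<^sup>2)"
    using curvature_value[OF U qU q e1 e2 indep] by simp
qed

end

section \<open>Surfaces of prescribed angle\<close>

locale PA_frame = riemannian_submanifold M g nabla S + SC: levi_civita_mfd S gS nablaS
  for M :: "('a, 3) manifold" and g and nabla and S :: "('a, 2) manifold" and gS and nablaS +
  fixes N V :: "('a, 3) vfield" and T e1 e2 :: "('a, 2) vfield"
    and A :: "'a \<Rightarrow> ('a, 2) tangent \<Rightarrow> ('a, 2) tangent"
    and \<theta> f \<kappa>1 \<kappa>2 B :: "'a \<Rightarrow> real" and U :: "'a set"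
  assumes PA: "PA_surface M g S N V \<theta>"
    and gS: "gS = induced_metric M S g"
    and A: "shape_operator M S nabla N A"
    and anti_torqued: "anti_torqued_along M g nabla S V f"
    and \<theta>_nonzero: "\<forall>p\<in>points S. \<theta> p \<noteq> 0"
    and T: "tangential_component M S N V \<theta> T"
    and U: "opens S U"
    and frame: "smooth_vfield S U e1" "smooth_vfield S U e2"
      "\<forall>p\<in>U. gS p (e1 p) (e1 p) = 1 \<and> gS p (e2 p) (e2 p) = 1 \<and> gS p (e1 p) (e2 p) = 0"
    and principal: "\<forall>p\<in>U. A p (e1 p) = \<kappa>1 p *\<^sub>R e1 p \<and> A p (e2 p) = \<kappa>2 p *\<^sub>R e2 p"
    and T_e1: "\<forall>p\<in>U. T p = sin (\<theta> p) *\<^sub>R e1 p"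
    and B: "\<forall>p\<in>U. B p = (f p + \<kappa>2 p * cos (\<theta> p)) / sin (\<theta> p)"
begin

text \<open>Positivity of the induced metric rests on injectivity of the differential of the
  inclusion; the other algebraic rules are inherited by linearity.\<close>

sublocale frm: framed_surface S gS nablaS U e1 e2
proof
  fix p x y z and s t :: real assume p: "p \<in> points S"
  note i = incl_tangent[OF p]
  show "gS p x y = gS p y x"
    unfolding gS induced_metric_def by (rule M.g_sym[OF points_subset[OF p] i i])
  show "gS p (s *\<^sub>R x + t *\<^sub>R y) z = s * gS p x z + t * gS p y z"
    unfolding gS induced_metric_def incl_linear[OF p] by (rule M.g_lin[OF points_subset[OF p] i i i])
  assume x: "x \<in> tangent_space S p" "x \<noteq> 0"
  have z: "0 *\<^sub>R x \<in> tangent_space S p" by (rule S.tangent_scale[OF p x(1)])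
  have "incl_diff M S p x \<noteq> 0"
  proof
    assume "incl_diff M S p x = 0"
    then have "incl_diff M S p x = incl_diff M S p (0 *\<^sub>R x)"
      using incl_scale[OF p, of 0 x] by (simp only: scaleR_zero_left)
    from incl_inj[OF p x(1) z this] x(2) show False by (simp only: scaleR_zero_left)
  qed
  then show "gS p x x > 0"
    unfolding gS induced_metric_def by (rule M.g_pos[OF points_subset[OF p] i])
qed (use U frame in auto)

lemma frame_ambient:
  assumes p: "p \<in> U"
  shows "p \<in> points S" "p \<in> points M"
    "N p \<in> tangent_space M p" "V p \<in> tangent_space M p"
    "g p (incl_diff M S p (e1 p)) (incl_diff M S p (e1 p)) = 1"
    "g p (incl_diff M S p (e2 p)) (incl_diff M S p (e2 p)) = 1"
    "g p (incl_diff M S p (e1 p)) (incl_diff M S p (e2 p)) = 0"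
    "V p = sin (\<theta> p) *\<^sub>R incl_diff M S p (e1 p) + cos (\<theta> p) *\<^sub>R N p"
    "g p (V p) (N p) = cos (\<theta> p)" "g p (V p) (V p) = 1" "g p (N p) (N p) = 1" "sin (\<theta> p) > 0"
    "x \<in> tangent_space S p \<Longrightarrow> g p (N p) (incl_diff M S p x) = 0"
proof -
  show pS: "p \<in> points S" by (rule frm.U_points[OF p])
  show "p \<in> points M" by (rule points_subset[OF pS])
  have PA': "unit_normal M S g N" "unit_vfield_along M S g V"
    "\<forall>p\<in>points S. \<theta> p \<in> {0..pi/2} \<and> g p (V p) (N p) = cos (\<theta> p)"
    using PA unfolding PA_surface_def by blast+
  have N': "unit_vfield_along M S g N" "\<forall>p\<in>points S. \<forall>x\<in>tangent_space S p. g p (N p) (incl_diff M S p x) = 0"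
    using PA'(1) unfolding unit_normal_def by blast+
  show "N p \<in> tangent_space M p" "V p \<in> tangent_space M p" "g p (V p) (V p) = 1" "g p (N p) (N p) = 1"
    using N'(1) PA'(2) pS unfolding unit_vfield_along_def vfield_along_def by blast+
  show "g p (incl_diff M S p (e1 p)) (incl_diff M S p (e1 p)) = 1"
    "g p (incl_diff M S p (e2 p)) (incl_diff M S p (e2 p)) = 1"
    "g p (incl_diff M S p (e1 p)) (incl_diff M S p (e2 p)) = 0"
    using frm.orthonormal[OF p] unfolding gS induced_metric_def by simp_all
  have "\<forall>p\<in>points S. V p = incl_diff M S p (T p) + cos (\<theta> p) *\<^sub>R N p"
    using T unfolding tangential_component_def by (rule conjunct2)
  from bspec[OF this pS] have "V p = incl_diff M S p (T p) + cos (\<theta> p) *\<^sub>R N p" .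
  also have "T p = sin (\<theta> p) *\<^sub>R e1 p" using T_e1 p by blast
  finally show "V p = sin (\<theta> p) *\<^sub>R incl_diff M S p (e1 p) + cos (\<theta> p) *\<^sub>R N p"
    by (simp only: incl_scale[OF pS])
  show "g p (V p) (N p) = cos (\<theta> p)" using PA'(3) pS by blast
  \<comment> \<open>Nonvanishing places \<theta> in (0, pi/2], where the sine is positive; the
    cancellations of sin \<theta> below rely on this.\<close>
  have "0 \<le> \<theta> p" "\<theta> p \<le> pi / 2" "\<theta> p \<noteq> 0" using PA'(3) \<theta>_nonzero pS by auto
  then show "sin (\<theta> p) > 0" by (intro sin_gt_zero) (auto intro: order.strict_trans1)
  show "x \<in> tangent_space S p \<Longrightarrow> g p (N p) (incl_diff M S p x) = 0" using N'(2) pS by blast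
qed

lemma angle_mdiff:
  assumes "p \<in> points S"
  shows "S.mdiff p \<theta>"
proof -
  have "smooth_fun S (points S) \<theta>"
    using PA unfolding PA_surface_def by blast
  then show ?thesis by (rule S.smooth_fun_mdiff[OF _ openin_topspace assms])
qed

lemma along_mdiff:
  assumes c: "c \<in> charts M" "p \<in> fst c" and p: "p \<in> points S"
  shows "S.mdiff p (\<lambda>q. V q c)" "S.mdiff p (\<lambda>q. N q c)"
proof -
  have "vfield_along M S N" "vfield_along M S V"
    using PA unfolding PA_surface_def unit_normal_def unit_vfield_along_def by blast+
  then have "smooth_fun S (fst c \<inter> points S) (\<lambda>q. N q c)" "smooth_fun S (fst c \<inter> points S) (\<lambda>q. V q c)"
    using c(1) unfolding vfield_along_def by blast+
  then show "S.mdiff p (\<lambda>q. V q c)" "S.mdiff p (\<lambda>q. N q c)"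
    using S.smooth_fun_mdiff[OF _ chart_restrict_open[OF c(1)], of _ p] c(2) p by blast+
qed

text \<open>The anti-torqued identity and the shape operator equation have tangent vectors on their
  right sides, so they transfer to the derivative in the fixed chart. The right sides are arranged
  as linear combinations to suit linearity of the metric.\<close>

lemma
  assumes c: "c \<in> charts M" "p \<in> fst c" and p: "p \<in> points S" and x: "x \<in> tangent_space S p"
  shows chart_covderiv_V: "chart_covderiv c V p x =
      f p *\<^sub>R incl_diff M S p x + (- (f p * g p (incl_diff M S p x) (V p))) *\<^sub>R V p"
    and chart_covderiv_N: "chart_covderiv c N p x = (- 1) *\<^sub>R incl_diff M S p (A p x)"
proof -
  have pM: "p \<in> points M" by (rule points_subset[OF p])
  have "vfield_along M S V"
    using PA unfolding PA_surface_def unit_vfield_along_def by blast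
  then have V: "V p \<in> tangent_space M p" using p unfolding vfield_along_def by blast
  have "covderiv_along M S nabla V p x = f p *\<^sub>R (incl_diff M S p x - g p (incl_diff M S p x) (V p) *\<^sub>R V p)"
    using anti_torqued p x unfolding anti_torqued_along_def by blast
  also have "\<dots> = f p *\<^sub>R incl_diff M S p x + (- (f p * g p (incl_diff M S p x) (V p))) *\<^sub>R V p"
    by (simp add: scaleR_diff_right)
  finally have eqV: "covderiv_along M S nabla V p x =
      f p *\<^sub>R incl_diff M S p x + (- (f p * g p (incl_diff M S p x) (V p))) *\<^sub>R V p" .
  have "covderiv_along M S nabla V p x \<in> tangent_space M p"
    unfolding eqV by (intro M.tangent_add M.tangent_scale pM incl_tangent p V)
  from covderiv_along_eq_chart_covderiv[OF c p this] eqV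
  show "chart_covderiv c V p x = f p *\<^sub>R incl_diff M S p x + (- (f p * g p (incl_diff M S p x) (V p))) *\<^sub>R V p"
    by (simp only:)
  have "incl_diff M S p (A p x) = - covderiv_along M S nabla N p x"
    using A p x unfolding shape_operator_def by blast
  then have eqN: "covderiv_along M S nabla N p x = (- 1) *\<^sub>R incl_diff M S p (A p x)"
    by (simp only: scaleR_minus_left scaleR_one minus_minus)
  have "covderiv_along M S nabla N p x \<in> tangent_space M p"
    unfolding eqN by (intro M.tangent_scale pM incl_tangent p)
  from covderiv_along_eq_chart_covderiv[OF c p this] eqN
  show "chart_covderiv c N p x = (- 1) *\<^sub>R incl_diff M S p (A p x)"
    by (simp only:)
qed

text \<open>Everything follows from differentiating known scalar products in one fixed chart: <V, N>
  gives the derivatives of \<theta>, <V, E2> and <N, E2> give <E1, D E2>, and orthonormality with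
  vanishing torsion turns the latter into the components of the bracket.\<close>

lemma frame_equations:
  assumes p: "p \<in> U"
  shows "tderiv S p (e1 p) \<theta> = \<kappa>1 p + f p * cos (\<theta> p)" "tderiv S p (e2 p) \<theta> = 0"
    "lie_bracket S e1 e2 p = - (B p *\<^sub>R e2 p)"
proof -
  note F = frame_ambient[OF p]
  let ?E1 = "incl_diff M S p (e1 p)" and ?E2 = "incl_diff M S p (e2 p)"
  define c where "c = chart_at M p"
  have c: "c \<in> charts M" "p \<in> fst c" using M.chart_at[OF F(2)] by (auto simp: c_def)
  note pS = F(1) and pM = F(2) and tN = F(3) and tV = F(4)
  note te = frm.e_tangent[OF p]
  note tE = incl_tangent[OF pS]
  let ?D = "chart_covderiv c"
  define E1 where "E1 q = incl_diff M S q (e1 q)" for q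
  define E2 where "E2 q = incl_diff M S q (e2 q)" for q
  have Ep: "E1 p = ?E1" "E2 p = ?E2" by (simp_all add: E1_def E2_def)
  have tD: "?D X p x \<in> tangent_space M p" for X x by (rule chart_covderiv_tangent[OF c pS])
  note lin = M.g_lin[OF pM] and sym = M.g_sym[OF pM]
  have mE: "S.mdiff p (\<lambda>q. E1 q c)" "S.mdiff p (\<lambda>q. E2 q c)"
    unfolding E1_def E2_def
    by (rule incl_mdiff[OF c pS U p frame(1)], rule incl_mdiff[OF c pS U p frame(2)])
  note mV = along_mdiff(1)[OF c pS] and mN = along_mdiff(2)[OF c pS]
  have metric: "tderiv S p x (\<lambda>q. g q (X q) (Y q)) = g p (?D X p x) (Y p) + g p (X p) (?D Y p x)"
    if "x \<in> tangent_space S p" "\<And>q. q \<in> U \<Longrightarrow> X q \<in> tangent_space M q" "\<And>q. q \<in> U \<Longrightarrow> Y q \<in> tangent_space M q"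
      "S.mdiff p (\<lambda>q. X q c)" "S.mdiff p (\<lambda>q. Y q c)" for x X Y
    by (rule chart_covderiv_metric[OF c pS that(1) U p that(2,3,4,5)])
  have tUN: "N q \<in> tangent_space M q" and tUV: "V q \<in> tangent_space M q" and tUE1: "E1 q \<in> tangent_space M q"
    and tUE2: "E2 q \<in> tangent_space M q" if "q \<in> U" for q
    using frame_ambient[OF that] incl_tangent by (simp_all add: E1_def E2_def)
  have const: "g p (?D X p x) (Y p) + g p (X p) (?D Y p x) = 0"
    if "x \<in> tangent_space S p" "\<And>q. q \<in> U \<Longrightarrow> X q \<in> tangent_space M q" "\<And>q. q \<in> U \<Longrightarrow> Y q \<in> tangent_space M q"
      "S.mdiff p (\<lambda>q. X q c)" "S.mdiff p (\<lambda>q. Y q c)" "\<And>q. q \<in> U \<Longrightarrow> g q (X q) (Y q) = k" for x X Y k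
    using metric[OF that(1-5)] S.tderiv_cong[OF U p, of "\<lambda>q. g q (X q) (Y q)" "\<lambda>q. k" x] that(6)
    by (simp add: S.tderiv_const)
  have gNE: "g p (N p) ?E1 = 0" "g p (N p) ?E2 = 0" "g p ?E1 (N p) = 0" "g p ?E2 (N p) = 0"
    using F(13)[OF te(1)] F(13)[OF te(2)] sym[OF tN tE, of "e1 p"] sym[OF tN tE, of "e2 p"] by simp_all
  have gVx: "g p (V p) v = sin (\<theta> p) * g p ?E1 v + cos (\<theta> p) * g p (N p) v" if "v \<in> tangent_space M p" for v
    by (subst F(8)) (rule lin[OF tE tN that])
  have gV: "g p (V p) ?E1 = sin (\<theta> p)" "g p (V p) ?E2 = 0"
    using gVx[OF tE, of "e1 p"] gVx[OF tE, of "e2 p"] gNE F(5,7) by simp_all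
  have gV': "g p ?E1 (V p) = sin (\<theta> p)" "g p ?E2 (V p) = 0"
    using gV sym[OF tV tE, of "e1 p"] sym[OF tV tE, of "e2 p"] by simp_all
  have DV: "g p (?D V p x) v = f p * g p (incl_diff M S p x) v - f p * g p (incl_diff M S p x) (V p) * g p (V p) v"
    if "x \<in> tangent_space S p" "v \<in> tangent_space M p" for x v
    unfolding chart_covderiv_V[OF c pS that(1)] lin[OF tE tV that(2)] by simp
  have A1: "incl_diff M S p (A p (e1 p)) = \<kappa>1 p *\<^sub>R ?E1" and A2: "incl_diff M S p (A p (e2 p)) = \<kappa>2 p *\<^sub>R ?E2"
    using principal p incl_scale[OF pS] by simp_all
  have DN: "?D N p (e1 p) = (- \<kappa>1 p) *\<^sub>R ?E1" "?D N p (e2 p) = (- \<kappa>2 p) *\<^sub>R ?E2"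
    unfolding chart_covderiv_N[OF c pS te(1)] chart_covderiv_N[OF c pS te(2)] A1 A2 by simp_all
  have gDN: "g p (?D N p (e1 p)) v = - \<kappa>1 p * g p ?E1 v" "g p (?D N p (e2 p)) v = - \<kappa>2 p * g p ?E2 v"
    "g p v (?D N p (e1 p)) = - \<kappa>1 p * g p v ?E1" "g p v (?D N p (e2 p)) = - \<kappa>2 p * g p v ?E2"
    if "v \<in> tangent_space M p" for v
    unfolding DN by (rule M.g_scale[OF pM tE that] M.g_scale_right[OF pM tE that])+
  have angle: "- sin (\<theta> p) * tderiv S p x \<theta> = g p (?D V p x) (N p) + g p (V p) (?D N p x)"
    if x: "x \<in> tangent_space S p" for x
  proof -
    have "tderiv S p x (\<lambda>q. g q (V q) (N q)) = tderiv S p x (\<lambda>q. cos (\<theta> q))"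
      by (rule S.tderiv_cong[OF U p frame_ambient(9)])
    also have "\<dots> = - sin (\<theta> p) * tderiv S p x \<theta>"
      by (rule S.tderiv_real_compose[OF pS angle_mdiff[OF pS]]) (auto intro!: derivative_eq_intros)
    finally show ?thesis using metric[OF x tUV tUN mV mN] by simp
  qed
  \<comment> \<open>Here <D V, N> = - f sin \<theta> cos \<theta> and <V, D N> = -
    \<open>\<kappa>1\<close> sin \<theta>. Along \<open>e2\<close> both products vanish.\<close>
  have "sin (\<theta> p) * tderiv S p (e1 p) \<theta> = sin (\<theta> p) * (\<kappa>1 p + f p * cos (\<theta> p))"
    using angle[OF te(1)] unfolding DV[OF te(1) tN] gDN(3)[OF tV] gV gV' gNE F(9) by (simp add: algebra_simps)
  then show "tderiv S p (e1 p) \<theta> = \<kappa>1 p + f p * cos (\<theta> p)" using F(12) by simp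
  have "sin (\<theta> p) * tderiv S p (e2 p) \<theta> = 0"
    using angle[OF te(2)] unfolding DV[OF te(2) tN] gDN(4)[OF tV] gV gV' gNE F(9) by simp
  then show "tderiv S p (e2 p) \<theta> = 0" using F(12) by simp
  have VE2: "g q (V q) (E2 q) = 0" if q: "q \<in> U" for q
  proof -
    note G = frame_ambient[OF q]
    show ?thesis
      unfolding E2_def
      by (subst G(8), subst M.g_lin[OF G(2) incl_tangent[OF G(1)] G(3) incl_tangent[OF G(1)]])
        (simp add: G(7) G(13)[OF frm.e_tangent(2)[OF q]])
  qed
  have NE2: "g q (N q) (E2 q) = 0" and E12: "g q (E1 q) (E2 q) = 0" and E11: "g q (E1 q) (E1 q) = 1"
    and E22: "g q (E2 q) (E2 q) = 1" if q: "q \<in> U" for q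
    using frame_ambient[OF q] frm.e_tangent(2)[OF q] by (simp_all add: E1_def E2_def)
  \<comment> \<open>The decomposition of V is inserted at p after differentiating, so no derivative
    of sin \<theta> appears; \<open>N2\<close> supplies the unknown <N, D E2>.\<close>
  have V2: "g p (?D V p x) ?E2 + (sin (\<theta> p) * g p ?E1 (?D E2 p x) + cos (\<theta> p) * g p (N p) (?D E2 p x)) = 0"
    and N2: "g p (?D N p x) ?E2 + g p (N p) (?D E2 p x) = 0"
    and 12: "g p (?D E1 p x) ?E2 + g p ?E1 (?D E2 p x) = 0"
    and 11: "g p (?D E1 p x) ?E1 = 0" and 22: "g p (?D E2 p x) ?E2 = 0"
    if x: "x \<in> tangent_space S p" for x
    using const[OF x tUV tUE2 mV mE(2) VE2] const[OF x tUN tUE2 mN mE(2) NE2] const[OF x tUE1 tUE2 mE E12]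
      const[OF x tUE1 tUE1 mE(1) mE(1) E11] const[OF x tUE2 tUE2 mE(2) mE(2) E22]
      gVx[OF tD] sym[OF tE tD, of "e1 p" E1 x] sym[OF tE tD, of "e2 p" E2 x]
    by (simp_all add: Ep)
  have "sin (\<theta> p) * g p ?E1 (?D E2 p (e1 p)) = 0"
    using V2[OF te(1)] N2[OF te(1)] unfolding DV[OF te(1) tE] gDN(1)[OF tE] gV F(7) by simp
  then have e1_12: "g p ?E1 (?D E2 p (e1 p)) = 0" using F(12) by simp
  \<comment> \<open>Here <D V, E2> = f and <N, D E2> = \<open>\<kappa>2\<close>, the two terms in
    the numerator of \<open>B\<close>.\<close>
  have "sin (\<theta> p) * g p ?E1 (?D E2 p (e2 p)) = - (f p + \<kappa>2 p * cos (\<theta> p))"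
    using V2[OF te(2)] N2[OF te(2)] unfolding DV[OF te(2) tE] gDN(2)[OF tE] gV F(6) by (simp add: algebra_simps)
  then have e2_12: "g p ?E1 (?D E2 p (e2 p)) = - B p"
    using F(12) B p by (simp add: field_simps)
  let ?L = "lie_bracket S e1 e2 p"
  have tL: "?L \<in> tangent_space S p" by (rule frm.lie_bracket_tangent[OF U frame(1,2) p])
  \<comment> \<open>The scalars 1 and - 1 bring the difference into the form of the linearity rule
    for the metric.\<close>
  have tor: "incl_diff M S p ?L = 1 *\<^sub>R ?D E2 p (e1 p) + (- 1) *\<^sub>R ?D E1 p (e2 p)"
  proof (rule M.tangent_eqI[OF tE M.tangent_add[OF pM M.tangent_scale[OF pM tD] M.tangent_scale[OF pM tD]] c])
    show "incl_diff M S p ?L c = (1 *\<^sub>R ?D E2 p (e1 p) + (- 1) *\<^sub>R ?D E1 p (e2 p)) c"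
      using chart_covderiv_torsion_free[OF c pS U p frame(1,2)]
      by (simp add: E1_def[abs_def] E2_def[abs_def] scaleR_fun_def)
  qed
  have gL: "gS p ?L v = g p (?D E2 p (e1 p)) (incl_diff M S p v) - g p (?D E1 p (e2 p)) (incl_diff M S p v)" for v
    unfolding gS induced_metric_def tor lin[OF tD tD tE] by simp
  have "gS p ?L (e1 p) = 0"
    unfolding gL using 11[OF te(2)] e1_12 sym[OF tE tD, of "e1 p" E2 "e1 p"] by simp
  moreover have "gS p ?L (e2 p) = - B p"
    unfolding gL using 22[OF te(1)] 12[OF te(2)] e2_12 by simp
  ultimately have "?L = (- B p) *\<^sub>R e2 p"
    using frm.frame_expansion[OF p tL] by simp
  then show "?L = - (B p *\<^sub>R e2 p)" by simp
qed

sublocale adapted_surface S gS nablaS U e1 e2 B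
  by unfold_locales (rule frame_equations(3))

lemma shape_operator_tangent:
  assumes "p \<in> points S" "x \<in> tangent_space S p"
  shows "A p x \<in> tangent_space S p"
  using A assms unfolding shape_operator_def by blast

text \<open>\<open>A\<close> is specified only by its image under the inclusion, which is minus the
  derivative of N. That derivative is linear in the direction, and injectivity of the inclusion
  transfers this to \<open>A\<close>.\<close>

lemma shape_operator_linear:
  assumes p: "p \<in> points S" and x: "x \<in> tangent_space S p" and y: "y \<in> tangent_space S p"
  shows "A p (s *\<^sub>R x + t *\<^sub>R y) = s *\<^sub>R A p x + t *\<^sub>R A p y"
proof (rule incl_inj[OF p])
  define c where "c = chart_at M p"
  have pM: "p \<in> points M" by (rule points_subset[OF p])
  have c: "c \<in> charts M" "p \<in> fst c" using M.chart_at[OF pM] by (auto simp: c_def)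
  have xy: "s *\<^sub>R x + t *\<^sub>R y \<in> tangent_space S p"
    by (intro S.tangent_add S.tangent_scale p x y)
  show "A p (s *\<^sub>R x + t *\<^sub>R y) \<in> tangent_space S p"
    by (rule shape_operator_tangent[OF p xy])
  show "s *\<^sub>R A p x + t *\<^sub>R A p y \<in> tangent_space S p"
    by (intro S.tangent_add S.tangent_scale shape_operator_tangent p x y)
  have inclA: "incl_diff M S p (A p v) = (- 1) *\<^sub>R chart_covderiv c N p v" if "v \<in> tangent_space S p" for v
    unfolding chart_covderiv_N[OF c p that] by simp
  have nab: "nabla (coord_field M c k) p (incl_diff M S p (s *\<^sub>R x + t *\<^sub>R y)) =
      s *\<^sub>R nabla (coord_field M c k) p (incl_diff M S p x) + t *\<^sub>R nabla (coord_field M c k) p (incl_diff M S p y)" for k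
    unfolding incl_linear[OF p]
    by (rule MC.nabla_lin[OF M.chart_open[OF c(1)] M.smooth_vfield_coord_field[OF c(1)] c(2) incl_tangent[OF p] incl_tangent[OF p]])
  have lin: "chart_covderiv c N p (s *\<^sub>R x + t *\<^sub>R y) c = s *\<^sub>R chart_covderiv c N p x c + t *\<^sub>R chart_covderiv c N p y c"
    unfolding chart_covderiv_component[OF c p] nab S.tderiv_vec_add[OF along_mdiff(2)[OF c p]]
    by (simp add: scaleR_fun_def algebra_simps sum.distrib scaleR_sum_right)
  show "incl_diff M S p (A p (s *\<^sub>R x + t *\<^sub>R y)) = incl_diff M S p (s *\<^sub>R A p x + t *\<^sub>R A p y)"
  proof (rule M.tangent_eqI[OF incl_tangent[OF p] incl_tangent[OF p] c])
    have comp: "(a *\<^sub>R v) c = a *\<^sub>R v c" "(v + w) c = v c + w c" for a :: real and v w :: "('a, 3) tangent"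
      by (simp_all add: scaleR_fun_def)
    show "incl_diff M S p (A p (s *\<^sub>R x + t *\<^sub>R y)) c = incl_diff M S p (s *\<^sub>R A p x + t *\<^sub>R A p y) c"
      unfolding incl_linear[OF p] inclA[OF xy] inclA[OF x] inclA[OF y] comp lin by simp
  qed
qed

lemma shape_operator_det:
  assumes p: "p \<in> U"
  shows "endo_det S p (A p) = \<kappa>1 p * \<kappa>2 p"
proof (rule endo_det_eigenbasis[OF S.smooth_manifold])
  show pS: "p \<in> points S" by (rule frm.U_points[OF p])
  show "A p x \<in> tangent_space S p" if "x \<in> tangent_space S p" for x
    by (rule shape_operator_tangent[OF pS that])
  show "A p (a *\<^sub>R x + b *\<^sub>R y) = a *\<^sub>R A p x + b *\<^sub>R A p y"
    if "x \<in> tangent_space S p" "y \<in> tangent_space S p" for x y a b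
    by (rule shape_operator_linear[OF pS that])
  show "e1 p \<in> tangent_space S p" "e2 p \<in> tangent_space S p" by (rule frm.e_tangent[OF p])+
  show "A p (e1 p) = \<kappa>1 p *\<^sub>R e1 p" "A p (e2 p) = \<kappa>2 p *\<^sub>R e2 p" using principal p by auto
  show "det2 (e1 p c) (e2 p c) \<noteq> 0" if "c \<in> charts S" "p \<in> fst c" for c
    by (rule frm.frame_indep[OF p that])
qed

end

text \<open>The symbol for the antiderivative is rendered by an arbitrary G: two choices differ by a
  function of v, which \<open>P\<close> absorbs, so \<open>P\<close> depends on G while the chart
  does not. Existence of some G is asserted separately to exclude a vacuous claim.\<close>

theorem proposition4p1:
  fixes M :: "('a, 3) manifold" and g :: "('a, 3) metric" and nabla :: "('a, 3) connection"
    and S :: "('a, 2) manifold" and gS :: "('a, 2) metric" and nablaS :: "('a, 2) connection"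
    and N V :: "('a, 3) vfield" and T e1 e2 :: "('a, 2) vfield"
    and A :: "'a \<Rightarrow> ('a, 2) tangent \<Rightarrow> ('a, 2) tangent"
    and \<theta> f \<kappa>1 \<kappa>2 B :: "'a \<Rightarrow> real" and U :: "'a set"
  assumes M: "smooth_manifold M" "riemannian_metric M g" "levi_civita M g nabla"
    and PA: "PA_surface M g S N V \<theta>"
    and gS: "gS = induced_metric M S g" and nablaS: "levi_civita S gS nablaS"
    and A: "shape_operator M S nabla N A"
    and anti_torqued: "anti_torqued_along M g nabla S V f"
    and \<theta>_nonzero: "\<forall>p\<in>points S. \<theta> p \<noteq> 0"
    and T: "tangential_component M S N V \<theta> T"
    and U: "opens S U"
    and frame: "smooth_vfield S U e1" "smooth_vfield S U e2"
      "\<forall>p\<in>U. gS p (e1 p) (e1 p) = 1 \<and> gS p (e2 p) (e2 p) = 1 \<and> gS p (e1 p) (e2 p) = 0"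
    and principal: "\<forall>p\<in>U. A p (e1 p) = \<kappa>1 p *\<^sub>R e1 p \<and> A p (e2 p) = \<kappa>2 p *\<^sub>R e2 p"
    and T_e1: "\<forall>p\<in>U. T p = sin (\<theta> p) *\<^sub>R e1 p"
    and B: "\<forall>p\<in>U. B p = (f p + \<kappa>2 p * cos (\<theta> p)) / sin (\<theta> p)"
  shows
    "(\<forall>p\<in>U. tderiv S p (e1 p) \<theta> = \<kappa>1 p + f p * cos (\<theta> p) \<and> tderiv S p (e2 p) \<theta> = 0) \<and>
     (\<forall>p\<in>U. nablaS e1 p (e1 p) = 0 \<and> nablaS e2 p (e1 p) = 0 \<and>
        nablaS e1 p (e2 p) = B p *\<^sub>R e2 p \<and> nablaS e2 p (e2 p) = - (B p *\<^sub>R e1 p) \<and>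
        lie_bracket S e1 e2 p = - (B p *\<^sub>R e2 p)) \<and>
     (\<forall>p0\<in>U. \<exists>c\<in>charts S. p0 \<in> fst c \<and> fst c \<subseteq> U \<and>
        (\<exists>G. antiderivative_u S c B G) \<and>
        (\<forall>G. antiderivative_u S c B G \<longrightarrow>
           (\<exists>P :: real \<Rightarrow> real.
              smooth_on ((\<lambda>q. snd c q $ 2) ` fst c) P \<and>
              (\<forall>q\<in>fst c.
                 P (snd c q $ 2) > 0 \<and>
                 (\<forall>x\<in>tangent_space S q. \<forall>y\<in>tangent_space S q.
                    gS q x y = x c $ 1 * y c $ 1
                      + (P (snd c q $ 2) * exp (G q))\<^sup>2 * (x c $ 2 * y c $ 2)) \<and>
                 e1 q = coord_field S c 1 q \<and>
                 e2 q = inverse (P (snd c q $ 2) * exp (G q)) *\<^sub>R coord_field S c 2 q))) \<and>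
        (\<forall>q\<in>fst c.
           gauss_curvature S gS nablaS q = - (partial_deriv c 1 B q + (B q)\<^sup>2) \<and>
           endo_det S q (A q) = (partial_deriv c 1 \<theta> q - f q * cos (\<theta> q)) * \<kappa>2 q))"
proof -
  have sub: "submanifold M S" using PA unfolding PA_surface_def by (rule conjunct1)
  then have S: "smooth_manifold S" unfolding submanifold_def by (elim conjE)
  interpret PA_frame M g nabla S gS nablaS N V T e1 e2 A \<theta> f \<kappa>1 \<kappa>2 B U
    by unfold_locales (fact M sub S PA gS nablaS A anti_torqued \<theta>_nonzero T U frame principal T_e1 B)+
  show ?thesis
  proof (intro conjI ballI)
    fix p assume p: "p \<in> U"
    show "tderiv S p (e1 p) \<theta> = \<kappa>1 p + f p * cos (\<theta> p)" "tderiv S p (e2 p) \<theta> = 0"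
      "lie_bracket S e1 e2 p = - (B p *\<^sub>R e2 p)"
      by (rule frame_equations[OF p])+
    show "nablaS e1 p (e1 p) = 0" "nablaS e2 p (e1 p) = 0"
      "nablaS e1 p (e2 p) = B p *\<^sub>R e2 p" "nablaS e2 p (e2 p) = - (B p *\<^sub>R e1 p)"
      by (rule nabla_frame[OF p])+
  next
    fix p0 assume p0: "p0 \<in> U"
    show "\<exists>c\<in>charts S. p0 \<in> fst c \<and> fst c \<subseteq> U \<and>
        (\<exists>G. antiderivative_u S c B G) \<and>
        (\<forall>G. antiderivative_u S c B G \<longrightarrow>
           (\<exists>P :: real \<Rightarrow> real.
              smooth_on ((\<lambda>q. snd c q $ 2) ` fst c) P \<and>
              (\<forall>q\<in>fst c.
                 P (snd c q $ 2) > 0 \<and>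
                 (\<forall>x\<in>tangent_space S q. \<forall>y\<in>tangent_space S q.
                    gS q x y = x c $ 1 * y c $ 1
                      + (P (snd c q $ 2) * exp (G q))\<^sup>2 * (x c $ 2 * y c $ 2)) \<and>
                 e1 q = coord_field S c 1 q \<and>
                 e2 q = inverse (P (snd c q $ 2) * exp (G q)) *\<^sub>R coord_field S c 2 q))) \<and>
        (\<forall>q\<in>fst c.
           gauss_curvature S gS nablaS q = - (partial_deriv c 1 B q + (B q)\<^sup>2) \<and>
           endo_det S q (A q) = (partial_deriv c 1 \<theta> q - f q * cos (\<theta> q)) * \<kappa>2 q)"
    proof (rule adapted_chart[OF p0])
      fix c a b and k :: "'a \<Rightarrow> real"
      assume C: "c \<in> charts S" "p0 \<in> fst c" "fst c \<subseteq> U" "snd c ` fst c = box a b" "smooth_fun S (fst c) k"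
        "\<And>q. q \<in> fst c \<Longrightarrow> k q > 0" "\<And>q. q \<in> fst c \<Longrightarrow> e1 q = coord_field S c 1 q"
        "\<And>q. q \<in> fst c \<Longrightarrow> e2 q = k q *\<^sub>R coord_field S c 2 q"
        "\<And>q. q \<in> fst c \<Longrightarrow> partial_deriv c 1 k q = - (B q * k q)"
      interpret adapted_coordinates S gS nablaS U e1 e2 B c a b k
        by unfold_locales (use C in auto)
      show ?thesis
      proof (intro bexI[OF _ C(1)] conjI allI impI ballI C(2,3))
        show "\<exists>G. antiderivative_u S c B G" using antiderivative_exists by blast
      next
        fix G assume "antiderivative_u S c B G"
        then show "\<exists>P :: real \<Rightarrow> real.
              smooth_on ((\<lambda>q. snd c q $ 2) ` fst c) P \<and>
              (\<forall>q\<in>fst c.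
                 P (snd c q $ 2) > 0 \<and>
                 (\<forall>x\<in>tangent_space S q. \<forall>y\<in>tangent_space S q.
                    gS q x y = x c $ 1 * y c $ 1
                      + (P (snd c q $ 2) * exp (G q))\<^sup>2 * (x c $ 2 * y c $ 2)) \<and>
                 e1 q = coord_field S c 1 q \<and>
                 e2 q = inverse (P (snd c q $ 2) * exp (G q)) *\<^sub>R coord_field S c 2 q)"
        proof (rule antiderivative_scale)
          fix P :: "real \<Rightarrow> real"
          assume P: "smooth_on ((\<lambda>q. snd c q $ 2) ` fst c) P"
            "\<And>q. q \<in> fst c \<Longrightarrow> P (snd c q $ 2) * exp (G q) = inverse (k q)"
            "\<And>q. q \<in> fst c \<Longrightarrow> P (snd c q $ 2) > 0"
          show ?thesis
          proof (intro exI[of _ P] conjI ballI P(1))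
            fix q assume q: "q \<in> fst c"
            show "P (snd c q $ 2) > 0" by (rule P(3)[OF q])
            show "e1 q = coord_field S c 1 q" by (rule C(7)[OF q])
            show "e2 q = inverse (P (snd c q $ 2) * exp (G q)) *\<^sub>R coord_field S c 2 q"
              unfolding P(2)[OF q] inverse_inverse_eq by (rule C(8)[OF q])
            fix x y assume "x \<in> tangent_space S q" "y \<in> tangent_space S q"
            then show "gS q x y = x c $ 1 * y c $ 1
                      + (P (snd c q $ 2) * exp (G q))\<^sup>2 * (x c $ 2 * y c $ 2)"
              unfolding P(2)[OF q] by (rule metric_coordinates[OF q])
          qed
        qed
      next
        fix q assume q: "q \<in> fst c"
        then have qU: "q \<in> U" using C(3) by blast
        show "gauss_curvature S gS nablaS q = - (partial_deriv c 1 B q + (B q)\<^sup>2)"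
          by (rule gauss_curvature_eq[OF q])
        \<comment> \<open>Since \<open>e1\<close> is the coordinate field of u, the first derivative
          formula replaces \<open>\<kappa>1\<close> by the u-derivative of \<theta> minus f cos
          \<theta> in the product of the principal curvatures.\<close>
        have "partial_deriv c 1 \<theta> q = tderiv S q (e1 q) \<theta>"
          by (rule S.partial_deriv_tderiv[OF C(1) q angle_mdiff[OF frm.U_points[OF qU]] frm.e_tangent(1)[OF qU] e1_component[OF q]])
        then show "endo_det S q (A q) = (partial_deriv c 1 \<theta> q - f q * cos (\<theta> q)) * \<kappa>2 q"
          using shape_operator_det[OF qU] frame_equations(1)[OF qU] by simp
      qed
    qed
  qed
qed

end
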